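(* Let $m$ be a positive integer, let $\ell_1,\ell_2\in\mathbb{Z}\cup\{\pm\infty\}$, $\ell_1\le\ell_2$, and let $p\in(1,\infty)$. Let $E=\{x_i\}_{i=\ell_1}^{\ell_2}$ be a strictly increasing sequence of points in $\mathbb{R}$, and let $m_E=\min\{m,\#E-1\}$. A function $f:E\to\mathbb{R}$ belongs to $W^m_p(\mathbb{R})|_E$ if and only if the quantity $$\widetilde{\mathcal{W}}_{m,p}(f:E)=\left(\sum_{k=0}^{m_E}\sum_{i=\ell_1}^{\ell_2-k}\min\{1,x_{i+m}-x_i\}\,\bigl|\Delta^kf[x_i,\dots,x_{i+k}]\bigr|^p\right)^{1/p}$$ is finite, where $x_i=+\infty$ for every $i>\ell_2$. Furthermore, $$\|f\|_{W^m_p(\mathbb{R})|_E}\sim\widetilde{\mathcal{W}}_{m,p}(f:E)$$ with constants in this equivalence depending only on $m$ (i.e. each side is at most $C$ times the other, with $C\ge1$ depending only on $m$).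
   Context: $L^m_p(\mathbb{R})$ is the space of functions $F:\mathbb{R}\to\mathbb{R}$ such that $F^{(m-1)}$ exists and is (locally) absolutely continuous and $F^{(m)}\in L_p(\mathbb{R})$. $W^m_p(\mathbb{R})$ is the space of all $F\in L^m_p(\mathbb{R})$ whose derivatives of all orders $0,\dots,m$ belong to $L_p(\mathbb{R})$, normed by $\|F\|_{W^m_p(\mathbb{R})}=\sum_{k=0}^m\|F^{(k)}\|_{L_p(\mathbb{R})}$ (functions are identified with their continuous representatives). The trace space is $W^m_p(\mathbb{R})|_E=\{f:E\to\mathbb{R}:\exists F\in W^m_p(\mathbb{R}),\,F|_E=f\}$ with trace norm $\|f\|_{W^m_p(\mathbb{R})|_E}=\inf\{\|F\|_{W^m_p(\mathbb{R})}:F\in W^m_p(\mathbb{R}),\,F|_E=f\}$. For a $(k+1)$-point set $S=\{x_0,\dots,x_k\}\subset\mathbb{R}$, the $k$-th order divided difference $\Delta^kf[S]=\Delta^kf[x_0,\dots,x_k]$ is the coefficient of $x^k$ in the Lagrange polynomial of degree at most $k$ which agrees with $f$ on $S$. The sequence may be finite, one-sided infinite or bi-infinite; the index $i$ runs over integers.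
   Formalization: The bound of the trace norm by C times W~ is claimed only when the sequence does not have l_2=+infinity with sup E finite; it fails there (m=1, x_i=eps(1-2^-i), f=1, eps->0). The membership criterion and the reverse bound are for all sequences. *)

theory Defs
  imports
    "HOL-Analysis.Analysis"
    "HOL-Computational_Algebra.Polynomial"
    "HOL-Library.Extended"
begin

section \<open>Absolute continuity of functions on the line\<close>

text \<open>The notion \<open>absolutely_continuous\<close> of the library is about measures.\<close>

definition abs_continuous_on :: "real set \<Rightarrow> (real \<Rightarrow> real) \<Rightarrow> bool" where
  "abs_continuous_on S F \<longleftrightarrow>
     (\<forall>\<epsilon>>0. \<exists>\<delta>>0. \<forall>(n::nat) u v.
        (\<forall>j<n. u j \<le> v j \<and> {u j..v j} \<subseteq> S) \<longrightarrow>
        disjoint_family_on (\<lambda>j. {u j<..<v j}) {..<n} \<longrightarrow>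
        (\<Sum>j<n. v j - u j) < \<delta> \<longrightarrow>
        (\<Sum>j<n. \<bar>F (v j) - F (u j)\<bar>) < \<epsilon>)"

definition locally_abs_continuous :: "(real \<Rightarrow> real) \<Rightarrow> bool" where
  "locally_abs_continuous F \<longleftrightarrow> (\<forall>a b. abs_continuous_on {a..b} F)"

section \<open>Lebesgue and Sobolev spaces on the line\<close>

definition Lp_space :: "real \<Rightarrow> (real \<Rightarrow> real) set" where
  "Lp_space p = {g. g \<in> borel_measurable lebesgue \<and> integrable lebesgue (\<lambda>x. \<bar>g x\<bar> powr p)}"

definition Lp_norm :: "real \<Rightarrow> (real \<Rightarrow> real) \<Rightarrow> real" where
  "Lp_norm p g = (LINT x|lebesgue. \<bar>g x\<bar> powr p) powr (1 / p)"

text \<open>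
  Orders below \<open>m\<close> are everywhere-defined classical derivatives. The derivative of order
  \<open>m\<close> exists almost everywhere, because the one of order \<open>m - 1\<close> is locally absolutely
  continuous; on the exceptional null set the value of \<^const>\<open>deriv\<close> is arbitrary, which
  affects neither Lebesgue measurability nor the integrals. Both spaces are meant for
  \<open>m \<ge> 1\<close>.
\<close>

definition sobolev_L :: "nat \<Rightarrow> real \<Rightarrow> (real \<Rightarrow> real) set" where
  "sobolev_L m p = {F.
     (\<forall>k<m - 1. \<forall>x. (deriv ^^ k) F differentiable (at x)) \<and>
     locally_abs_continuous ((deriv ^^ (m - 1)) F) \<and>
     (deriv ^^ m) F \<in> Lp_space p}"

definition sobolev_W :: "nat \<Rightarrow> real \<Rightarrow> (real \<Rightarrow> real) set" where
  "sobolev_W m p = {F \<in> sobolev_L m p. \<forall>k\<le>m. (deriv ^^ k) F \<in> Lp_space p}"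

definition sobolev_W_norm :: "nat \<Rightarrow> real \<Rightarrow> (real \<Rightarrow> real) \<Rightarrow> real" where
  "sobolev_W_norm m p F = (\<Sum>k\<le>m. Lp_norm p ((deriv ^^ k) F))"

text \<open>A function \<open>f : E \<rightarrow> \<real>\<close> is a total function of which only the values on \<open>E\<close> are used.\<close>

definition trace_W :: "nat \<Rightarrow> real \<Rightarrow> real set \<Rightarrow> (real \<Rightarrow> real) set" where
  "trace_W m p E = {f. \<exists>F \<in> sobolev_W m p. \<forall>x\<in>E. F x = f x}"

definition trace_W_norm :: "nat \<Rightarrow> real \<Rightarrow> real set \<Rightarrow> (real \<Rightarrow> real) \<Rightarrow> real" where
  "trace_W_norm m p E f = Inf (sobolev_W_norm m p ` {F \<in> sobolev_W m p. \<forall>x\<in>E. F x = f x})"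

section \<open>Divided differences\<close>

definition lagrange_poly :: "(real \<Rightarrow> real) \<Rightarrow> real set \<Rightarrow> real poly" where
  "lagrange_poly f S = (THE P. degree P \<le> card S - 1 \<and> (\<forall>x\<in>S. poly P x = f x))"

definition divided_diff :: "(real \<Rightarrow> real) \<Rightarrow> real set \<Rightarrow> real" where
  "divided_diff f S = coeff (lagrange_poly f S) (card S - 1)"

lemma lagrange_poly_ex1:
  fixes S :: "real set"
  assumes fin: "finite S" and ne: "S \<noteq> {}"
  shows "\<exists>!P. degree P \<le> card S - 1 \<and> (\<forall>x\<in>S. poly P x = f x)"
proof (rule ex_ex1I)
  have card: "card (S - {x}) = card S - 1" if "x \<in> S" for x
    using that fin by simp
  define L where "L x = (\<Prod>y\<in>S - {x}. [:- y, 1:])" for x :: real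
  define P where "P = (\<Sum>x\<in>S. smult (f x / poly (L x) x) (L x))"
  have deg: "degree (L x) \<le> card S - 1" if "x \<in> S" for x
  proof -
    have "degree (L x) \<le> (\<Sum>y\<in>S - {x}. degree [:- y, 1:])"
      unfolding L_def using degree_prod_sum_le[of "S - {x}" "\<lambda>y. [:- y, 1:]"] fin by (simp add: o_def)
    then show ?thesis using card[OF that] by simp
  qed
  have same: "poly (L x) x \<noteq> 0" if "x \<in> S" for x
    using fin by (auto simp: L_def poly_prod)
  have other: "poly (L y) x = 0" if "x \<in> S" "y \<in> S" "y \<noteq> x" for x y
    using fin that by (auto simp: L_def poly_prod)
  have "degree P \<le> card S - 1"
    unfolding P_def by (intro degree_sum_le fin order_trans[OF degree_smult_le] deg)
  moreover have "poly P x = f x" if x: "x \<in> S" for x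
  proof -
    have "poly P x = (\<Sum>y\<in>S. if y = x then f x else 0)"
      unfolding P_def poly_sum using x same other by (intro sum.cong) auto
    then show ?thesis using fin x by simp
  qed
  ultimately show "\<exists>P. degree P \<le> card S - 1 \<and> (\<forall>x\<in>S. poly P x = f x)" by blast
next
  fix P Q
  assume P: "degree P \<le> card S - 1 \<and> (\<forall>x\<in>S. poly P x = f x)"
    and Q: "degree Q \<le> card S - 1 \<and> (\<forall>x\<in>S. poly Q x = f x)"
  show "P = Q"
  proof (rule ccontr)
    assume "P \<noteq> Q"
    then have nz: "P - Q \<noteq> 0" by simp
    have "S \<subseteq> {x. poly (P - Q) x = 0}" using P Q by auto
    then have "card S \<le> card {x. poly (P - Q) x = 0}"
      by (intro card_mono poly_roots_finite nz)
    also have "\<dots> \<le> degree (P - Q)" by (rule card_poly_roots_bound[OF nz])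
    also have "\<dots> \<le> card S - 1" using P Q by (intro degree_diff_le) auto
    finally have "card S \<le> card S - 1" .
    moreover have "card S > 0" using fin ne by (simp add: card_gt_0_iff)
    ultimately show False by linarith
  qed
qed

section \<open>The functional\<close>

text \<open>The integers \<open>i\<close> with \<open>l\<^sub>1 \<le> i\<close> and \<open>i + k \<le> l\<^sub>2\<close>; for \<open>k = 0\<close> these index the sequence.\<close>

definition indices :: "int extended \<Rightarrow> int extended \<Rightarrow> nat \<Rightarrow> int set" where
  "indices l1 l2 k = {i. l1 \<le> Fin i \<and> Fin (i + int k) \<le> l2}"

definition points :: "int extended \<Rightarrow> int extended \<Rightarrow> (int \<Rightarrow> real) \<Rightarrow> real set" where
  "points l1 l2 x = x ` indices l1 l2 0"

definition ext_point :: "int extended \<Rightarrow> (int \<Rightarrow> real) \<Rightarrow> int \<Rightarrow> ereal" where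
  "ext_point l2 x i = (if Fin i \<le> l2 then ereal (x i) else PInfty)"

text \<open>The case distinction is needed because \<^const>\<open>card\<close> is \<open>0\<close> on infinite sets.\<close>

definition m_of :: "nat \<Rightarrow> real set \<Rightarrow> nat" where
  "m_of m E = (if finite E then min m (card E - 1) else m)"

definition W_sum ::
  "nat \<Rightarrow> real \<Rightarrow> int extended \<Rightarrow> int extended \<Rightarrow> (int \<Rightarrow> real) \<Rightarrow> (real \<Rightarrow> real) \<Rightarrow> ennreal" where
  "W_sum m p l1 l2 x f =
     (\<Sum>k\<le>m_of m (points l1 l2 x). \<Sum>\<^sub>\<infinity>i\<in>indices l1 l2 k.
        e2ennreal (min 1 (ext_point l2 x (i + int m) - ext_point l2 x i)) *
        ennreal (\<bar>divided_diff f (x ` {i..i + int k})\<bar> powr p))"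

definition W_tilde ::
  "nat \<Rightarrow> real \<Rightarrow> int extended \<Rightarrow> int extended \<Rightarrow> (int \<Rightarrow> real) \<Rightarrow> (real \<Rightarrow> real) \<Rightarrow> ennreal" where
  "W_tilde m p l1 l2 x f =
     (if W_sum m p l1 l2 x f = top then top
      else ennreal (enn2real (W_sum m p l1 l2 x f) powr (1 / p)))"

text \<open>
  An infinite sequence may converge to a finite limit from the left. The trace norm is then
  not bounded by a multiple of \<open>W_tilde\<close> with a factor depending on \<open>m\<close> alone: for
  \<open>m = 1\<close>, \<open>x\<^sub>i = \<epsilon> (1 - 2\<^sup>-\<^sup>i)\<close> with \<open>i \<ge> 0\<close>, and \<open>f = 1\<close>, one has
  \<open>W_tilde = \<epsilon> powr (1 / p)\<close>, whereas the trace norm stays above a positive constant as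
  \<open>\<epsilon> \<rightarrow> 0\<close>. This cannot happen if the sequence is a closed set, nor if \<open>l\<^sub>2\<close> is finite.
\<close>

definition right_accumulating ::
  "int extended \<Rightarrow> int extended \<Rightarrow> (int \<Rightarrow> real) \<Rightarrow> bool" where
  "right_accumulating l1 l2 x \<longleftrightarrow>
     l2 = Pinf \<and> points l1 l2 x \<noteq> {} \<and> bdd_above (points l1 l2 x)"

end

theory Submission
  imports Defs
begin

text \<open>
  Necessity. A divided difference of order \<open>k < m\<close> is \<open>F\<^sup>(\<^sup>k\<^sup>) / k!\<close> at a point of its window, and a local Sobolev
  inequality on a piece of the window bounds this value; the one of order \<open>m\<close> is a difference quotient of
  \<open>F\<^sup>(\<^sup>m\<^sup>-\<^sup>1\<^sup>)\<close>. Every point lies in at most \<open>m + 1\<close> windows. Since \<open>F\<^sup>(\<^sup>m\<^sup>-\<^sup>1\<^sup>)\<close> is only locally absolutely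
  continuous, this needs Lebesgue's theorem that such a function is differentiable almost everywhere and
  is the integral of its derivative.

  Sufficiency. A finite end of the sequence is prolonged by points at distance one carrying the value zero,
  so that the sequence becomes bi-infinite. Gaps of length at least \<open>1 / m\<close> are called big. Each point \<open>y j\<close>
  gets a polynomial \<open>Q j\<close> that interpolates at up to \<open>m\<close> consecutive points among which there is no big gap,
  and on the gap between \<open>y j\<close> and \<open>y (j + 1)\<close> one passes smoothly from \<open>Q j\<close> to \<open>Q (j + 1)\<close>, through zero
  if the gap is big. The windows are chosen so that, when passing from the window of \<open>i\<close> to that of \<open>i + 1\<close>,
  the change happens in the longest gap between \<open>y i\<close> and \<open>y (i + m)\<close>; as in de Boor's construction the
  change \<open>(y (i + m) - y i) \<Delta>\<^sup>m f \<Prod> (x - y (i + l))\<close> then has derivatives bounded by \<open>\<Delta>\<^sup>m f\<close>. The weights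
  look to the right, so what is needed to the left of a cluster is bounded by the function just
  constructed to the right of it. At a finite accumulation point the function is continued by its Taylor
  polynomial times a cutoff.
\<close>

section \<open>Absolutely continuous functions\<close>

text \<open>The threshold \<open>1 / m\<close> makes \<open>m\<close> consecutive gaps that are not
  big span at most length one, so that every window in use lives at a scale where
  \<open>L ^ m \<le> L ^ k\<close> for \<open>k \<le> m\<close>. The gaps added by the prolongation
  have length at least one and are therefore big: windows without a big gap never mix the data with
  the added zeros. Changing the polynomial in a gap of length \<open>g\<close> costs
  \<open>g ^ k\<close> in the denominator of the \<open>k\<close>-th derivative, while the change
  itself gains powers of the window length \<open>L\<close>; the two balance only if
  \<open>L \<le> m * g\<close>, which is the reason for the longest gap. The constant has to be
  independent of \<open>p\<close>, so all bounds are kept in the form \<open>C powr p\<close> times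
  an integral; a factor left outside the power is at least one and is moved inside because
  \<open>1 < p\<close>. A finite limit of the knots on the left still leaves a unit interval to the
  right of it, if the knots are unbounded above; then the continuation has a constant depending on
  \<open>m\<close> only. If the knots have a finite limit on the right, the room behind a big gap
  may be arbitrarily short, and only membership is obtained.\<close>

lemma vitali_covering_intervals:
  fixes S :: "real set" and K :: "(real \<times> real) set"
  assumes "\<And>x d. \<lbrakk>x \<in> S; 0 < d\<rbrakk> \<Longrightarrow> \<exists>u v. (u, v) \<in> K \<and> u \<le> x \<and> x \<le> v \<and> u < v \<and> v - u < d"
  obtains C where "countable C" "C \<subseteq> K" "\<forall>i\<in>C. fst i < snd i"
    "pairwise (\<lambda>i j. disjnt {fst i..snd i} {fst j..snd j}) C"
    "negligible (S - (\<Union>i\<in>C. {fst i..snd i}))"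
proof -
  define a where "a i = (fst i + snd i) / 2" for i :: "real \<times> real"
  define r where "r i = (snd i - fst i) / 2" for i :: "real \<times> real"
  define K' where "K' = {i \<in> K. fst i < snd i}"
  have ball: "cball (a i) (r i) = {fst i..snd i}" for i
    by (auto simp: a_def r_def cball_eq_atLeastAtMost field_simps)
  have "\<And>i. i \<in> K' \<Longrightarrow> 0 < r i" by (auto simp: K'_def r_def)
  moreover have "\<exists>i. i \<in> K' \<and> x \<in> cball (a i) (r i) \<and> r i < d" if xd: "x \<in> S" "0 < d" for x d
  proof -
    obtain u v where "(u, v) \<in> K \<and> u \<le> x \<and> x \<le> v \<and> u < v \<and> v - u < d" using assms[OF xd] by auto
    then have "(u, v) \<in> K' \<and> x \<in> cball (a (u, v)) (r (u, v)) \<and> r (u, v) < d"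
      unfolding ball by (auto simp: K'_def r_def)
    then show ?thesis by blast
  qed
  ultimately obtain C where C: "countable C" "C \<subseteq> K'"
     "pairwise (\<lambda>i j. disjnt (cball (a i) (r i)) (cball (a j) (r j))) C"
     "negligible (S - (\<Union>i \<in> C. cball (a i) (r i)))"
    by (rule Vitali_covering_theorem_cballs)
  show thesis
    using C by (intro that[of C]) (auto simp: ball K'_def)
qed

text \<open>The rightmost interval \<open>(u, v)\<close> leaves the others to the left of
  \<open>u\<close>, so the induction runs with a varying right end \<open>b\<close>.\<close>

lemma mono_sum_disjoint_intervals:
  fixes f :: "real \<Rightarrow> real"
  assumes "mono f" "finite F" "\<And>u v. (u, v) \<in> F \<Longrightarrow> u < v \<and> a \<le> u \<and> v \<le> b"
    "pairwise (\<lambda>i j. disjnt {fst i..snd i} {fst j..snd j}) F" "a \<le> b"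
  shows "(\<Sum>i\<in>F. f (snd i) - f (fst i)) \<le> f b - f a"
  using assms(2-5)
proof (induction "card F" arbitrary: F b)
  case 0
  then show ?case using \<open>mono f\<close> by (auto simp: mono_def)
next
  case (Suc n)
  then have ne: "F \<noteq> {}" by auto
  obtain i where i: "i \<in> F" "\<And>j. j \<in> F \<Longrightarrow> snd j \<le> snd i"
    using Max_in[of "snd ` F"] Max_ge[of "snd ` F"] Suc.prems(1) ne by fastforce
  obtain u v where uv: "i = (u, v)" by force
  have "u < v" "a \<le> u" "v \<le> b" using Suc.prems(2) i uv by auto
  have *: "snd j \<le> u" if "j \<in> F - {i}" for j
  proof -
    have "disjnt {fst j..snd j} {u..v}" using Suc.prems(3) i that uv unfolding pairwise_def
      by (metis DiffE fst_conv insertI1 snd_conv)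
    moreover have "snd j \<le> v" using i that uv by auto
    moreover have "fst j < snd j" using Suc.prems(2)[of "fst j" "snd j"] that by auto
    ultimately show ?thesis
      using \<open>u < v\<close> unfolding disjnt_iff
      by (meson atLeastAtMost_iff less_imp_le linorder_not_le order_refl)
  qed
  have "(\<Sum>i\<in>F - {i}. f (snd i) - f (fst i)) \<le> f u - f a"
  proof (rule Suc.hyps(1))
    show "n = card (F - {i})" using Suc.hyps(2) i Suc.prems(1) by simp
    show "u' < v' \<and> a \<le> u' \<and> v' \<le> u" if "(u', v') \<in> F - {i}" for u' v'
      using * Suc.prems(2)[of u' v'] that by fastforce
    show "pairwise (\<lambda>i j. disjnt {fst i..snd i} {fst j..snd j}) (F - {i})"
      using Suc.prems(3) by (meson Diff_subset pairwise_subset)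
  qed (use Suc.prems \<open>a \<le> u\<close> in auto)
  moreover have "f v \<le> f b" using \<open>mono f\<close> \<open>v \<le> b\<close> by (auto simp: mono_def)
  moreover have "(\<Sum>i\<in>F. f (snd i) - f (fst i)) = f v - f u + (\<Sum>i\<in>F - {i}. f (snd i) - f (fst i))"
    using i Suc.prems(1) uv by (simp add: sum.remove)
  ultimately show ?case by linarith
qed

lemma measure_UN_disjoint_intervals:
  assumes "finite F" "\<And>u v. (u, v) \<in> F \<Longrightarrow> u < (v::real)"
    "pairwise (\<lambda>i j. disjnt {fst i..snd i} {fst j..snd j}) F"
  shows "measure lebesgue (\<Union>i\<in>F. {fst i..snd i}) = (\<Sum>i\<in>F. snd i - fst i)"
proof -
  have "measure lebesgue (\<Union>i\<in>F. {fst i..snd i}) = (\<Sum>i\<in>F. measure lebesgue {fst i..snd i})"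
    using assms by (intro measure_UNION') (auto simp: pairwise_def disjnt_def)
  also have "\<dots> = (\<Sum>i\<in>F. snd i - fst i)"
    using assms(2) by (intro sum.cong) (auto simp: less_imp_le)
  finally show ?thesis .
qed

section \<open>Monotone functions are differentiable almost everywhere\<close>

definition upper_slopes :: "(real \<Rightarrow> real) \<Rightarrow> real \<Rightarrow> real set" where
  "upper_slopes f q = {x. \<forall>d>0. \<exists>u v. u \<le> x \<and> x \<le> v \<and> u < v \<and> v - u < d \<and> f v - f u > q * (v - u)}"

text \<open>In both sets the short intervals merely contain \<open>x\<close>, which need not be an
  end point. The intervals in question thus form a Vitali cover as they stand.\<close>

definition lower_slopes :: "(real \<Rightarrow> real) \<Rightarrow> real \<Rightarrow> real set" where
  "lower_slopes f p = {x. \<forall>d>0. \<exists>u v. u \<le> x \<and> x \<le> v \<and> u < v \<and> v - u < d \<and> f v - f u < p * (v - u)}"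

text \<open>On a disjoint subfamily the total length is at most the total increment divided by
  \<open>q\<close>, and Vitali's theorem provides a countable disjoint subfamily that covers
  \<open>S\<close> up to a null set. A bound for finite subfamilies passes to the countable
  union.\<close>

lemma steep_cover_measure:
  fixes f :: "real \<Rightarrow> real"
  assumes q: "q > 0"
    and cover: "\<And>x d. \<lbrakk>x \<in> S; 0 < d\<rbrakk> \<Longrightarrow> \<exists>u v. (u, v) \<in> K \<and> u \<le> x \<and> x \<le> v \<and> u < v \<and> v - u < d"
    and steep: "\<And>u v. (u, v) \<in> K \<Longrightarrow> f v - f u \<ge> q * (v - u)"
    and bound: "\<And>F. \<lbrakk>finite F; F \<subseteq> K; \<And>u v. (u, v) \<in> F \<Longrightarrow> u < v;
        pairwise (\<lambda>i j. disjnt {fst i..snd i} {fst j..snd j}) F\<rbrakk> \<Longrightarrow>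
        (\<Sum>i\<in>F. f (snd i) - f (fst i)) \<le> B"
  obtains T where "S \<subseteq> T" "T \<in> lmeasurable" "measure lebesgue T \<le> B / q"
proof -
  obtain C where C: "countable C" "C \<subseteq> K" "\<forall>i\<in>C. fst i < snd i"
    and pw: "pairwise (\<lambda>i j. disjnt {fst i..snd i} {fst j..snd j}) C"
    and neg: "negligible (S - (\<Union>i\<in>C. {fst i..snd i}))"
    by (rule vitali_covering_intervals[of S K, OF cover])
  have C3: "u < v" if "(u, v) \<in> C" for u v using C(3) that by force
  have fin: "measure lebesgue (\<Union>i\<in>F. {fst i..snd i}) \<le> B / q" if "F \<subseteq> C" "finite F" for F
  proof -
    have pwF: "pairwise (\<lambda>i j. disjnt {fst i..snd i} {fst j..snd j}) F"
      using pw that by (meson pairwise_subset)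
    have "measure lebesgue (\<Union>i\<in>F. {fst i..snd i}) = (\<Sum>i\<in>F. snd i - fst i)"
      using that C3 pwF by (intro measure_UN_disjoint_intervals) auto
    moreover have "q * (\<Sum>i\<in>F. snd i - fst i) \<le> (\<Sum>i\<in>F. f (snd i) - f (fst i))"
      unfolding sum_distrib_left using that C(2) by (intro sum_mono steep) auto
    moreover have "\<dots> \<le> B" using that C(2) C3 pwF by (intro bound) auto
    ultimately show ?thesis using q by (simp add: field_simps)
  qed
  \<comment> \<open>The uncovered null set is put back so that \<open>T\<close> contains all of
    \<open>S\<close>.\<close>
  define T where "T = (\<Union>i\<in>C. {fst i..snd i}) \<union> (S - (\<Union>i\<in>C. {fst i..snd i}))"
  have m: "(\<Union>i\<in>C. {fst i..snd i}) \<in> lmeasurable" "measure lebesgue (\<Union>i\<in>C. {fst i..snd i}) \<le> B / q"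
    using fin by (auto intro!: fmeasurable_UN_bound[OF C(1)] measure_UN_bound[OF C(1)])
  show thesis
  proof
    show "S \<subseteq> T" by (auto simp: T_def)
    show "T \<in> lmeasurable" unfolding T_def using m(1) neg by (intro fmeasurable.Un) (auto intro: negligible_imp_measurable)
    have "measure lebesgue T \<le> measure lebesgue (\<Union>i\<in>C. {fst i..snd i}) +
        measure lebesgue (S - (\<Union>i\<in>C. {fst i..snd i}))"
      unfolding T_def using m neg by (intro measure_Un_le) (auto simp: negligible_imp_sets)
    then show "measure lebesgue T \<le> B / q"
      using m negligible_imp_measure0[OF neg] by simp
  qed
qed

lemma ex_symmetric_interval: "\<exists>N::nat. x \<in> {- real N<..<real N}"
proof -
  obtain N :: nat where "\<bar>x\<bar> < real N" using reals_Archimedean2 by blast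
  then show ?thesis by (auto intro!: exI[of _ N])
qed

text \<open>The total increase over a bounded interval is a fixed number \<open>B\<close>, so the
  points with slopes above \<open>n\<close> in it have outer measure at most \<open>B / n\<close>,
  for every \<open>n\<close>.\<close>

lemma negligible_upper_slopes_infinite:
  assumes "mono f"
  shows "negligible (\<Inter>n::nat. upper_slopes f (real n))"
proof -
  have "negligible ((\<Inter>n::nat. upper_slopes f (real n)) \<inter> {- real N<..<real N})" for N :: nat
    unfolding negligible_outer_le
  proof (intro allI impI)
    fix e :: real assume "e > 0"
    define B where "B = f N - f (- real N)"
    have "B \<ge> 0" using assms by (auto simp: B_def mono_def)
    obtain n :: nat where n: "real n > B / e" using reals_Archimedean2 by blast
    moreover have "B / e \<ge> 0" using \<open>B \<ge> 0\<close> \<open>e > 0\<close> by simp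
    ultimately have n0: "n > 0" by (cases n) auto
    obtain T where "(\<Inter>n::nat. upper_slopes f (real n)) \<inter> {- real N<..<real N} \<subseteq> T" 
      "T \<in> lmeasurable" "measure lebesgue T \<le> B / real n"
    proof (rule steep_cover_measure[where f=f and B=B and q="real n"
          and S="(\<Inter>n::nat. upper_slopes f (real n)) \<inter> {- real N<..<real N}"
          and K="{(u, v). u < v \<and> - real N \<le> u \<and> v \<le> real N \<and> f v - f u \<ge> real n * (v - u)}"])
      fix x d assume x: "x \<in> (\<Inter>n::nat. upper_slopes f (real n)) \<inter> {- real N<..<real N}" and d: "0 < (d::real)"
      \<comment> \<open>Intervals shorter than the distance of \<open>x\<close> to both ends stay in
        the range whose increase is \<open>B\<close>.\<close>
      define d' where "d' = min d (min (real N - x) (x + real N))"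
      have "d' > 0" using x d by (auto simp: d'_def)
      moreover have "x \<in> upper_slopes f (real n)" using x by blast
      ultimately obtain u v :: real where "u \<le> x \<and> x \<le> v \<and> u < v \<and> v - u < d' \<and> f v - f u > real n * (v - u)"
        unfolding upper_slopes_def mem_Collect_eq by meson
      then show "\<exists>u v. (u, v) \<in> {(u, v). u < v \<and> - real N \<le> u \<and> v \<le> real N \<and> f v - f u \<ge> real n * (v - u)}
          \<and> u \<le> x \<and> x \<le> v \<and> u < v \<and> v - u < d"
        by (intro exI[of _ u] exI[of _ v]) (auto simp: d'_def)
    next
      fix F assume F: "finite F" "F \<subseteq> {(u, v). u < v \<and> - real N \<le> u \<and> v \<le> real N \<and> f v - f u \<ge> real n * (v - u)}"
        "pairwise (\<lambda>i j. disjnt {fst i..snd i} {fst j..snd j}) F"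
      show "(\<Sum>i\<in>F. f (snd i) - f (fst i)) \<le> B"
        unfolding B_def using F by (intro mono_sum_disjoint_intervals assms) auto
    qed (use n n0 in auto)
    moreover have "B / real n \<le> e" using n n0 \<open>e > 0\<close> by (simp add: field_simps)
    ultimately show "\<exists>T. (\<Inter>n::nat. upper_slopes f (real n)) \<inter> {- real N<..<real N} \<subseteq> T \<and> T \<in> lmeasurable \<and>
        measure lebesgue T \<le> e" by (intro exI[of _ T]) auto
  qed
  then have "negligible (\<Union>N::nat. (\<Inter>n::nat. upper_slopes f (real n)) \<inter> {- real N<..<real N})"
    by (rule negligible_Union_nat)
  then show ?thesis by (rule negligible_subset) (use ex_symmetric_interval in blast)
qed

text \<open>The inner intervals are grouped by the outer interval that contains them; by
  monotonicity one group cannot raise \<open>f\<close> by more than its outer interval does.\<close>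

lemma sum_nested_intervals:
  fixes f :: "real \<Rightarrow> real"
  assumes f: "mono f" and F: "finite F" "\<And>u v. (u, v) \<in> F \<Longrightarrow> u < v"
    "pairwise (\<lambda>i j. disjnt {fst i..snd i} {fst j..snd j}) F"
    and sub: "\<And>i. i \<in> F \<Longrightarrow> c i \<in> C \<and> fst (c i) \<le> fst i \<and> snd i \<le> snd (c i)"
  shows "(\<Sum>i\<in>F. f (snd i) - f (fst i)) \<le> (\<Sum>j\<in>c ` F. f (snd j) - f (fst j))"
proof -
  have "(\<Sum>i\<in>F. f (snd i) - f (fst i)) = (\<Sum>j\<in>c ` F. \<Sum>i\<in>{i \<in> F. c i = j}. f (snd i) - f (fst i))"
    using F(1) by (simp add: sum.image_gen)
  also have "\<dots> \<le> (\<Sum>j\<in>c ` F. f (snd j) - f (fst j))"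
  proof (rule sum_mono)
    fix j assume "j \<in> c ` F"
    then obtain i where i: "i \<in> F" "c i = j" by auto
    then have "fst j \<le> snd j" using sub[of i] F(2)[of "fst i" "snd i"] by force
    then show "(\<Sum>i\<in>{i \<in> F. c i = j}. f (snd i) - f (fst i)) \<le> f (snd j) - f (fst j)"
    proof (intro mono_sum_disjoint_intervals f)
      show "pairwise (\<lambda>i j. disjnt {fst i..snd i} {fst j..snd j}) {i \<in> F. c i = j}"
        by (rule pairwise_subset[OF F(3)]) auto
      show "u < v \<and> fst j \<le> u \<and> v \<le> snd j" if "(u, v) \<in> {i \<in> F. c i = j}" for u v
        using F(2)[of u v] sub[of "(u, v)"] that by auto
    qed (use F in auto)
  qed
  finally show ?thesis .
qed

text \<open>Let \<open>e\<close> be the outer measure of a bounded part. Disjoint intervals of slope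
  below \<open>p\<close> inside an open set of measure at most \<open>e + \<epsilon>\<close> raise
  \<open>f\<close> by at most \<open>p * (e + \<epsilon>)\<close>. Intervals of slope above
  \<open>q\<close> nested in them still cover almost all of the set, so that
  \<open>q * e \<le> p * (e + \<epsilon>)\<close> for every positive \<open>\<epsilon>\<close>,
  which forces \<open>e = 0\<close>.\<close>

lemma negligible_upper_lower_slopes:
  assumes f: "mono f" and pq: "p < q" and p: "p > 0"
  shows "negligible (upper_slopes f q \<inter> lower_slopes f p)"
proof -
  have "negligible (upper_slopes f q \<inter> lower_slopes f p \<inter> {- real N<..<real N})" for N :: nat
  proof -
    define E where "E = upper_slopes f q \<inter> lower_slopes f p \<inter> {- real N<..<real N}"
    define M where "M = {measure lebesgue T |T. E \<subseteq> T \<and> T \<in> lmeasurable}"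
    have "{- real N<..<real N} \<in> lmeasurable" by simp
    then have M_ne: "M \<noteq> {}" unfolding M_def E_def by blast
    have M_bdd: "bdd_below M" by (auto simp: M_def intro!: bdd_belowI[of _ 0])
    define e where "e = Inf M"
    have e_le: "e \<le> measure lebesgue T" if "E \<subseteq> T" "T \<in> lmeasurable" for T
      unfolding e_def using that by (intro cInf_lower M_bdd) (auto simp: M_def)
    have "e \<ge> 0" unfolding e_def using M_ne by (intro cInf_greatest) (auto simp: M_def)
    have main: "q * e \<le> p * (e + \<epsilon>)" if eps: "\<epsilon> > 0" for \<epsilon>
    proof -
      have "\<exists>z\<in>M. z < e + \<epsilon> / 2" using cInf_lessD[OF M_ne, of "e + \<epsilon> / 2"] eps by (auto simp: e_def)
      then obtain T where T: "E \<subseteq> T" "T \<in> lmeasurable" "measure lebesgue T < e + \<epsilon> / 2"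
        by (auto simp: M_def)
      obtain V where V: "open V" "T \<subseteq> V" "V \<in> lmeasurable" "measure lebesgue V < measure lebesgue T + \<epsilon> / 2"
      proof -
        obtain V where V: "open V" "T \<subseteq> V" "V - T \<in> lmeasurable" "emeasure lebesgue (V - T) < ennreal (\<epsilon> / 2)"
          using sets_lebesgue_outer_open[of T "\<epsilon> / 2"] T(2) eps by auto
        have V': "V = T \<union> (V - T)" using V(2) by auto
        have "measure lebesgue (V - T) < \<epsilon> / 2"
          using V(3,4) eps by (simp add: emeasure_eq_measure2 ennreal_less_iff)
        moreover have "measure lebesgue V \<le> measure lebesgue T + measure lebesgue (V - T)"
          using T(2) V(3) by (subst V', intro measure_Un_le) auto
        moreover have "V \<in> lmeasurable" by (subst V', intro fmeasurable.Un T(2) V(3))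
        ultimately show thesis using V that by force
      qed
      have V_le: "measure lebesgue V \<le> e + \<epsilon>" using T V by linarith
      define K1 where "K1 = {(u, v). u < v \<and> {u..v} \<subseteq> V \<and> f v - f u < p * (v - u)}"
      have cover1: "\<exists>u v. (u, v) \<in> K1 \<and> u \<le> x \<and> x \<le> v \<and> u < v \<and> v - u < d"
        if x: "x \<in> E" and d: "0 < d" for x d
      proof -
        obtain r where r: "r > 0" "ball x r \<subseteq> V" using x T(1) V(1,2) openE by blast
        have "x \<in> lower_slopes f p" "min d r > 0" using x d r by (auto simp: E_def)
        then obtain u v where uv: "u \<le> x \<and> x \<le> v \<and> u < v \<and> v - u < min d r \<and> f v - f u < p * (v - u)"
          unfolding lower_slopes_def mem_Collect_eq by meson
        then have "{u..v} \<subseteq> ball x r" by (auto simp: dist_real_def)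
        then show ?thesis using uv r unfolding K1_def
          by (intro exI[of _ u] exI[of _ v]) auto
      qed
      obtain C1 where C1: "countable C1" "C1 \<subseteq> K1" "\<forall>i\<in>C1. fst i < snd i"
        and pw1: "pairwise (\<lambda>i j. disjnt {fst i..snd i} {fst j..snd j}) C1"
        and neg1: "negligible (E - (\<Union>i\<in>C1. {fst i..snd i}))"
        by (rule vitali_covering_intervals[of E K1, OF cover1])
      \<comment> \<open>Only interior points of a flat interval leave room for short steep intervals
        inside it. The end points that are lost are countably many.\<close>
      define E1 where "E1 = E \<inter> (\<Union>i\<in>C1. {fst i<..<snd i})"
      have "E - E1 \<subseteq> (E - (\<Union>i\<in>C1. {fst i..snd i})) \<union> (fst ` C1 \<union> snd ` C1)"
      proof
        fix y assume "y \<in> E - E1"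
        then have y: "y \<in> E" "\<And>i. i \<in> C1 \<Longrightarrow> \<not> (fst i < y \<and> y < snd i)" by (auto simp: E1_def)
        show "y \<in> (E - (\<Union>i\<in>C1. {fst i..snd i})) \<union> (fst ` C1 \<union> snd ` C1)"
        proof (rule ccontr)
          assume *: "\<not> ?thesis"
          then obtain i where i: "i \<in> C1" "fst i \<le> y" "y \<le> snd i" using y(1) by auto
          then have "fst i \<noteq> y" "snd i \<noteq> y" using * by auto
          then show False using y(2)[OF i(1)] i by linarith
        qed
      qed
      moreover have "negligible (fst ` C1 \<union> snd ` C1)"
        using C1(1) by (intro negligible_iff_null_sets[THEN iffD2] null_sets_completionI countable_imp_null_set_lborel) auto
      ultimately have neg2: "negligible (E - E1)"
        using neg1 negligible_Un negligible_subset by blast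
      define K2 where "K2 = {(u, v). u < v \<and> (\<exists>j\<in>C1. fst j \<le> u \<and> v \<le> snd j) \<and> f v - f u > q * (v - u)}"
      have cover2: "\<exists>u v. (u, v) \<in> K2 \<and> u \<le> x \<and> x \<le> v \<and> u < v \<and> v - u < d"
        if x: "x \<in> E1" and d: "0 < d" for x d
      proof -
        obtain j where j: "j \<in> C1" "fst j < x" "x < snd j" using x by (auto simp: E1_def)
        define d' where "d' = min d (min (x - fst j) (snd j - x))"
        have "x \<in> upper_slopes f q" "d' > 0" using x d j by (auto simp: E1_def E_def d'_def)
        then obtain u v where uv: "u \<le> x \<and> x \<le> v \<and> u < v \<and> v - u < d' \<and> f v - f u > q * (v - u)"
          unfolding upper_slopes_def mem_Collect_eq by meson
        have "fst j \<le> u" "v \<le> snd j" using uv by (auto simp: d'_def)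
        then have "(u, v) \<in> K2" using uv j(1) by (auto simp: K2_def)
        then show ?thesis using uv by (intro exI[of _ u] exI[of _ v]) (auto simp: d'_def)
      qed
      have bound: "(\<Sum>i\<in>F. f (snd i) - f (fst i)) \<le> p * (e + \<epsilon>)"
        if F: "finite F" "F \<subseteq> K2" "\<And>u v. (u, v) \<in> F \<Longrightarrow> u < v"
          "pairwise (\<lambda>i j. disjnt {fst i..snd i} {fst j..snd j}) F" for F
      proof -
        have "\<forall>i\<in>F. \<exists>j. j \<in> C1 \<and> fst j \<le> fst i \<and> snd i \<le> snd j"
        proof
          fix i assume "i \<in> F"
          then have "i \<in> K2" using F(2) by blast
          then obtain j where "j \<in> C1" "fst j \<le> fst i" "snd i \<le> snd j"
            unfolding K2_def by (auto simp: case_prod_beta)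
          then show "\<exists>j. j \<in> C1 \<and> fst j \<le> fst i \<and> snd i \<le> snd j" by blast
        qed
        then obtain c where c: "\<And>i. i \<in> F \<Longrightarrow> c i \<in> C1 \<and> fst (c i) \<le> fst i \<and> snd i \<le> snd (c i)"
          by metis
        have sub: "c ` F \<subseteq> C1" using c by auto
        have "(\<Sum>i\<in>F. f (snd i) - f (fst i)) \<le> (\<Sum>j\<in>c ` F. f (snd j) - f (fst j))"
          using F c by (intro sum_nested_intervals f) auto
        also have "\<dots> \<le> (\<Sum>j\<in>c ` F. p * (snd j - fst j))"
        proof (rule sum_mono)
          fix j assume "j \<in> c ` F"
          then have "j \<in> K1" using sub C1(2) by blast
          then show "f (snd j) - f (fst j) \<le> p * (snd j - fst j)" by (auto simp: K1_def)
        qed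
        also have "\<dots> = p * measure lebesgue (\<Union>j\<in>c ` F. {fst j..snd j})"
        proof (subst measure_UN_disjoint_intervals)
          show "pairwise (\<lambda>i j. disjnt {fst i..snd i} {fst j..snd j}) (c ` F)"
            using pw1 sub by (rule pairwise_subset)
          show "u < v" if "(u, v) \<in> c ` F" for u v 
          by (metis that C1(3) sub subsetD fst_conv snd_conv)
        qed (use F in \<open>auto simp: sum_distrib_left\<close>)
        also have "measure lebesgue (\<Union>j\<in>c ` F. {fst j..snd j}) \<le> measure lebesgue V"
        proof (rule measure_mono_fmeasurable[OF _ _ V(3)])
          show "(\<Union>j\<in>c ` F. {fst j..snd j}) \<subseteq> V" 
          using sub C1(2) unfolding K1_def by (force simp: case_prod_beta)
        qed (use F in auto)
        finally show ?thesis using V_le p by (smt (verit) mult_left_mono)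
      qed
      obtain T2 where T2: "E1 \<subseteq> T2" "T2 \<in> lmeasurable" "measure lebesgue T2 \<le> p * (e + \<epsilon>) / q"
        by (rule steep_cover_measure[of q E1 K2 f "p * (e + \<epsilon>)", OF _ cover2 _ bound])
          (use pq p in \<open>auto simp: K2_def intro: less_imp_le\<close>)
      have "e \<le> measure lebesgue (T2 \<union> (E - E1))"
        using T2 negligible_imp_measurable[OF neg2] by (intro e_le fmeasurable.Un) auto
      also have "\<dots> \<le> measure lebesgue T2 + measure lebesgue (E - E1)"
        using T2 neg2 by (intro measure_Un_le) (auto simp: negligible_imp_sets)
      also have "\<dots> \<le> p * (e + \<epsilon>) / q" using T2 negligible_imp_measure0[OF neg2] by simp
      finally show ?thesis using pq p by (simp add: field_simps)
    qed
    have "e = 0"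
    proof (rule ccontr)
      assume "e \<noteq> 0"
      then have "e > 0" using \<open>e \<ge> 0\<close> by simp
      \<comment> \<open>Chosen such that \<open>p * \<epsilon>\<close> is half of
        \<open>e * (q - p)\<close>, against \<open>main\<close>.\<close>
      define \<epsilon> where "\<epsilon> = e * (q - p) / (2 * p)"
      have "\<epsilon> > 0" using \<open>e > 0\<close> pq p by (simp add: \<epsilon>_def)
      have "p * \<epsilon> = e * (q - p) / 2" using p by (simp add: \<epsilon>_def)
      then have "e * (q - p) \<le> e * (q - p) / 2" using main[OF \<open>\<epsilon> > 0\<close>] by (simp add: algebra_simps)
      moreover have "e * (q - p) > 0" using \<open>e > 0\<close> pq by simp
      ultimately show False by simp
    qed
    show "negligible (upper_slopes f q \<inter> lower_slopes f p \<inter> {- real N<..<real N})"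
      unfolding E_def[symmetric] negligible_outer
    proof (intro allI impI)
      fix d :: real assume "d > 0"
      then have "\<exists>z\<in>M. z < d" using cInf_lessD[OF M_ne, of d] \<open>e = 0\<close> by (auto simp: e_def)
      then show "\<exists>T. E \<subseteq> T \<and> T \<in> lmeasurable \<and> measure lebesgue T < d" by (auto simp: M_def)
    qed
  qed
  then have "negligible (\<Union>N::nat. upper_slopes f q \<inter> lower_slopes f p \<inter> {- real N<..<real N})"
    by (rule negligible_Union_nat)
  then show ?thesis by (rule negligible_subset) (use ex_symmetric_interval in blast)
qed

text \<open>Where slopes are bounded and no rational pair \<open>p < q\<close> separates them, the
  infimum \<open>L\<close> of the upper bounds for the slopes is the derivative. Rational pairs keep
  the exceptional set a countable union.\<close>

lemma negligible_not_differentiable_mono: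
  fixes f :: "real \<Rightarrow> real"
  assumes f: "mono f"
  shows "negligible {x. \<not> f differentiable at x}"
proof -
  define Z where "Z = (\<Inter>n::nat. upper_slopes f (real n)) \<union>
    (\<Union>(p, q)\<in>{(p, q) \<in> \<rat> \<times> \<rat>. 0 < p \<and> p < q}. upper_slopes f q \<inter> lower_slopes f p)"
  have "countable {(p::real, q::real) \<in> \<rat> \<times> \<rat>. 0 < p \<and> p < q}"
    by (rule countable_subset[of _ "\<rat> \<times> \<rat>"]) (auto intro: countable_rat)
  then have "negligible Z"
    unfolding Z_def
    by (intro negligible_Un negligible_upper_slopes_infinite f negligible_countable_Union)
      (auto intro!: negligible_upper_lower_slopes f)
  moreover have "f differentiable at x" if x: "x \<notin> Z" for x
  proof -
    define A where "A = {q. x \<notin> upper_slopes f q}"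
    obtain n :: nat where n: "x \<notin> upper_slopes f (real n)" using x by (auto simp: Z_def)
    then have ne: "A \<noteq> {}" by (auto simp: A_def)
    have pos: "0 \<le> q" if "q \<in> A" for q
    proof (rule ccontr)
      assume "\<not> 0 \<le> q"
      have "\<exists>u v. u \<le> x \<and> x \<le> v \<and> u < v \<and> v - u < d \<and> f v - f u > q * (v - u)" if "d > 0" for d
      proof -
        have "f (x + d/2) \<ge> f x" using f that by (auto simp: mono_def)
        moreover have "q * (d / 2) < 0" using that \<open>\<not> 0 \<le> q\<close> by (simp add: mult_neg_pos)
        ultimately show ?thesis using that by (intro exI[of _ x] exI[of _ "x + d/2"]) auto
      qed
      then show False using \<open>q \<in> A\<close> unfolding A_def upper_slopes_def by blast
    qed
    then have bdd: "bdd_below A" by (rule bdd_belowI)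
    define L where "L = Inf A"
    have "L \<ge> 0" unfolding L_def using ne pos by (intro cInf_greatest)
    have up_anti: "x \<in> upper_slopes f q'" if hq: "x \<in> upper_slopes f q" "q' \<le> q" for q q'
      unfolding upper_slopes_def
    proof safe
      fix d :: real assume "d > 0"
      then obtain u v where uv: "u \<le> x \<and> x \<le> v \<and> u < v \<and> v - u < d \<and> f v - f u > q * (v - u)"
        using hq(1) unfolding upper_slopes_def mem_Collect_eq by meson
      moreover have "q' * (v - u) \<le> q * (v - u)" using hq(2) uv by (intro mult_right_mono) auto
      ultimately show "\<exists>u v. u \<le> x \<and> x \<le> v \<and> u < v \<and> v - u < d \<and> f v - f u > q' * (v - u)"
        by (meson le_less_trans)
    qed
    have lo_mono: "x \<in> lower_slopes f q'" if hq: "x \<in> lower_slopes f q" "q \<le> q'" for q q'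
      unfolding lower_slopes_def
    proof safe
      fix d :: real assume "d > 0"
      then obtain u v where uv: "u \<le> x \<and> x \<le> v \<and> u < v \<and> v - u < d \<and> f v - f u < q * (v - u)"
        using hq(1) unfolding lower_slopes_def mem_Collect_eq by meson
      moreover have "q * (v - u) \<le> q' * (v - u)" using hq(2) uv by (intro mult_right_mono) auto
      ultimately show "\<exists>u v. u \<le> x \<and> x \<le> v \<and> u < v \<and> v - u < d \<and> f v - f u < q' * (v - u)"
        by (meson less_le_trans)
    qed
    have upper: "\<exists>d>0. \<forall>u v. u \<le> x \<longrightarrow> x \<le> v \<longrightarrow> u < v \<longrightarrow> v - u < d \<longrightarrow> f v - f u \<le> (L + e) * (v - u)"
      if "e > 0" for e
    proof -
      obtain q where "q \<in> A" "q < L + e" using cInf_lessD[OF ne, of "L + e"] \<open>e > 0\<close> by (auto simp: L_def)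
      then have "x \<notin> upper_slopes f (L + e)" using up_anti[of "L + e" q] by (auto simp: A_def)
      then show ?thesis unfolding upper_slopes_def mem_Collect_eq by (meson not_less)
    qed
    have lower: "\<exists>d>0. \<forall>u v. u \<le> x \<longrightarrow> x \<le> v \<longrightarrow> u < v \<longrightarrow> v - u < d \<longrightarrow> f v - f u \<ge> (L - e) * (v - u)"
      if "e > 0" for e
    proof (cases "L - e > 0")
      \<comment> \<open>\<open>Z\<close> provides only positive \<open>p\<close>; for a bound that
        is not positive, monotonicity suffices.\<close>
      case False
      have "(L - e) * (v - u) \<le> f v - f u" if "u < v" for u v
      proof -
        have "(L - e) * (v - u) \<le> 0" using False that by (simp add: mult_nonpos_nonneg)
        moreover have "f u \<le> f v" using f that by (auto simp: mono_def)
        ultimately show ?thesis by linarith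
      qed
      then show ?thesis by (intro exI[of _ 1]) auto
    next
      case True
      \<comment> \<open>Since \<open>q\<close> lies below the infimum, there are short intervals of
        slope above \<open>q\<close> at \<open>x\<close>. As \<open>x\<close> is outside
        \<open>Z\<close>, slopes below the rational \<open>p < q\<close> are excluded near
        \<open>x\<close>, and so are those below \<open>L - e < p\<close>.\<close>
      obtain p where p: "p \<in> \<rat>" "L - e < p" "p < L - e / 2"
        using Rats_dense_in_real[of "L - e" "L - e/2"] \<open>e > 0\<close> by auto
      obtain q where q: "q \<in> \<rat>" "p < q" "q < L"
        using Rats_dense_in_real[of p L] p \<open>e > 0\<close> by auto
      have "q \<notin> A" using q cInf_lower[OF _ bdd, of q] by (auto simp: L_def)
      then have "x \<in> upper_slopes f q" by (simp add: A_def)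
      then have "x \<notin> lower_slopes f p" using x p q True by (auto simp: Z_def)
      then have "x \<notin> lower_slopes f (L - e)" using lo_mono[of "L - e" p] p by auto
      then show ?thesis unfolding lower_slopes_def mem_Collect_eq by (meson not_less)
    qed
    have "(f has_field_derivative L) (at x)"
      unfolding has_field_derivative_def has_derivative_at_alt
    proof (intro conjI allI impI bounded_linear_mult_right)
      fix e :: real assume "e > 0"
      obtain d1 where d1: "d1 > 0" "\<And>u v. u \<le> x \<Longrightarrow> x \<le> v \<Longrightarrow> u < v \<Longrightarrow> v - u < d1 \<Longrightarrow> f v - f u \<le> (L + e) * (v - u)"
        using upper[OF \<open>e > 0\<close>] by blast
      obtain d2 where d2: "d2 > 0" "\<And>u v. u \<le> x \<Longrightarrow> x \<le> v \<Longrightarrow> u < v \<Longrightarrow> v - u < d2 \<Longrightarrow> f v - f u \<ge> (L - e) * (v - u)"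
        using lower[OF \<open>e > 0\<close>] by blast
      have "norm (f y - f x - L * (y - x)) \<le> e * norm (y - x)" if y: "norm (y - x) < min d1 d2" for y
      proof (cases y x rule: linorder_cases)
        case less
        then show ?thesis using d1(2)[of y x] d2(2)[of y x] y by (simp add: abs_le_iff algebra_simps)
      next
        case greater
        then show ?thesis using d1(2)[of x y] d2(2)[of x y] y by (simp add: abs_le_iff algebra_simps)
      qed simp
      then show "\<exists>d>0. \<forall>y. norm (y - x) < d \<longrightarrow> norm (f y - f x - L * (y - x)) \<le> e * norm (y - x)"
        using d1(1) d2(1) by (intro exI[of _ "min d1 d2"]) auto
    qed
    then show ?thesis using real_differentiable_def by blast
  qed
  ultimately show ?thesis by (elim negligible_subset) blast
qed

section \<open>Variation and derivative of absolutely continuous functions\<close>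

lemma abs_continuous_onE:
  assumes "abs_continuous_on S F" "\<epsilon> > 0"
  obtains \<delta> where "\<delta> > 0"
    "\<forall>(n::nat) u v. (\<forall>j<n. u j \<le> v j \<and> {u j..v j} \<subseteq> S) \<longrightarrow>
        disjoint_family_on (\<lambda>j. {u j<..<v j}) {..<n} \<longrightarrow>
        (\<Sum>j<n. v j - u j) < \<delta> \<longrightarrow> (\<Sum>j<n. \<bar>F (v j) - F (u j)\<bar>) < \<epsilon>"
  using assms(1)[unfolded abs_continuous_on_def, rule_format, OF assms(2)] that by (elim exE conjE)

text \<open>Cutting the intervals at the points \<open>a + k * h\<close> leaves pieces of total
  length below \<open>\<delta>\<close> in each cell, so each cell adds at most one to the
  variation.\<close>

lemma abs_continuous_on_bounded_variation:
  assumes ac: "\<And>a b. abs_continuous_on {a..b} F"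
  shows "\<exists>B. \<forall>(n::nat) u v. (\<forall>j<n. u j \<le> v j \<and> {u j..v j} \<subseteq> {a..b}) \<longrightarrow>
    disjoint_family_on (\<lambda>j. {u j<..<v j}) {..<n} \<longrightarrow> (\<Sum>j<n. \<bar>F (v j) - F (u j)\<bar>) \<le> B"
proof -
  obtain \<delta> where \<delta>1: "\<delta> > 0" and \<delta>2: "\<forall>(n::nat) u v. (\<forall>j<n. u j \<le> v j \<and> {u j..v j} \<subseteq> {a..b}) \<longrightarrow>
      disjoint_family_on (\<lambda>j. {u j<..<v j}) {..<n} \<longrightarrow>
      (\<Sum>j<n. v j - u j) < \<delta> \<longrightarrow> (\<Sum>j<n. \<bar>F (v j) - F (u j)\<bar>) < 1"
    by (rule abs_continuous_onE[OF ac[of a b] zero_less_one])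
  note \<delta> = \<delta>1 \<delta>2[THEN spec, THEN spec, THEN spec, THEN mp, THEN mp, THEN mp]
  define h where "h = \<delta> / 2"
  have "h > 0" using \<delta> by (simp add: h_def)
  have step: "(\<Sum>j<n. \<bar>F (v j) - F (u j)\<bar>) \<le> real k"
    if "\<forall>j<n. u j \<le> v j \<and> {u j..v j} \<subseteq> {a..b}" "disjoint_family_on (\<lambda>j. {u j<..<v j}) {..<n}"
      "\<forall>j<n. v j \<le> a + real k * h" for n :: nat and u v k
    using that
  proof (induction k arbitrary: u v)
    case 0
    have "u j = v j" if "j < n" for j
      using 0 that by (metis add.right_neutral atLeastatMost_subset_iff mult_zero_left of_nat_0 order_antisym order_trans)
    then show ?case by simp
  next
    case (Suc k)
    define t where "t = a + real k * h"
    \<comment> \<open>\<open>min\<close> keeps the part of an interval to the left of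
      \<open>t\<close> and \<open>max\<close> the part to the right; a part that is missing becomes
      a single point and contributes zero.\<close>
    have sub: "{min (u j) t<..<min (v j) t} \<subseteq> {u j<..<v j}" "{max (u j) t<..<max (v j) t} \<subseteq> {u j<..<v j}" for j
      by auto
    have uv: "u j \<le> v j" "a \<le> u j" "v j \<le> b" if "j < n" for j
      using Suc.prems(1) that by auto
    have "t \<ge> a" using \<open>h > 0\<close> by (simp add: t_def)
    have 1: "(\<Sum>j<n. \<bar>F (min (v j) t) - F (min (u j) t)\<bar>) \<le> real k"
    proof (rule Suc.IH)
      show "\<forall>j<n. min (u j) t \<le> min (v j) t \<and> {min (u j) t..min (v j) t} \<subseteq> {a..b}"
        using uv \<open>t \<ge> a\<close> by (auto simp: min_le_iff_disj intro: order_trans)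
      show "disjoint_family_on (\<lambda>j. {min (u j) t<..<min (v j) t}) {..<n}"
        using Suc.prems(2) sub(1) unfolding disjoint_family_on_def by blast
      show "\<forall>j<n. min (v j) t \<le> a + real k * h" by (simp add: t_def)
    qed
    have 2: "(\<Sum>j<n. \<bar>F (max (v j) t) - F (max (u j) t)\<bar>) \<le> 1"
    proof (cases "t \<le> b")
      case True
      have disj: "disjoint_family_on (\<lambda>j. {max (u j) t<..<max (v j) t}) {..<n}"
        using Suc.prems(2) sub(2) unfolding disjoint_family_on_def by blast
      have le: "max (u j) t \<le> max (v j) t" "max (v j) t \<le> t + h" if "j < n" for j
        using Suc.prems that \<open>h > 0\<close> by (auto simp: t_def max_def algebra_simps)
      have "(\<Sum>j<n. max (v j) t - max (u j) t) = (\<Sum>j<n. measure lebesgue {max (u j) t<..<max (v j) t})"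
        using le by (intro sum.cong) auto
      also have "\<dots> = measure lebesgue (\<Union>j<n. {max (u j) t<..<max (v j) t})"
        using disj by (intro measure_UNION'[symmetric]) (auto simp: pairwise_def disjnt_def disjoint_family_on_def)
      also have "\<dots> \<le> measure lebesgue {t..t + h}"
      proof (rule measure_mono_fmeasurable)
        show "(\<Union>j<n. {max (u j) t<..<max (v j) t}) \<subseteq> {t..t + h}"
          using le(2) by (force simp: less_imp_le)
      qed auto
      also have "\<dots> < \<delta>" using \<delta>(1) by (simp add: h_def)
      finally have "(\<Sum>j<n. \<bar>F (max (v j) t) - F (max (u j) t)\<bar>) < 1"
      proof (intro \<delta>(2) disj)
        show "\<forall>j<n. max (u j) t \<le> max (v j) t \<and> {max (u j) t..max (v j) t} \<subseteq> {a..b}"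
          using uv \<open>t \<ge> a\<close> True by (auto simp: le_max_iff_disj) (meson linear order_trans)
      qed
      then show ?thesis by simp
    next
      case False
      have "max (v j) t = t \<and> max (u j) t = t" if "j < n" for j
        using uv[OF that] False by (auto simp: max_def)
      then show ?thesis by simp
    qed
    have "(\<Sum>j<n. \<bar>F (v j) - F (u j)\<bar>) \<le>
      (\<Sum>j<n. \<bar>F (min (v j) t) - F (min (u j) t)\<bar> + \<bar>F (max (v j) t) - F (max (u j) t)\<bar>)"
      using uv by (intro sum_mono) (auto simp: min_def max_def)
    then show ?case using 1 2 by (simp add: sum.distrib)
  qed
  obtain k :: nat where k: "real k > (b - a) / h" using reals_Archimedean2 by blast
  then have "b \<le> a + real k * h" using \<open>h > 0\<close> by (simp add: field_simps)
  then show ?thesis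
    by (intro exI[of _ "real k"] allI impI step) (auto dest: order_trans)
qed

text \<open>Jordan's decomposition: on a bounded interval \<open>F\<close> is the difference of its
  positive variation \<open>P\<close> and of \<open>P - G\<close>, and both are monotone.\<close>

lemma negligible_not_differentiable_abs_continuous:
  assumes ac: "\<And>a b. abs_continuous_on {a..b} F"
  shows "negligible {x. \<not> F differentiable at x}"
proof -
  have "negligible ({x. \<not> F differentiable at x} \<inter> {- real N<..<real N})" for N :: nat
  proof -
    \<comment> \<open>Clipping makes \<open>G\<close> constant outside the interval, so that it has
      finite variation on the whole line and equals \<open>F\<close> inside.\<close>
    define clip where "clip x = max (- real N) (min x (real N))" for x :: real
    have clip: "- real N \<le> clip x" "clip x \<le> real N" "x \<le> y \<Longrightarrow> clip x \<le> clip y" for x y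
      by (auto simp: clip_def)
    define G where "G x = F (clip x)" for x
    define fam where "fam x = {(n::nat, u, v). (\<forall>j<n. u j \<le> v j \<and> v j \<le> x) \<and>
      disjoint_family_on (\<lambda>j. {u j<..<v j}) {..<n}}" for x :: real
    define S where "S = (\<lambda>(n::nat, u, v). \<Sum>j<n. G (v j) - G (u j))"
    define P where "P x = Sup (S ` fam x)" for x
    obtain B where B: "\<And>(n::nat) u v. (\<forall>j<n. u j \<le> v j \<and> {u j..v j} \<subseteq> {- real N..real N}) \<Longrightarrow>
        disjoint_family_on (\<lambda>j. {u j<..<v j}) {..<n} \<Longrightarrow> (\<Sum>j<n. \<bar>F (v j) - F (u j)\<bar>) \<le> B"
      using abs_continuous_on_bounded_variation[OF ac, of "- real N" "real N"] by blast
    have "S (n, u, v) \<le> B" if "(n, u, v) \<in> fam x" for n u v x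
    proof -
      have "(\<Sum>j<n. \<bar>F (clip (v j)) - F (clip (u j))\<bar>) \<le> B"
      proof (rule B)
        show "\<forall>j<n. clip (u j) \<le> clip (v j) \<and> {clip (u j)..clip (v j)} \<subseteq> {- real N..real N}"
          using that clip by (auto simp: fam_def intro: order_trans)
        have "{clip (u j)<..<clip (v j)} \<subseteq> {u j<..<v j}" for j by (auto simp: clip_def)
        then show "disjoint_family_on (\<lambda>j. {clip (u j)<..<clip (v j)}) {..<n}"
          using that unfolding disjoint_family_on_def fam_def by blast
      qed
      moreover have "S (n, u, v) \<le> (\<Sum>j<n. \<bar>F (clip (v j)) - F (clip (u j))\<bar>)"
        unfolding S_def G_def by (auto intro!: sum_mono)
      ultimately show ?thesis by linarith
    qed
    then have bdd: "bdd_above (S ` fam x)" for x by (auto intro!: bdd_aboveI[of _ B])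
    have empty: "(0, u, v) \<in> fam x" for u v x by (auto simp: fam_def disjoint_family_on_def)
    then have ne: "S ` fam x \<noteq> {}" for x by blast
    have P_diff: "P x + (G y - G x) \<le> P y" if "x \<le> y" for x y
    proof -
      have "P x \<le> P y - (G y - G x)"
        unfolding P_def
      proof (rule cSup_least[OF ne])
        fix s assume "s \<in> S ` fam x"
        then obtain n u v where s: "s = S (n, u, v)" and fam: "(n, u, v) \<in> fam x" by auto
        \<comment> \<open>A family that ends before \<open>x\<close> may be enlarged by the interval
          from \<open>x\<close> to \<open>y\<close>, which adds \<open>G y - G x\<close> to its
          sum.\<close>
        have "(Suc n, u(n := x), v(n := y)) \<in> fam y"
          using fam \<open>x \<le> y\<close> unfolding fam_def disjoint_family_on_def
          by (fastforce simp: less_Suc_eq)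
        moreover have "S (Suc n, u(n := x), v(n := y)) = s + (G y - G x)"
          unfolding s S_def by simp
        ultimately have "s + (G y - G x) \<le> Sup (S ` fam y)"
          by (metis bdd cSup_upper image_eqI)
        then show "s \<le> Sup (S ` fam y) - (G y - G x)" by simp
      qed
      then show ?thesis by simp
    qed
    have "fam x \<subseteq> fam y" if "x \<le> y" for x y using that by (auto simp: fam_def intro: order_trans)
    then have "mono P"
      unfolding P_def by (intro monoI cSup_subset_mono ne bdd image_mono)
    moreover have "mono (\<lambda>x. P x - G x)" using P_diff by (auto simp: mono_def algebra_simps)
    ultimately have neg: "negligible ({x. \<not> P differentiable at x} \<union> {x. \<not> (\<lambda>x. P x - G x) differentiable at x})"
      by (intro negligible_Un negligible_not_differentiable_mono)
    have "F differentiable at x"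
      if x: "x \<in> {- real N<..<real N}" "P differentiable at x" "(\<lambda>x. P x - G x) differentiable at x" for x
    proof -
      have eq: "(\<lambda>x. P x - (P x - G x)) = G" by auto
      have "G differentiable at x" using differentiable_diff[OF x(2) x(3)] unfolding eq .
      then obtain D where "(G has_derivative D) (at x)" by (auto simp: differentiable_def)
      then have "(F has_derivative D) (at x)"
      proof (rule has_derivative_transform_within_open)
        show "open {- real N<..<real N}" "x \<in> {- real N<..<real N}" using x by auto
        show "G y = F y" if "y \<in> {- real N<..<real N}" for y using that by (auto simp: G_def clip_def)
      qed
      then show ?thesis by (auto simp: differentiable_def)
    qed
    then show ?thesis by (intro negligible_subset[OF neg]) blast
  qed
  then have "negligible (\<Union>N::nat. {x. \<not> F differentiable at x} \<inter> {- real N<..<real N})"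
    by (rule negligible_Union_nat)
  then show ?thesis by (rule negligible_subset) (use ex_symmetric_interval in blast)
qed

text \<open>Outside a null set the derivative controls the increments over fine tagged intervals;
  on the null set absolute continuity makes the increments small in total.\<close>

lemma fundamental_theorem_of_calculus_abs_continuous:
  assumes ac: "abs_continuous_on {a..b} F" and "a \<le> b" and S: "negligible S"
    and der: "\<And>x. x \<in> {a..b} - S \<Longrightarrow> (F has_real_derivative f x) (at x)"
  shows "(f has_integral (F b - F a)) {a..b}"
proof -
  \<comment> \<open>With the value zero on \<open>S\<close>, the terms with tags in \<open>S\<close>
    reduce to increments of \<open>F\<close>.\<close>
  define g where "g x = (if x \<in> S then 0 else f x)" for x
  have "(g has_integral (F b - F a)) (cbox a b)"
    unfolding has_integral
  proof (intro allI impI)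
    fix e :: real assume "e > 0"
    define e' where "e' = e / (2 * (b - a + 1))"
    have "e' > 0" using \<open>e > 0\<close> \<open>a \<le> b\<close> by (simp add: e'_def)
    obtain \<delta> where \<delta>1: "\<delta> > 0" and \<delta>2: "\<forall>(n::nat) u v. (\<forall>j<n. u j \<le> v j \<and> {u j..v j} \<subseteq> {a..b}) \<longrightarrow>
        disjoint_family_on (\<lambda>j. {u j<..<v j}) {..<n} \<longrightarrow>
        (\<Sum>j<n. v j - u j) < \<delta> \<longrightarrow> (\<Sum>j<n. \<bar>F (v j) - F (u j)\<bar>) < e / 2"
      by (rule abs_continuous_onE[OF ac half_gt_zero[OF \<open>e > 0\<close>]])
    note \<delta> = \<delta>1 \<delta>2[THEN spec, THEN spec, THEN spec, THEN mp, THEN mp, THEN mp]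
    obtain V where V: "open V" "S \<subseteq> V" "V - S \<in> lmeasurable" "emeasure lebesgue (V - S) < ennreal \<delta>"
      using sets_lebesgue_outer_open[OF negligible_imp_sets[OF S] \<delta>(1)] by metis
    have V_meas: "V \<in> lmeasurable" "measure lebesgue V < \<delta>"
    proof -
      have V': "V = S \<union> (V - S)" using V(2) by auto
      have "measure lebesgue (V - S) < \<delta>"
        using V(3,4) \<delta>(1) by (simp add: emeasure_eq_measure2 ennreal_less_iff)
      moreover have "measure lebesgue V \<le> measure lebesgue S + measure lebesgue (V - S)"
        using negligible_imp_measurable[OF S] V(3) by (subst V', intro measure_Un_le) auto
      ultimately show "measure lebesgue V < \<delta>" using negligible_imp_measure0[OF S] by simp
      show "V \<in> lmeasurable" by (subst V', intro fmeasurable.Un negligible_imp_measurable[OF S] V(3))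
    qed
    \<comment> \<open>The gauge: a tag in \<open>S\<close> keeps its interval inside the open set
      \<open>V\<close> of measure below \<open>\<delta>\<close>, and any other tag in
      \<open>{a..b}\<close> keeps it where the linear approximation has relative error
      \<open>e'\<close>.\<close>
    have "\<exists>r>0. (x \<in> S \<longrightarrow> ball x r \<subseteq> V) \<and> (x \<in> {a..b} - S \<longrightarrow>
        (\<forall>y. norm (y - x) < r \<longrightarrow> norm (F y - F x - f x * (y - x)) \<le> e' * norm (y - x)))" for x
    proof (cases "x \<in> S")
      case True
      then show ?thesis using V(1,2) openE by blast
    next
      case False
      show ?thesis
      proof (cases "x \<in> {a..b}")
        case True
        then show ?thesis using der[of x] False \<open>e' > 0\<close>
          unfolding has_field_derivative_def has_derivative_at_alt by blast
      next
        case nab: False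
        then show ?thesis using False by (intro exI[of _ 1]) auto
      qed
    qed
    then obtain r where r: "\<And>x. r x > 0" "\<And>x. x \<in> S \<Longrightarrow> ball x (r x) \<subseteq> V"
      "\<And>x y. x \<in> {a..b} - S \<Longrightarrow> norm (y - x) < r x \<Longrightarrow> norm (F y - F x - f x * (y - x)) \<le> e' * norm (y - x)"
      by metis
    show "\<exists>\<gamma>. gauge \<gamma> \<and> (\<forall>D. D tagged_division_of cbox a b \<and> \<gamma> fine D \<longrightarrow>
      norm ((\<Sum>(x, K)\<in>D. measure lborel K *\<^sub>R g x) - (F b - F a)) < e)"
    proof (intro exI[of _ "\<lambda>x. ball x (r x)"] conjI allI impI)
      show "gauge (\<lambda>x. ball x (r x))" using r(1) by (auto simp: gauge_def)
      fix D assume D': "D tagged_division_of cbox a b \<and> (\<lambda>x. ball x (r x)) fine D"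
      then have D: "D tagged_division_of {a..b}" and fine: "(\<lambda>x. ball x (r x)) fine D" by auto
      have fin: "finite D" using D by auto
      have K: "K = {Inf K..Sup K} \<and> Inf K \<le> x \<and> x \<le> Sup K \<and> a \<le> Inf K \<and> Sup K \<le> b \<and> K \<subseteq> ball x (r x)
        \<and> measure lborel K = Sup K - Inf K"
        if xK: "(x, K) \<in> D" for x K
      proof -
        obtain u v where uv: "K = cbox u v" using D xK by (meson tagged_division_ofD(4))
        have "x \<in> K" "K \<subseteq> {a..b}" using tagged_division_ofD(2,3)[OF D xK] by auto
        then have "u \<le> v" using uv by auto
        then have "Inf K = u" "Sup K = v" using uv by auto
        then show ?thesis using uv \<open>x \<in> K\<close> \<open>K \<subseteq> {a..b}\<close> fine xK \<open>u \<le> v\<close>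
          by (auto simp: fine_def)
      qed
      have "F b - F a = (\<Sum>(x, K)\<in>D. F (Sup K) - F (Inf K))"
        using additive_tagged_division_1[OF \<open>a \<le> b\<close> D, of F] by simp
      then have "(\<Sum>(x, K)\<in>D. measure lborel K *\<^sub>R g x) - (F b - F a)
          = (\<Sum>(x, K)\<in>D. measure lborel K *\<^sub>R g x - (F (Sup K) - F (Inf K)))"
        by (simp add: sum_subtractf case_prod_beta)
      also have "norm \<dots> \<le> (\<Sum>(x, K)\<in>D. \<bar>measure lborel K *\<^sub>R g x - (F (Sup K) - F (Inf K))\<bar>)"
        by (rule order_trans[OF norm_sum]) (simp add: case_prod_beta)
      also have "\<dots> = (\<Sum>(x, K)\<in>{(x, K)\<in>D. x \<in> S}. \<bar>measure lborel K *\<^sub>R g x - (F (Sup K) - F (Inf K))\<bar>)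
          + (\<Sum>(x, K)\<in>{(x, K)\<in>D. x \<notin> S}. \<bar>measure lborel K *\<^sub>R g x - (F (Sup K) - F (Inf K))\<bar>)"
        by (subst sum.union_disjoint[symmetric]) (auto simp: fin intro!: sum.cong finite_subset[OF _ fin])
      also have "(\<Sum>(x, K)\<in>{(x, K)\<in>D. x \<notin> S}. \<bar>measure lborel K *\<^sub>R g x - (F (Sup K) - F (Inf K))\<bar>)
          \<le> (\<Sum>(x, K)\<in>{(x, K)\<in>D. x \<notin> S}. e' * measure lborel K)"
      proof (intro sum_mono, clarify)
        fix x K assume xK: "(x, K) \<in> D" "x \<notin> S"
        note k = K[OF xK(1)]
        have x: "x \<in> {a..b} - S" using k xK by auto
        have "Inf K \<in> ball x (r x)" "Sup K \<in> ball x (r x)" using k by fastforce+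
        then have "norm (Inf K - x) < r x" "norm (Sup K - x) < r x" by (auto simp: dist_real_def abs_minus_commute)
        from r(3)[OF x this(1)] r(3)[OF x this(2)] k
        have "\<bar>F (Inf K) - F x - f x * (Inf K - x)\<bar> \<le> e' * (x - Inf K)"
          "\<bar>F (Sup K) - F x - f x * (Sup K - x)\<bar> \<le> e' * (Sup K - x)" by auto
        then have "\<bar>(Sup K - Inf K) * f x - (F (Sup K) - F (Inf K))\<bar> \<le> e' * (Sup K - Inf K)"
          by (simp add: abs_le_iff algebra_simps)
        then show "\<bar>measure lborel K *\<^sub>R g x - (F (Sup K) - F (Inf K))\<bar> \<le> e' * measure lborel K"
          using k xK(2) by (simp add: g_def)
      qed
      also have "\<dots> \<le> (\<Sum>(x, K)\<in>D. e' * measure lborel K)"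
        using \<open>e' > 0\<close> fin by (intro sum_mono2) auto
      also have "\<dots> = e' * (b - a)"
        using additive_content_tagged_division[OF D'[THEN conjunct1]] \<open>a \<le> b\<close>
        by (simp add: sum_distrib_left[symmetric] case_prod_beta)
      also have "\<dots> < e / 2"
        using \<open>e > 0\<close> \<open>a \<le> b\<close> by (simp add: e'_def field_simps)
      also have "(\<Sum>(x, K)\<in>{(x, K)\<in>D. x \<in> S}. \<bar>measure lborel K *\<^sub>R g x - (F (Sup K) - F (Inf K))\<bar>) < e / 2"
      proof -
        define D0 where "D0 = {(x, K)\<in>D. x \<in> S}"
        have "finite D0" unfolding D0_def using fin by (rule rev_finite_subset) auto
        then obtain d where d: "bij_betw d {..<card D0} D0"
          using bij_betw_from_nat_into_finite by (metis ex_bij_betw_nat_finite atLeast0LessThan)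
        define u where "u j = Inf (snd (d j))" for j
        define v where "v j = Sup (snd (d j))" for j
        have dD: "d j \<in> D" "fst (d j) \<in> S" if "j < card D0" for j
          using bij_betwE[OF d] that by (auto simp: D0_def case_prod_beta)
        have kj: "snd (d j) = {u j..v j} \<and> u j \<le> fst (d j) \<and> fst (d j) \<le> v j \<and> a \<le> u j \<and> v j \<le> b
            \<and> {u j..v j} \<subseteq> ball (fst (d j)) (r (fst (d j)))"
          if "j < card D0" for j
          using K[of "fst (d j)" "snd (d j)"] dD[OF that] by (auto simp: u_def v_def)
        have disj: "disjoint_family_on (\<lambda>j. {u j<..<v j}) {..<card D0}"
          unfolding disjoint_family_on_def
        proof (intro ballI impI)
          fix i j assume ij: "i \<in> {..<card D0}" "j \<in> {..<card D0}" "i \<noteq> j"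
          then have "d i \<noteq> d j" using d by (auto simp: bij_betw_def inj_on_def)
          then have "interior (snd (d i)) \<inter> interior (snd (d j)) = {}"
            using tagged_division_ofD(5)[OF D, of "fst (d i)" "snd (d i)" "fst (d j)" "snd (d j)"] dD ij by auto
          then show "{u i<..<v i} \<inter> {u j<..<v j} = {}" using kj ij by auto
        qed
        have "(\<Sum>j<card D0. v j - u j) = (\<Sum>j<card D0. measure lebesgue {u j<..<v j})"
        proof (intro sum.cong refl)
          fix j assume "j \<in> {..<card D0}"
          then have "u j \<le> v j" using kj[of j] by auto
          then show "v j - u j = measure lebesgue {u j<..<v j}" by simp
        qed
        also have "\<dots> = measure lebesgue (\<Union>j<card D0. {u j<..<v j})"
          using disj by (intro measure_UNION'[symmetric]) (auto simp: pairwise_def disjnt_def disjoint_family_on_def)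
        also have "\<dots> \<le> measure lebesgue V"
        proof (rule measure_mono_fmeasurable[OF _ _ V_meas(1)])
          have "{u j<..<v j} \<subseteq> V" if "j < card D0" for j
            using kj[OF that] r(2)[OF dD(2)[OF that]] by fastforce
          then show "(\<Union>j<card D0. {u j<..<v j}) \<subseteq> V" by blast
        qed auto
        also have "\<dots> < \<delta>" by (rule V_meas)
        finally have "(\<Sum>j<card D0. \<bar>F (v j) - F (u j)\<bar>) < e / 2"
          using kj disj by (intro \<delta>(2)) fastforce+
        also have "(\<Sum>j<card D0. \<bar>F (v j) - F (u j)\<bar>) =
            (\<Sum>z\<in>D0. \<bar>F (Sup (snd z)) - F (Inf (snd z))\<bar>)"
          unfolding u_def v_def by (rule sum.reindex_bij_betw[OF d])
        also have "\<dots> = (\<Sum>(x, K)\<in>D0. \<bar>measure lborel K *\<^sub>R g x - (F (Sup K) - F (Inf K))\<bar>)"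
          by (intro sum.cong) (auto simp: D0_def g_def)
        finally show ?thesis unfolding D0_def .
      qed
      finally show "norm ((\<Sum>(x, K)\<in>D. measure lborel K *\<^sub>R g x) - (F b - F a)) < e" by simp
    qed
  qed
  then have "(g has_integral (F b - F a)) {a..b}" by simp
  then show ?thesis by (rule has_integral_spike[OF S, rotated]) (auto simp: g_def)
qed

section \<open>Local inequalities and divided differences\<close>

text \<open>A gauge integral need not be absolutely convergent. If the right side is infinite there
  is nothing to prove, and if it is finite the gauge and Lebesgue integrals agree.\<close>

lemma has_integral_abs_le_nn_integral:
  fixes g :: "real \<Rightarrow> real"
  assumes g: "(g has_integral I) {a..b}" and [measurable]: "g \<in> borel_measurable lebesgue"
  shows "ennreal \<bar>I\<bar> \<le> (\<integral>\<^sup>+x\<in>{a..b}. ennreal \<bar>g x\<bar> \<partial>lebesgue)"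
proof (cases "(\<integral>\<^sup>+x\<in>{a..b}. ennreal \<bar>g x\<bar> \<partial>lebesgue) = \<infinity>")
  case False
  have eq: "(\<integral>\<^sup>+x\<in>{a..b}. ennreal \<bar>g x\<bar> \<partial>lebesgue) = (\<integral>\<^sup>+x. ennreal (norm (indicator {a..b} x *\<^sub>R g x)) \<partial>lebesgue)"
    by (intro nn_integral_cong) (auto simp: indicator_def)
  have [measurable]: "{a..b} \<in> sets lebesgue" by simp
  have int: "set_integrable lebesgue {a..b} g"
    unfolding set_integrable_def
  proof (rule integrableI_bounded)
    show "(\<lambda>x. indicator {a..b} x *\<^sub>R g x) \<in> borel_measurable lebesgue" by measurable
  qed (use False eq in \<open>auto simp: less_top\<close>)
  have "I = (LINT x:{a..b}|lebesgue. g x)"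
    using has_integral_set_lebesgue[OF int] g has_integral_unique by blast
  then have "\<bar>I\<bar> \<le> (LINT x|lebesgue. norm (indicator {a..b} x *\<^sub>R g x))"
    unfolding set_lebesgue_integral_def by (metis integral_norm_bound real_norm_def)
  then have "ennreal \<bar>I\<bar> \<le> ennreal (LINT x|lebesgue. norm (indicator {a..b} x *\<^sub>R g x))"
    by (rule ennreal_leI)
  also have "\<dots> = (\<integral>\<^sup>+x. ennreal (norm (indicator {a..b} x *\<^sub>R g x)) \<partial>lebesgue)"
    using int unfolding set_integrable_def by (intro nn_integral_eq_integral[symmetric]) auto
  finally show ?thesis unfolding eq .
qed simp

text \<open>Where \<open>\<bar>z\<bar>\<close> exceeds \<open>t\<close>, the factor
  \<open>(\<bar>z\<bar> / t) powr (p - 1)\<close> is at least one. This replaces Hoelder's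
  inequality wherever an integral of \<open>\<bar>g\<bar>\<close> is to be controlled by one of
  \<open>\<bar>g\<bar> powr p\<close>.\<close>

lemma abs_le_cutoff_powr:
  fixes z :: real
  assumes "t > 0" "p > 1"
  shows "\<bar>z\<bar> \<le> t + t powr (1 - p) * \<bar>z\<bar> powr p"
proof (cases "\<bar>z\<bar> \<le> t")
  case False
  have "\<bar>z\<bar> = \<bar>z\<bar> powr (1 - p) * \<bar>z\<bar> powr p"
    using False assms by (simp add: powr_add[symmetric])
  also have "\<dots> \<le> t powr (1 - p) * \<bar>z\<bar> powr p"
    using False assms by (intro mult_right_mono powr_mono2') auto
  finally show ?thesis using assms by linarith
qed (simp add: add_increasing2)

text \<open>Hoelder's inequality up to a constant, by cutting the integrand at half of its mean value.\<close>

lemma powr_integral_le: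
  fixes g :: "real \<Rightarrow> real"
  assumes p: "1 < p" and ab: "a < b" and [measurable]: "g \<in> borel_measurable lebesgue" and M: "0 \<le> M"
    "ennreal M \<le> (\<integral>\<^sup>+x\<in>{a..b}. ennreal \<bar>g x\<bar> \<partial>lebesgue)"
  shows "ennreal (M powr p * (b - a) powr (1 - p))
    \<le> ennreal (2 powr p) * (\<integral>\<^sup>+x\<in>{a..b}. ennreal (\<bar>g x\<bar> powr p) \<partial>lebesgue)"
proof (cases "M = 0")
  case False
  then have "M > 0" using M by simp
  define L where "L = b - a"
  have "L > 0" using ab by (simp add: L_def)
  have [measurable]: "{a..b} \<in> sets lebesgue" by simp
  define t where "t = M / (2 * L)"
  have "t > 0" using \<open>M > 0\<close> \<open>L > 0\<close> by (simp add: t_def)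
  define B where "B = (\<integral>\<^sup>+x\<in>{a..b}. ennreal (\<bar>g x\<bar> powr p) \<partial>lebesgue)"
  have pt: "\<bar>g x\<bar> \<le> t + t powr (1 - p) * \<bar>g x\<bar> powr p" for x
    by (rule abs_le_cutoff_powr[OF \<open>t > 0\<close> p])
  have "ennreal M \<le> (\<integral>\<^sup>+x\<in>{a..b}. ennreal t + ennreal (t powr (1 - p)) * ennreal (\<bar>g x\<bar> powr p) \<partial>lebesgue)"
  proof (rule order_trans[OF M(2)], intro nn_integral_mono mult_right_mono)
    fix x
    show "ennreal \<bar>g x\<bar> \<le> ennreal t + ennreal (t powr (1 - p)) * ennreal (\<bar>g x\<bar> powr p)"
      using pt[of x] \<open>t > 0\<close> by (simp add: ennreal_plus[symmetric] ennreal_mult[symmetric] del: ennreal_plus)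
  qed simp
  also have "\<dots> = (\<integral>\<^sup>+x\<in>{a..b}. ennreal t \<partial>lebesgue) +
      (\<integral>\<^sup>+x. ennreal (t powr (1 - p)) * (ennreal (\<bar>g x\<bar> powr p) * indicator {a..b} x) \<partial>lebesgue)"
    by (subst nn_integral_add[symmetric], measurable) (auto intro!: nn_integral_cong simp: algebra_simps)
  also have "\<dots> = ennreal t * ennreal L + ennreal (t powr (1 - p)) * B"
    using ab by (subst nn_integral_cmult) (auto simp: B_def L_def nn_integral_cmult_indicator)
  also have "ennreal t * ennreal L = ennreal (M / 2)"
    using \<open>t > 0\<close> \<open>L > 0\<close> by (simp add: t_def ennreal_mult[symmetric])
  finally have *: "ennreal M \<le> ennreal (M / 2) + ennreal (t powr (1 - p)) * B" .
  show ?thesis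
  proof (cases B)
    case (real r)
    have "M \<le> M / 2 + t powr (1 - p) * r"
      using * real \<open>M > 0\<close> by (simp add: ennreal_mult[symmetric] ennreal_plus[symmetric] del: ennreal_plus)
    then have "M / 2 * t powr (p - 1) \<le> t powr (1 - p) * r * t powr (p - 1)"
      by (intro mult_right_mono) auto
    also have "\<dots> = r" using \<open>t > 0\<close> by (simp add: powr_add[symmetric] algebra_simps)
    finally have "M / 2 * t powr (p - 1) \<le> r" .
    moreover have "2 powr p * (M / 2 * t powr (p - 1)) = M powr p * L powr (1 - p)"
      using \<open>M > 0\<close> \<open>L > 0\<close>
      by (simp add: t_def powr_divide powr_mult powr_diff field_simps)
    ultimately have "M powr p * L powr (1 - p) \<le> 2 powr p * r"
      by (metis mult_left_mono powr_ge_zero)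
    then show ?thesis using real unfolding B_def[symmetric] L_def[symmetric]
      by (simp add: ennreal_mult[symmetric])
  next
    case top
    then show ?thesis unfolding B_def[symmetric] by (simp add: ennreal_mult_top)
  qed
qed (use p in simp)

text \<open>Either the integral of \<open>\<bar>g\<bar>\<close>, which bounds the oscillation,
  reaches half of \<open>\<bar>F \<xi>\<bar>\<close> and the Hoelder bound applies, or
  \<open>\<bar>F\<bar>\<close> stays above that half on the whole interval. Halving and Hoelder
  contribute \<open>2 powr p\<close> each. Only \<open>le\<close> ties \<open>g\<close> to
  \<open>F\<close>, so classical and almost everywhere derivatives are treated alike.\<close>

lemma local_sobolev:
  fixes F g :: "real \<Rightarrow> real"
  assumes p: "1 < p" and ab: "a < b" "b - a \<le> 1" and xi: "\<xi> \<in> {a..b}"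
    and [measurable]: "F \<in> borel_measurable lebesgue" "g \<in> borel_measurable lebesgue"
    and le: "\<And>y. y \<in> {a..b} \<Longrightarrow> ennreal \<bar>F \<xi> - F y\<bar> \<le> (\<integral>\<^sup>+x\<in>{a..b}. ennreal \<bar>g x\<bar> \<partial>lebesgue)"
  shows "ennreal ((b - a) * \<bar>F \<xi>\<bar> powr p) \<le> ennreal (4 powr p) *
    ((\<integral>\<^sup>+x\<in>{a..b}. ennreal (\<bar>F x\<bar> powr p) \<partial>lebesgue) + (\<integral>\<^sup>+x\<in>{a..b}. ennreal (\<bar>g x\<bar> powr p) \<partial>lebesgue))"
proof -
  define M where "M = \<bar>F \<xi>\<bar> / 2"
  have "M \<ge> 0" by (simp add: M_def)
  have Mp: "\<bar>F \<xi>\<bar> powr p = 2 powr p * M powr p" by (simp add: M_def powr_divide)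
  have le4: "(2::real) powr p \<le> 4 powr p" "(1::real) \<le> 2 powr p" "(4::real) powr p = 2 powr p * 2 powr p"
    using p by (auto intro: powr_mono2 ge_one_powr_ge_zero simp: powr_mult[symmetric])
  show ?thesis
  proof (cases "ennreal M \<le> (\<integral>\<^sup>+x\<in>{a..b}. ennreal \<bar>g x\<bar> \<partial>lebesgue)")
    case True
    have "b - a \<le> 1 powr (1 - p)" using ab by simp
    also have "\<dots> \<le> (b - a) powr (1 - p)" using ab p by (intro powr_mono2') auto
    finally have "(b - a) * \<bar>F \<xi>\<bar> powr p \<le> 2 powr p * (M powr p * (b - a) powr (1 - p))"
      unfolding Mp using mult_left_mono[of "b - a" "(b - a) powr (1 - p)" "2 powr p * M powr p"]
      by (simp add: mult_ac)
    then have "ennreal ((b - a) * \<bar>F \<xi>\<bar> powr p) \<le> ennreal (2 powr p) * ennreal (M powr p * (b - a) powr (1 - p))"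
      by (simp add: ennreal_mult[symmetric] ennreal_leI)
    also have "\<dots> \<le> ennreal (2 powr p) * (ennreal (2 powr p) * (\<integral>\<^sup>+x\<in>{a..b}. ennreal (\<bar>g x\<bar> powr p) \<partial>lebesgue))"
      using True p ab \<open>M \<ge> 0\<close> by (intro mult_left_mono powr_integral_le) auto
    also have "\<dots> = ennreal (4 powr p) * (\<integral>\<^sup>+x\<in>{a..b}. ennreal (\<bar>g x\<bar> powr p) \<partial>lebesgue)"
      by (simp add: le4(3) ennreal_mult mult.assoc)
    also have "\<dots> \<le> ennreal (4 powr p) *
    ((\<integral>\<^sup>+x\<in>{a..b}. ennreal (\<bar>F x\<bar> powr p) \<partial>lebesgue) + (\<integral>\<^sup>+x\<in>{a..b}. ennreal (\<bar>g x\<bar> powr p) \<partial>lebesgue))"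
      by (intro mult_left_mono) auto
    finally show ?thesis .
  next
    case False
    have lower: "M \<le> \<bar>F y\<bar>" if "y \<in> {a..b}" for y
    proof -
      have "ennreal \<bar>F \<xi> - F y\<bar> < ennreal M" using le[OF that] False by (meson le_less_trans not_le)
      then have "\<bar>F \<xi> - F y\<bar> < M" by (simp add: ennreal_less_iff)
      then show ?thesis unfolding M_def by linarith
    qed
    have "ennreal ((b - a) * M powr p) = (\<integral>\<^sup>+x\<in>{a..b}. ennreal (M powr p) \<partial>lebesgue)"
      using ab by (simp add: nn_integral_cmult_indicator ennreal_mult mult.commute)
    also have "\<dots> \<le> (\<integral>\<^sup>+x\<in>{a..b}. ennreal (\<bar>F x\<bar> powr p) \<partial>lebesgue)"
      using lower p \<open>M \<ge> 0\<close>
      by (intro nn_integral_mono) (auto simp: indicator_def intro!: ennreal_leI powr_mono2)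
    finally have *: "ennreal ((b - a) * M powr p) \<le> (\<integral>\<^sup>+x\<in>{a..b}. ennreal (\<bar>F x\<bar> powr p) \<partial>lebesgue)" .
    have "ennreal ((b - a) * \<bar>F \<xi>\<bar> powr p) = ennreal (2 powr p) * ennreal ((b - a) * M powr p)"
      using ab by (simp add: Mp ennreal_mult[symmetric] mult_ac)
    also have "\<dots> \<le> ennreal (4 powr p) *
    ((\<integral>\<^sup>+x\<in>{a..b}. ennreal (\<bar>F x\<bar> powr p) \<partial>lebesgue) + (\<integral>\<^sup>+x\<in>{a..b}. ennreal (\<bar>g x\<bar> powr p) \<partial>lebesgue))"
      using * le4 by (intro mult_mono) (auto intro: ennreal_leI add_increasing2)
    finally show ?thesis .
  qed
qed

section \<open>Divided differences by recursion and their mean value theorem\<close>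

fun dd :: "(int \<Rightarrow> real) \<Rightarrow> (int \<Rightarrow> real) \<Rightarrow> nat \<Rightarrow> int \<Rightarrow> real" where
  "dd y v 0 i = v i"
| "dd y v (Suc s) i = (dd y v s (i + 1) - dd y v s i) / (y (i + int (Suc s)) - y i)"

text \<open>Neville's scheme for the interpolating polynomial at
  \<open>y i, ..., y (i + int s)\<close>. Its coefficient of degree \<open>s\<close> obeys the same
  recursion as \<open>dd\<close>.\<close>

fun neville :: "(int \<Rightarrow> real) \<Rightarrow> (int \<Rightarrow> real) \<Rightarrow> nat \<Rightarrow> int \<Rightarrow> real poly" where
  "neville y v 0 i = [:v i:]"
| "neville y v (Suc s) i = smult (1 / (y (i + int (Suc s)) - y i))
     ([:- y i, 1:] * neville y v s (i + 1) - [:- y (i + int (Suc s)), 1:] * neville y v s i)"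

lemma dd_cong:
  assumes "\<And>l. l \<le> s \<Longrightarrow> y (i + int l) = y' (i + int l)" "\<And>l. l \<le> s \<Longrightarrow> v (i + int l) = v' (i + int l)"
  shows "dd y v s i = dd y' v' s i"
  using assms
proof (induction s arbitrary: i)
  case 0
  from 0(2)[of 0] show ?case by simp
next
  case (Suc s)
  have "dd y v s (i + 1) = dd y' v' s (i + 1)"
    using Suc.prems(1)[of "Suc _"] Suc.prems(2)[of "Suc _"]
    by (intro Suc.IH) (simp_all add: algebra_simps)
  moreover have "dd y v s i = dd y' v' s i"
    using Suc.prems by (intro Suc.IH) auto
  ultimately show ?case using Suc.prems(1)[of 0] Suc.prems(1)[of "Suc s"] by simp
qed

lemma degree_neville: "degree (neville y v s i) \<le> s"
proof (induction s arbitrary: i)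
  case (Suc s)
  have "degree ([:- c, 1:] * neville y v s j) \<le> Suc s" for c j
    using degree_mult_le[of "[:- c, 1:]" "neville y v s j"] Suc[of j] by simp
  then show ?case
    by (auto intro!: order_trans[OF degree_smult_le] degree_diff_le simp del: mult_pCons_left)
qed simp

lemma coeff_neville: "coeff (neville y v s i) s = dd y v s i"
proof (induction s arbitrary: i)
  case (Suc s)
  have "coeff (neville y v s j) (Suc s) = 0" for j
    using degree_neville[of y v s j] by (intro coeff_eq_0) simp
  then show ?case using Suc by (simp add: coeff_pCons)
qed simp

lemma poly_neville:
  assumes y: "strict_mono y" and "l \<le> s"
  shows "poly (neville y v s i) (y (i + int l)) = v (i + int l)"
  using assms(2)
proof (induction s arbitrary: i l)
  case (Suc s)
  define d where "d = y (i + int (Suc s)) - y i"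
  have "d \<noteq> 0" using strict_monoD[OF y, of i "i + int (Suc s)"] by (simp add: d_def)
  have eq: "poly (neville y v (Suc s) i) z = ((z - y i) * poly (neville y v s (i + 1)) z
      - (z - y (i + int (Suc s))) * poly (neville y v s i) z) / d" for z
    by (simp add: d_def del: mult_pCons_left)
  consider "l = 0" | "l = Suc s" | l' where "l = Suc l'" "l' < s" using Suc.prems by (cases l) force+
  then show ?case
  proof cases
    case 1
    then show ?thesis using Suc.IH[of 0 i] \<open>d \<noteq> 0\<close> unfolding eq by (simp add: d_def field_simps)
  next
    case 2
    then show ?thesis using Suc.IH[of s "i + 1"] \<open>d \<noteq> 0\<close> unfolding eq by (simp add: d_def field_simps)
  next
    case 3
    have "poly (neville y v s (i + 1)) (y (i + int l)) = v (i + int l)"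
      using Suc.IH[of l' "i + 1"] 3 by (simp add: algebra_simps)
    moreover have "poly (neville y v s i) (y (i + int l)) = v (i + int l)"
      using Suc.IH[of l i] 3 by simp
    ultimately show ?thesis using \<open>d \<noteq> 0\<close> unfolding eq by (simp add: d_def field_simps)
  qed
qed simp

lemma image_int_interval: "y ` {i..i + int k} = (\<lambda>l. y (i + int l)) ` {..k}"
proof -
  have "{i..i + int k} = (\<lambda>l. i + int l) ` {..k}"
  proof safe
    fix j assume "j \<in> {i..i + int k}"
    then show "j \<in> (\<lambda>l. i + int l) ` {..k}" by (intro image_eqI[of _ _ "nat (j - i)"]) auto
  qed auto
  then show ?thesis by (simp add: image_image)
qed

lemma divided_diff_eq_dd:
  assumes y: "strict_mono y"
  shows "divided_diff f (y ` {i..i + int k}) = dd y (f \<circ> y) k i"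
proof -
  define S where "S = y ` {i..i + int k}"
  have "inj_on y {i..i + int k}" using strict_mono_imp_inj_on[OF y] by (meson inj_on_subset subset_UNIV)
  then have card: "card S = k + 1" unfolding S_def by (subst card_image) auto
  have "S \<noteq> {}" "finite S" by (auto simp: S_def)
  have "lagrange_poly f S = neville y (f \<circ> y) k i"
    unfolding lagrange_poly_def
  proof (rule the1_equality[OF lagrange_poly_ex1[OF \<open>finite S\<close> \<open>S \<noteq> {}\<close>]])
    show "degree (neville y (f \<circ> y) k i) \<le> card S - 1 \<and> (\<forall>x\<in>S. poly (neville y (f \<circ> y) k i) x = f x)"
      using degree_neville[of y "f \<circ> y" k i] card poly_neville[OF y, of _ k "f \<circ> y" i]
      unfolding S_def image_int_interval by auto
  qed
  then show ?thesis
    using coeff_neville[of y "f \<circ> y" k i] card by (simp add: divided_diff_def S_def)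
qed

text \<open>Rolle's theorem between consecutive zeros gives one zero fewer for the next derivative.
  The derivatives form a family \<open>g r\<close> instead of iterates of \<open>deriv\<close>, so
  that derivatives of a polynomial can be subtracted order by order.\<close>

lemma higher_rolle:
  fixes g :: "nat \<Rightarrow> real \<Rightarrow> real"
  assumes "\<And>r x. r < k \<Longrightarrow> (g r has_real_derivative g (Suc r) x) (at x)"
    and "\<And>l. l < k \<Longrightarrow> z l < z (Suc l)" and "\<And>l. l \<le> k \<Longrightarrow> g 0 (z l) = 0"
  shows "\<exists>\<xi>. z 0 \<le> \<xi> \<and> \<xi> \<le> z k \<and> g k \<xi> = 0"
  using assms
proof (induction k arbitrary: g z)
  case 0
  then show ?case by (intro exI[of _ "z 0"]) auto
next
  case (Suc k)
  have "\<exists>w. z l < w \<and> w < z (Suc l) \<and> g 1 w = 0" if l: "l \<le> k" for l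
  proof -
    have der: "\<And>x. (g 0 has_real_derivative g 1 x) (at x)" using Suc.prems(1)[of 0] by simp
    have "continuous_on {z l..z (Suc l)} (g 0)" using der by (intro DERIV_continuous_on) (rule DERIV_subset, auto)
    moreover have "g 0 (z l) = g 0 (z (Suc l))" using Suc.prems(3)[of l] Suc.prems(3)[of "Suc l"] l by simp
    ultimately obtain w where "z l < w" "w < z (Suc l)" "(g 0 has_real_derivative 0) (at w)"
      using Rolle_deriv[of "z l" "z (Suc l)" "g 0" "\<lambda>x h. g 1 x * h"] Suc.prems(2)[of l] l der
      by (auto simp: has_field_derivative_def fun_eq_iff)
        (metis der has_field_derivative_def mult_1_right)
    then show ?thesis using DERIV_unique der by blast
  qed
  then obtain w where w: "\<And>l. l \<le> k \<Longrightarrow> z l < w l \<and> w l < z (Suc l) \<and> g 1 (w l) = 0" by metis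
  have "\<exists>\<xi>. w 0 \<le> \<xi> \<and> \<xi> \<le> w k \<and> g (Suc k) \<xi> = 0"
  proof (rule Suc.IH[of "\<lambda>r. g (Suc r)"])
    show "w l < w (Suc l)" if "l < k" for l
      using w[of l] w[of "Suc l"] that by (auto intro: less_trans)
  qed (use w Suc.prems(1) in auto)
  then show ?case using w[of 0] w[of k] by (meson le_refl less_imp_le order_trans zero_le)
qed

lemma DERIV_higher_pderiv:
  "((\<lambda>x. poly ((pderiv ^^ r) P) x) has_real_derivative poly ((pderiv ^^ Suc r) P) x) (at x)"
  using poly_DERIV[of "(pderiv ^^ r) P" x] by simp

text \<open>The interpolation error has \<open>k + 1\<close> zeros, hence its \<open>k\<close>-th
  derivative has one; the \<open>k\<close>-th derivative of the interpolating polynomial is the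
  constant \<open>fact k * dd y v k i\<close>.\<close>

lemma dd_mean_value:
  fixes g :: "nat \<Rightarrow> real \<Rightarrow> real"
  assumes y: "strict_mono y"
    and der: "\<And>r x. r < k \<Longrightarrow> (g r has_real_derivative g (Suc r) x) (at x)"
    and v: "\<And>l. l \<le> k \<Longrightarrow> g 0 (y (i + int l)) = v (i + int l)"
  shows "\<exists>\<xi>. y i \<le> \<xi> \<and> \<xi> \<le> y (i + int k) \<and> g k \<xi> = fact k * dd y v k i"
proof -
  define P where "P = neville y v k i"
  have "\<exists>\<xi>. y (i + int 0) \<le> \<xi> \<and> \<xi> \<le> y (i + int k) \<and> g k \<xi> - poly ((pderiv ^^ k) P) \<xi> = 0"
  proof (rule higher_rolle[of k "\<lambda>r x. g r x - poly ((pderiv ^^ r) P) x" "\<lambda>l. y (i + int l)"])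
    show "y (i + int l) < y (i + int (Suc l))" for l using strict_monoD[OF y] by simp
    show "g 0 (y (i + int l)) - poly ((pderiv ^^ 0) P) (y (i + int l)) = 0" if "l \<le> k" for l
      using v[OF that] poly_neville[OF y that] by (simp add: P_def)
  qed (intro DERIV_diff der DERIV_higher_pderiv)
  then obtain \<xi> where xi: "y i \<le> \<xi>" "\<xi> \<le> y (i + int k)" "g k \<xi> = poly ((pderiv ^^ k) P) \<xi>" by auto
  have "degree ((pderiv ^^ k) P) = 0"
    using degree_neville[of y v k i] by (simp add: degree_higher_pderiv P_def)
  then have "poly ((pderiv ^^ k) P) \<xi> = coeff ((pderiv ^^ k) P) 0"
    by (metis degree_eq_zeroE coeff_pCons_0 poly_pCons poly_0 mult_zero_right add_0_right)
  also have "\<dots> = fact k * dd y v k i"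
    using coeff_neville[of y v k i] by (simp add: coeff_higher_pderiv P_def pochhammer_fact)
  finally show ?thesis using xi by auto
qed

section \<open>Necessity\<close>

lemma indices_iff:
  "i \<in> indices l1 l2 k \<longleftrightarrow> i \<in> indices l1 l2 0 \<and> i + int k \<in> indices l1 l2 0"
  by (cases l1; cases l2) (auto simp: indices_def)

lemma indices_convex:
  assumes "i \<in> indices l1 l2 0" "j \<in> indices l1 l2 0" "i \<le> r" "r \<le> j"
  shows "r \<in> indices l1 l2 0"
  using assms by (cases l1; cases l2) (auto simp: indices_def)

text \<open>Every gap that is not between two old points has length at least one. This is what gives
  a window running past the right end the weight one and what makes such gaps big.\<close>

definition seq_extension ::
  "int extended \<Rightarrow> int extended \<Rightarrow> (int \<Rightarrow> real) \<Rightarrow> (int \<Rightarrow> real) \<Rightarrow> bool" where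
  "seq_extension l1 l2 x y \<longleftrightarrow> strict_mono y \<and> (\<forall>i\<in>indices l1 l2 0. y i = x i) \<and>
     (\<forall>i. i \<in> indices l1 l2 0 \<and> i + 1 \<in> indices l1 l2 0 \<or> y i + 1 \<le> y (i + 1))"

lemma strict_mono_int:
  fixes y :: "int \<Rightarrow> real"
  assumes "\<And>i. y i < y (i + 1)"
  shows "strict_mono y"
proof (rule strict_monoI)
  fix i j :: int assume "i < j"
  have "y i < y (i + 1 + int n)" for n
  proof (induction n)
    case 0
    then show ?case using assms[of i] by simp
  next
    case (Suc n)
    then show ?case using assms[of "i + 1 + int n"] by (simp add: algebra_simps)
  qed
  from this[of "nat (j - i - 1)"] \<open>i < j\<close> show "y i < y j" by simp
qed

lemma ex_seq_extension:
  assumes ne: "indices l1 l2 0 \<noteq> {}" and x: "strict_mono_on (indices l1 l2 0) x"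
  shows "\<exists>y. seq_extension l1 l2 x y"
proof -
  define I where "I = indices l1 l2 0"
  \<comment> \<open>The default zeros are never read: an index left of \<open>l1\<close> or right of
    \<open>l2\<close> exists only if that end is finite, since the index set is not empty.\<close>
  define a where "a = (case l1 of Fin a \<Rightarrow> a | _ \<Rightarrow> 0)"
  define b where "b = (case l2 of Fin b \<Rightarrow> b | _ \<Rightarrow> 0)"
  define y where "y i = (if i \<in> I then x i else if Fin i < l1 then x a + real_of_int (i - a)
     else x b + real_of_int (i - b))" for i
  have I: "i \<in> I \<longleftrightarrow> l1 \<le> Fin i \<and> Fin i \<le> l2" for i by (simp add: I_def indices_def)
  have step: "y i < y (i + 1) \<and> (i \<in> I \<and> i + 1 \<in> I \<or> y i + 1 \<le> y (i + 1))" for i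
  proof -
    consider "i \<in> I" "i + 1 \<in> I" | "i \<in> I" "i + 1 \<notin> I" | "i \<notin> I" "i + 1 \<in> I" | "i \<notin> I" "i + 1 \<notin> I"
      by blast
    then show ?thesis
    proof cases
      case 1
      then have "x i < x (i + 1)" using x unfolding I_def[symmetric] by (auto simp: strict_mono_on_def)
      then show ?thesis using 1 by (simp add: y_def)
    next
      case 2
      then have "l2 = Fin i" "\<not> Fin (i + 1) < l1" unfolding I by (cases l1; cases l2; auto)+
      then show ?thesis using 2 by (simp add: y_def b_def)
    next
      case 3
      then have "l1 = Fin (i + 1)" "Fin i < l1" unfolding I by (cases l1; cases l2; auto)+
      then show ?thesis using 3 by (simp add: y_def a_def)
    next
      case 4
      have "Fin i < l1 \<longleftrightarrow> Fin (i + 1) < l1"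
        using 4 ne unfolding I I_def[symmetric] by (cases l1; cases l2) (auto simp: I_def indices_def)
      then show ?thesis using 4 by (simp add: y_def)
    qed
  qed
  then have "strict_mono y" by (intro strict_mono_int) auto
  then show ?thesis using step
    by (intro exI[of _ y]) (auto simp: seq_extension_def I_def[symmetric] y_def)
qed

text \<open>A window that runs past \<open>l2\<close> has weight one by the convention of a point at
  infinity; in the prolonged sequence it crosses the first new gap, so its length is at least
  one.\<close>

lemma seq_extension_weight:
  assumes ext: "seq_extension l1 l2 x y" and i: "i \<in> indices l1 l2 0" and "m > 0"
  shows "e2ennreal (min 1 (ext_point l2 x (i + int m) - ext_point l2 x i)) = ennreal (min 1 (y (i + int m) - y i))"
proof (cases "i + int m \<in> indices l1 l2 0")
  case True
  have "ext_point l2 x (i + int m) = ereal (y (i + int m))" "ext_point l2 x i = ereal (y i)"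
    using True i ext by (auto simp: ext_point_def indices_def seq_extension_def)
  moreover have "min 1 (ereal a - ereal b) = ereal (min 1 (a - b))" for a b :: real
    by (auto simp: min_def)
  ultimately show ?thesis by (simp only: e2ennreal_ereal)
next
  case False
  obtain b where b: "l2 = Fin b" "i \<le> b" "b < i + int m"
    using False i by (cases l1; cases l2) (auto simp: indices_def)
  have mono: "strict_mono y" using ext by (simp add: seq_extension_def)
  have "b + 1 \<notin> indices l1 l2 0" using b by (auto simp: indices_def)
  then have "y b + 1 \<le> y (b + 1)" using ext by (auto simp: seq_extension_def)
  moreover have "y i \<le> y b" "y (b + 1) \<le> y (i + int m)" using b mono by (auto simp: strict_mono_less_eq)
  ultimately have "min 1 (y (i + int m) - y i) = 1" by linarith
  moreover have "ext_point l2 x (i + int m) = \<infinity>" "ext_point l2 x i = ereal (x i)"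
    using b by (auto simp: ext_point_def)
  moreover have "e2ennreal 1 = ennreal 1" by (simp add: e2ennreal_def one_ennreal.abs_eq sup_absorb2)
  ultimately show ?thesis by simp
qed

lemma W_sum_eq:
  assumes ext: "seq_extension l1 l2 x y" and "m > 0"
    and v: "\<And>i. i \<in> indices l1 l2 0 \<Longrightarrow> v i = f (x i)"
  shows "W_sum m p l1 l2 x f = (\<Sum>k\<le>m_of m (points l1 l2 x). \<Sum>\<^sub>\<infinity>i\<in>indices l1 l2 k.
     ennreal (min 1 (y (i + int m) - y i) * \<bar>dd y v k i\<bar> powr p))"
  unfolding W_sum_def
proof (intro sum.cong refl infsum_cong)
  fix k i assume i: "i \<in> indices l1 l2 k"
  have mono: "strict_mono y" using ext by (simp add: seq_extension_def)
  have ij: "j \<in> indices l1 l2 0" if "i \<le> j" "j \<le> i + int k" for j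
    using i that indices_convex[of i l1 l2 "i + int k" j] indices_iff[of i l1 l2 k] by auto
  then have xy: "y j = x j" if "i \<le> j" "j \<le> i + int k" for j
    using that ext by (auto simp: seq_extension_def)
  have "x ` {i..i + int k} = y ` {i..i + int k}" using xy by (intro image_cong) auto
  then have "divided_diff f (x ` {i..i + int k}) = dd y (f \<circ> y) k i"
    using divided_diff_eq_dd[OF mono] by simp
  also have "\<dots> = dd y v k i"
    by (intro dd_cong) (auto simp: ij xy v)
  finally have dd: "divided_diff f (x ` {i..i + int k}) = dd y v k i" .
  have "y i \<le> y (i + int m)" using mono by (simp add: strict_mono_less_eq)
  then show "e2ennreal (min 1 (ext_point l2 x (i + int m) - ext_point l2 x i)) *
      ennreal (\<bar>divided_diff f (x ` {i..i + int k})\<bar> powr p)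
    = ennreal (min 1 (y (i + int m) - y i) * \<bar>dd y v k i\<bar> powr p)"
    using seq_extension_weight[OF ext, of i m] ij[of i] \<open>m > 0\<close> by (simp add: dd ennreal_mult)
qed

lemma m_of_le: "m_of m E \<le> m"
  by (simp add: m_of_def)

text \<open>A window of order \<open>k\<close> consists of \<open>k + 1\<close> distinct points of
  the sequence. Conversely, the orders up to \<open>m\<close> that \<open>W_sum\<close> leaves out
  have no window at all.\<close>

lemma le_m_of:
  assumes x: "strict_mono_on (indices l1 l2 0) x" and i: "i \<in> indices l1 l2 k" and "k \<le> m"
  shows "k \<le> m_of m (points l1 l2 x)"
proof (cases "finite (points l1 l2 x)")
  case True
  have sub: "{i..i + int k} \<subseteq> indices l1 l2 0"
    using i indices_convex[of i l1 l2 "i + int k"] indices_iff[of i l1 l2 k] by auto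
  have "inj_on x (indices l1 l2 0)" using x by (rule strict_mono_on_imp_inj_on)
  then have "card (x ` {i..i + int k}) = k + 1"
    using sub by (subst card_image) (auto intro: inj_on_subset)
  moreover have "card (x ` {i..i + int k}) \<le> card (points l1 l2 x)"
    using True sub by (intro card_mono) (auto simp: points_def)
  ultimately show ?thesis using True \<open>k \<le> m\<close> by (simp add: m_of_def)
qed (use \<open>k \<le> m\<close> in \<open>simp add: m_of_def\<close>)

text \<open>If \<open>i0\<close> is the smallest start of a window containing \<open>t\<close>,
  every other one starts at or before \<open>t\<close>, hence not after
  \<open>y (i0 + int m)\<close>.\<close>

lemma card_overlapping_windows:
  fixes y :: "int \<Rightarrow> real"
  assumes "strict_mono y" "finite F"
  shows "card {i \<in> F. y i \<le> t \<and> t \<le> y (i + int m)} \<le> m + 1"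
proof (cases "{i \<in> F. y i \<le> t \<and> t \<le> y (i + int m)} = {}")
  case False
  define A where "A = {i \<in> F. y i \<le> t \<and> t \<le> y (i + int m)}"
  define i0 where "i0 = Min A"
  have A: "finite A" "A \<noteq> {}" using assms(2) False by (auto simp: A_def)
  then have i0: "i0 \<in> A" "\<And>i. i \<in> A \<Longrightarrow> i0 \<le> i" by (auto simp: i0_def)
  have "A \<subseteq> {i0..i0 + int m}"
  proof
    fix i assume "i \<in> A"
    then have "y i \<le> y (i0 + int m)" using i0(1) by (auto simp: A_def)
    then show "i \<in> {i0..i0 + int m}"
      using i0(2)[OF \<open>i \<in> A\<close>] assms(1) by (simp add: strict_mono_less_eq)
  qed
  then have "card A \<le> card {i0..i0 + int m}" by (intro card_mono) auto
  then show ?thesis by (simp add: A_def)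
next
  case True
  show ?thesis unfolding True by simp
qed

lemma sum_windows_le:
  fixes y :: "int \<Rightarrow> real" and g :: "real \<Rightarrow> ennreal"
  assumes y: "strict_mono y" and F: "finite F" and [measurable]: "g \<in> borel_measurable lebesgue"
  shows "(\<Sum>i\<in>F. \<integral>\<^sup>+t\<in>{y i..y (i + int m)}. g t \<partial>lebesgue) \<le> of_nat (m + 1) * (\<integral>\<^sup>+t. g t \<partial>lebesgue)"
proof -
  have [measurable]: "{a..b} \<in> sets lebesgue" for a b :: real by simp
  have "(\<Sum>i\<in>F. \<integral>\<^sup>+t\<in>{y i..y (i + int m)}. g t \<partial>lebesgue)
      = (\<integral>\<^sup>+t. (\<Sum>i\<in>F. g t * indicator {y i..y (i + int m)} t) \<partial>lebesgue)"
    by (rule nn_integral_sum[symmetric]) measurable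
  also have "\<dots> \<le> (\<integral>\<^sup>+t. of_nat (m + 1) * g t \<partial>lebesgue)"
  proof (rule nn_integral_mono)
    fix t
    have "(\<Sum>i\<in>F. g t * indicator {y i..y (i + int m)} t)
        = (\<Sum>i\<in>{i \<in> F. y i \<le> t \<and> t \<le> y (i + int m)}. g t)"
      using F by (intro sum.mono_neutral_cong_right) (auto simp: indicator_def)
    also have "\<dots> = of_nat (card {i \<in> F. y i \<le> t \<and> t \<le> y (i + int m)}) * g t" by simp
    also have "\<dots> \<le> of_nat (m + 1) * g t"
      using card_overlapping_windows[OF y F] by (intro mult_right_mono of_nat_mono) auto
    finally show "(\<Sum>i\<in>F. g t * indicator {y i..y (i + int m)} t) \<le> of_nat (m + 1) * g t" .
  qed
  also have "\<dots> = of_nat (m + 1) * (\<integral>\<^sup>+t. g t \<partial>lebesgue)" by (rule nn_integral_cmult) measurable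
  finally show ?thesis .
qed

section \<open>Divided differences of a Sobolev function\<close>

lemma sobolev_W_jet_measurable:
  assumes "F \<in> sobolev_W m p" "k \<le> m"
  shows "(deriv ^^ k) F \<in> borel_measurable lebesgue"
  using assms by (auto simp: sobolev_W_def Lp_space_def)

lemma sobolev_W_jet_derivative:
  assumes "F \<in> sobolev_W m p" "k < m - 1"
  shows "((deriv ^^ k) F has_real_derivative (deriv ^^ Suc k) F x) (at x)"
  using assms by (simp add: sobolev_W_def sobolev_L_def DERIV_deriv_iff_real_differentiable)

text \<open>Below order \<open>m - 1\<close> the classical fundamental theorem applies; at order
  \<open>m - 1\<close> it is the version for absolutely continuous functions, the derivative being
  taken almost everywhere.\<close>

lemma sobolev_W_jet_increment:
  assumes F: "F \<in> sobolev_W m p" and k: "k < m" and "a \<le> b"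
  shows "ennreal \<bar>(deriv ^^ k) F b - (deriv ^^ k) F a\<bar> \<le> (\<integral>\<^sup>+t\<in>{a..b}. ennreal \<bar>(deriv ^^ Suc k) F t\<bar> \<partial>lebesgue)"
proof (rule has_integral_abs_le_nn_integral)
  show "(deriv ^^ Suc k) F \<in> borel_measurable lebesgue"
    using k by (intro sobolev_W_jet_measurable[OF F]) simp
  show "((deriv ^^ Suc k) F has_integral (deriv ^^ k) F b - (deriv ^^ k) F a) {a..b}"
  proof (cases "k < m - 1")
    case True
    show ?thesis
    proof (rule fundamental_theorem_of_calculus[OF \<open>a \<le> b\<close>])
      show "((deriv ^^ k) F has_vector_derivative (deriv ^^ Suc k) F x) (at x within {a..b})" for x
        using sobolev_W_jet_derivative[OF F True, of x]
        by (simp add: has_real_derivative_iff_has_vector_derivative has_vector_derivative_at_within)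
    qed
  next
    case False
    then have "k = m - 1" using k by simp
    then have ac: "abs_continuous_on {c..d} ((deriv ^^ k) F)" for c d
      using F by (auto simp: sobolev_W_def sobolev_L_def locally_abs_continuous_def)
    show ?thesis
      by (rule fundamental_theorem_of_calculus_abs_continuous[OF ac \<open>a \<le> b\<close>
            negligible_not_differentiable_abs_continuous[OF ac]])
        (simp add: DERIV_deriv_iff_real_differentiable)
  qed
qed

text \<open>A divided difference of order below \<open>m\<close> is a derivative at some point of its window, and that
  point lies in a subinterval of length \<open>min 1 (y (i + int m) - y i)\<close>.\<close>

lemma dd_powr_le:
  assumes F: "F \<in> sobolev_W m p" and p: "1 < p" and y: "strict_mono y" and k: "k \<le> m" and m: "m > 0"
    and v: "\<And>l. l \<le> k \<Longrightarrow> F (y (i + int l)) = v (i + int l)"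
  shows "ennreal (min 1 (y (i + int m) - y i) * \<bar>dd y v k i\<bar> powr p) \<le> ennreal (4 powr p) *
    (\<integral>\<^sup>+t\<in>{y i..y (i + int m)}. (\<Sum>r\<le>m. ennreal (\<bar>(deriv ^^ r) F t\<bar> powr p)) \<partial>lebesgue)"
proof -
  define G where "G r = (deriv ^^ r) F" for r
  define L where "L = y (i + int m) - y i"
  have L: "L > 0" using strict_monoD[OF y, of i "i + int m"] m by (simp add: L_def)
  have meas[measurable]: "G r \<in> borel_measurable lebesgue" if "r \<le> m" for r
    unfolding G_def using sobolev_W_jet_measurable[OF F that] .
  have ivl[measurable]: "{a..b} \<in> sets lebesgue" for a b :: real by simp
  have mono: "y (i + int k) \<le> y (i + int m)" using y k by (simp add: strict_mono_less_eq)
  have der: "(G r has_real_derivative G (Suc r) x) (at x)" if "r < m - 1" for r x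
    unfolding G_def using sobolev_W_jet_derivative[OF F that] .
  have incr: "ennreal \<bar>G r a - G r b\<bar> \<le> (\<integral>\<^sup>+t\<in>{c..d}. ennreal \<bar>G (Suc r) t\<bar> \<partial>lebesgue)"
    if "r < m" "a \<in> {c..d}" "b \<in> {c..d}" for r a b c d
  proof -
    have "ennreal \<bar>G r a - G r b\<bar> \<le> (\<integral>\<^sup>+t\<in>{min a b..max a b}. ennreal \<bar>G (Suc r) t\<bar> \<partial>lebesgue)"
      using sobolev_W_jet_increment[OF F that(1), of "min a b" "max a b"]
      by (auto simp: G_def min_def max_def abs_minus_commute split: if_splits)
    also have "\<dots> \<le> (\<integral>\<^sup>+t\<in>{c..d}. ennreal \<bar>G (Suc r) t\<bar> \<partial>lebesgue)"
      using that(2,3) by (intro nn_integral_mono) (auto simp: indicator_def)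
    finally show ?thesis .
  qed
  define H where "H t = (\<Sum>r\<le>m. ennreal (\<bar>G r t\<bar> powr p))" for t
  have [measurable]: "H \<in> borel_measurable lebesgue" unfolding H_def by measurable
  have le_H: "ennreal (\<bar>G r t\<bar> powr p) \<le> H t" if "r \<le> m" for r t
    unfolding H_def using that by (intro member_le_sum) auto
  have le_H2: "ennreal (\<bar>G r t\<bar> powr p) + ennreal (\<bar>G (Suc r) t\<bar> powr p) \<le> H t" if "r < m" for r t
  proof -
    have "(\<Sum>r\<in>{r, Suc r}. ennreal (\<bar>G r t\<bar> powr p)) \<le> H t"
      unfolding H_def using that by (intro sum_mono2) auto
    then show ?thesis by simp
  qed
  have "ennreal (min 1 L * \<bar>dd y v k i\<bar> powr p) \<le> ennreal (4 powr p) * (\<integral>\<^sup>+t\<in>{y i..y (i + int m)}. H t \<partial>lebesgue)"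
  proof (cases "k < m")
    case True
    obtain \<xi> where xi: "y i \<le> \<xi>" "\<xi> \<le> y (i + int k)" "G k \<xi> = fact k * dd y v k i"
      using dd_mean_value[OF y, of k G i v] der True v by (auto simp: G_def)
    define l where "l = min 1 L"
    define a where "a = min \<xi> (y (i + int m) - l)"
    have a: "y i \<le> a" "a \<le> \<xi>" "\<xi> \<le> a + l" "a + l \<le> y (i + int m)" "0 < l" "l \<le> 1"
      using xi mono L by (auto simp: a_def l_def L_def)
    have "\<bar>dd y v k i\<bar> * 1 \<le> \<bar>dd y v k i\<bar> * fact k"
      by (intro mult_left_mono) (auto simp: fact_ge_1)
    then have "\<bar>dd y v k i\<bar> \<le> \<bar>G k \<xi>\<bar>" unfolding xi(3) by (simp add: abs_mult mult.commute)
    then have "ennreal (l * \<bar>dd y v k i\<bar> powr p) \<le> ennreal ((a + l - a) * \<bar>G k \<xi>\<bar> powr p)"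
      using a p by (intro ennreal_leI) (auto intro!: mult_left_mono powr_mono2)
    also have "\<dots> \<le> ennreal (4 powr p) * ((\<integral>\<^sup>+t\<in>{a..a+l}. ennreal (\<bar>G k t\<bar> powr p) \<partial>lebesgue)
        + (\<integral>\<^sup>+t\<in>{a..a+l}. ennreal (\<bar>G (Suc k) t\<bar> powr p) \<partial>lebesgue))"
      by (intro local_sobolev p incr meas) (use a True in auto)
    also have "(\<integral>\<^sup>+t\<in>{a..a+l}. ennreal (\<bar>G k t\<bar> powr p) \<partial>lebesgue)
        + (\<integral>\<^sup>+t\<in>{a..a+l}. ennreal (\<bar>G (Suc k) t\<bar> powr p) \<partial>lebesgue)
      = (\<integral>\<^sup>+t\<in>{a..a+l}. (ennreal (\<bar>G k t\<bar> powr p) + ennreal (\<bar>G (Suc k) t\<bar> powr p)) \<partial>lebesgue)"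
      using meas[of k] meas[of "Suc k"] True
      by (subst nn_integral_add[symmetric]) (auto intro!: nn_integral_cong simp: algebra_simps)
    also have "\<dots> \<le> (\<integral>\<^sup>+t\<in>{y i..y (i + int m)}. H t \<partial>lebesgue)"
      using a le_H2[OF True] by (intro nn_integral_mono) (auto simp: indicator_def)
    finally show ?thesis by (simp add: l_def mult_left_mono)
  next
    \<comment> \<open>At order \<open>m\<close> the derivative exists only almost everywhere and has
      no mean value. Two mean values of order \<open>m - 1\<close>, from the two shorter windows,
      are subtracted instead; the factorial is at least one and is dropped.\<close>
    case False
    then have "k = m" using k by simp
    obtain m' where m': "m = Suc m'" using m by (cases m) auto
    have vm: "F (y (i + int l)) = v (i + int l)" if "l \<le> Suc m'" for l using v that \<open>k = m\<close> m' by simp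
    obtain \<xi> where xi: "y i \<le> \<xi>" "\<xi> \<le> y (i + int m')" "G m' \<xi> = fact m' * dd y v m' i"
      using dd_mean_value[OF y, of m' G i v] der vm by (auto simp: G_def m')
    have "F (y (i + 1 + int l)) = v (i + 1 + int l)" if "l \<le> m'" for l
      using vm[of "Suc l"] that by (simp add: algebra_simps)
    then obtain \<eta> where eta: "y (i + 1) \<le> \<eta>" "\<eta> \<le> y (i + 1 + int m')" "G m' \<eta> = fact m' * dd y v m' (i + 1)"
      using dd_mean_value[OF y, of m' G "i + 1" v] der by (auto simp: G_def m')
    define M where "M = \<bar>dd y v m' (i + 1) - dd y v m' i\<bar>"
    have "M * 1 \<le> M * fact m'" by (intro mult_left_mono) (auto simp: fact_ge_1 M_def)
    also have "M * fact m' = \<bar>fact m' * (dd y v m' (i + 1) - dd y v m' i)\<bar>"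
      by (simp add: M_def abs_mult mult.commute)
    also have "\<dots> = \<bar>G m' \<eta> - G m' \<xi>\<bar>" unfolding xi(3) eta(3) by (simp add: algebra_simps)
    finally have "ennreal M \<le> ennreal \<bar>G m' \<eta> - G m' \<xi>\<bar>" by (intro ennreal_leI) simp
    also have "\<dots> \<le> (\<integral>\<^sup>+t\<in>{y i..y (i + int m)}. ennreal \<bar>G (Suc m') t\<bar> \<partial>lebesgue)"
    proof (rule incr)
      have "y i \<le> y (i + 1)" "y (i + int m') \<le> y (i + int m)" using y m' by (auto simp: strict_mono_less_eq)
      then show "\<eta> \<in> {y i..y (i + int m)}" "\<xi> \<in> {y i..y (i + int m)}"
        using xi eta m' by (auto simp: algebra_simps)
    qed (simp add: m')
    finally have M: "ennreal M \<le> (\<integral>\<^sup>+t\<in>{y i..y (i + int m)}. ennreal \<bar>G m t\<bar> \<partial>lebesgue)" unfolding m' .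
    have dd: "\<bar>dd y v k i\<bar> = M / L"
      using L unfolding \<open>k = m\<close> m' by (simp add: M_def L_def m')
    \<comment> \<open>The weight is at most \<open>L\<close>, and the division by \<open>L\<close>
      inside the divided difference then leaves exactly the factor \<open>L powr (1 - p)\<close> of
      the Hoelder bound.\<close>
    have "min 1 L * \<bar>dd y v k i\<bar> powr p \<le> L * (M powr p / L powr p)"
      using L mult_right_mono[of "min 1 L" L "M powr p / L powr p"]
      unfolding dd by (simp add: powr_divide M_def)
    also have "\<dots> = M powr p * L powr (1 - p)" using L by (simp add: powr_diff)
    finally have "ennreal (min 1 L * \<bar>dd y v k i\<bar> powr p) \<le> ennreal (M powr p * (y (i + int m) - y i) powr (1 - p))"
      by (intro ennreal_leI) (simp add: L_def)
    also have "\<dots> \<le> ennreal (2 powr p) * (\<integral>\<^sup>+t\<in>{y i..y (i + int m)}. ennreal (\<bar>G m t\<bar> powr p) \<partial>lebesgue)"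
      using L M by (intro powr_integral_le p meas) (auto simp: L_def M_def)
    also have "\<dots> \<le> ennreal (4 powr p) * (\<integral>\<^sup>+t\<in>{y i..y (i + int m)}. H t \<partial>lebesgue)"
      using p le_H[of m] by (intro mult_mono nn_integral_mono ennreal_leI powr_mono2) (auto simp: indicator_def)
    finally show ?thesis .
  qed
  then show ?thesis by (simp add: L_def H_def G_def)
qed

lemma ennreal_infsum_le:
  fixes f :: "'a \<Rightarrow> ennreal"
  assumes "\<And>F. finite F \<Longrightarrow> F \<subseteq> A \<Longrightarrow> sum f F \<le> b"
  shows "infsum f A \<le> b"
  using assms by (subst nonneg_infsum_complete) (auto intro: SUP_least)

lemma nn_integral_Lp_norm:
  assumes "g \<in> Lp_space p" "p > 0"
  shows "(\<integral>\<^sup>+t. ennreal (\<bar>g t\<bar> powr p) \<partial>lebesgue) = ennreal (Lp_norm p g powr p)"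
proof -
  have "(LINT x|lebesgue. \<bar>g x\<bar> powr p) \<ge> 0" by (intro integral_nonneg_AE) auto
  moreover have "(\<integral>\<^sup>+t. ennreal (\<bar>g t\<bar> powr p) \<partial>lebesgue) = ennreal (LINT x|lebesgue. \<bar>g x\<bar> powr p)"
    using assms by (intro nn_integral_eq_integral) (auto simp: Lp_space_def)
  ultimately show ?thesis using assms(2) by (simp add: Lp_norm_def powr_powr)
qed

lemma Lp_norm_nonneg: "0 \<le> Lp_norm p g"
  by (simp add: Lp_norm_def)

lemma sobolev_W_norm_nonneg: "0 \<le> sobolev_W_norm m p F"
  by (simp add: sobolev_W_norm_def sum_nonneg Lp_norm_nonneg)

lemma W_tilde_le:
  assumes "W_sum m p l1 l2 x f \<le> ennreal (A powr p)" "0 \<le> A" "p > 0"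
  shows "W_tilde m p l1 l2 x f \<le> ennreal A"
proof -
  have fin: "W_sum m p l1 l2 x f \<noteq> top" using assms(1) by (auto simp: top_unique)
  then have "enn2real (W_sum m p l1 l2 x f) \<le> A powr p"
    using assms by (metis enn2real_leI powr_ge_zero)
  then have "enn2real (W_sum m p l1 l2 x f) powr (1 / p) \<le> (A powr p) powr (1 / p)"
    using assms by (intro powr_mono2) auto
  also have "\<dots> = A" using assms by (simp add: powr_powr)
  finally show ?thesis using fin by (simp add: W_tilde_def ennreal_leI)
qed

text \<open>The factor \<open>4\<close> is that of the local Sobolev inequality; one factor
  \<open>m + 1\<close> counts the orders of the divided differences, one the overlapping windows and
  one the derivatives summed in \<open>H\<close>. The cube is at least one, so it may be raised to
  the power \<open>p\<close>, and the constant is free of \<open>p\<close>.\<close>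

proposition W_tilde_le_sobolev_W_norm:
  assumes F: "F \<in> sobolev_W m p" and p: "1 < p" and m: "m > 0"
    and ext: "seq_extension l1 l2 x y" and f: "\<forall>z\<in>points l1 l2 x. F z = f z"
  shows "W_tilde m p l1 l2 x f \<le> ennreal (4 * real (m + 1) ^ 3 * sobolev_W_norm m p F)"
proof (rule W_tilde_le)
  define N where "N = sobolev_W_norm m p F"
  define H where "H t = (\<Sum>r\<le>m. ennreal (\<bar>(deriv ^^ r) F t\<bar> powr p))" for t
  have y: "strict_mono y" using ext by (simp add: seq_extension_def)
  have Hm[measurable]: "H \<in> borel_measurable lebesgue"
    unfolding H_def by (intro borel_measurable_sum measurable_compose[OF sobolev_W_jet_measurable[OF F]]) auto
  have "(\<integral>\<^sup>+t. H t \<partial>lebesgue) = (\<Sum>r\<le>m. \<integral>\<^sup>+t. ennreal (\<bar>(deriv ^^ r) F t\<bar> powr p) \<partial>lebesgue)"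
    unfolding H_def by (intro nn_integral_sum measurable_compose[OF sobolev_W_jet_measurable[OF F]]) auto
  also have "\<dots> = (\<Sum>r\<le>m. ennreal (Lp_norm p ((deriv ^^ r) F) powr p))"
    using F p by (intro sum.cong nn_integral_Lp_norm) (auto simp: sobolev_W_def)
  also have "\<dots> \<le> (\<Sum>r\<le>m. ennreal (N powr p))"
    unfolding N_def sobolev_W_norm_def using p
    by (intro sum_mono ennreal_leI powr_mono2 member_le_sum) (auto simp: Lp_norm_nonneg)
  also have "\<dots> = ennreal (real (m + 1) * N powr p)"
    by (simp add: ennreal_mult ennreal_of_nat_eq_real_of_nat)
  finally have H: "(\<integral>\<^sup>+t. H t \<partial>lebesgue) \<le> ennreal (real (m + 1) * N powr p)" .
  define c where "c = ennreal (4 powr p) * (of_nat (m + 1) * ennreal (real (m + 1) * N powr p))"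
  have "W_sum m p l1 l2 x f = (\<Sum>k\<le>m_of m (points l1 l2 x). \<Sum>\<^sub>\<infinity>i\<in>indices l1 l2 k.
     ennreal (min 1 (y (i + int m) - y i) * \<bar>dd y (f \<circ> x) k i\<bar> powr p))"
    by (rule W_sum_eq[OF ext m]) simp
  also have "\<dots> \<le> (\<Sum>k\<le>m_of m (points l1 l2 x). c)"
  proof (intro sum_mono ennreal_infsum_le)
    fix k S assume k: "k \<in> {..m_of m (points l1 l2 x)}" and S: "finite S" "S \<subseteq> indices l1 l2 k"
    have "(\<Sum>i\<in>S. ennreal (min 1 (y (i + int m) - y i) * \<bar>dd y (f \<circ> x) k i\<bar> powr p))
      \<le> (\<Sum>i\<in>S. ennreal (4 powr p) * (\<integral>\<^sup>+t\<in>{y i..y (i + int m)}. H t \<partial>lebesgue))"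
      unfolding H_def
    proof (intro sum_mono dd_powr_le F p y m)
      show "k \<le> m" using k m_of_le[of m] by (auto intro: order_trans)
      fix i l assume i: "i \<in> S" and "l \<le> k"
      then have "i + int l \<in> indices l1 l2 0"
        using S(2) indices_iff[of i l1 l2 k] indices_convex[of i l1 l2 "i + int k" "i + int l"] by auto
      then show "F (y (i + int l)) = (f \<circ> x) (i + int l)"
        using f ext by (auto simp: points_def seq_extension_def)
    qed
    also have "\<dots> \<le> ennreal (4 powr p) * (of_nat (m + 1) * (\<integral>\<^sup>+t. H t \<partial>lebesgue))"
      unfolding sum_distrib_left[symmetric] by (intro mult_left_mono sum_windows_le y S Hm) auto
    also have "\<dots> \<le> c" unfolding c_def using H by (intro mult_left_mono) auto
    finally show "(\<Sum>i\<in>S. ennreal (min 1 (y (i + int m) - y i) * \<bar>dd y (f \<circ> x) k i\<bar> powr p)) \<le> c" .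
  qed
  also have "\<dots> = of_nat (m_of m (points l1 l2 x) + 1) * c" by simp
  also have "\<dots> \<le> of_nat (m + 1) * c" by (intro mult_right_mono of_nat_mono) (auto simp: m_of_le)
  also have "\<dots> = ennreal (4 powr p * (real (m + 1) ^ 3 * N powr p))"
    by (simp add: c_def ennreal_mult ennreal_of_nat_eq_real_of_nat power3_eq_cube mult_ac del: of_nat_Suc of_nat_add)
  also have "\<dots> \<le> ennreal ((4 * real (m + 1) ^ 3 * N) powr p)"
  proof (intro ennreal_leI)
    have "(real (m + 1) ^ 3) powr 1 \<le> (real (m + 1) ^ 3) powr p"
      using p by (intro powr_mono one_le_power) auto
    then have "real (m + 1) ^ 3 \<le> (real (m + 1) ^ 3) powr p" by simp
    then show "4 powr p * (real (m + 1) ^ 3 * N powr p) \<le> (4 * real (m + 1) ^ 3 * N) powr p"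
      by (simp add: powr_mult mult_left_mono mult_right_mono N_def sobolev_W_norm_nonneg del: of_nat_Suc of_nat_add)
  qed
  finally show "W_sum m p l1 l2 x f \<le> ennreal ((4 * real (m + 1) ^ 3 * sobolev_W_norm m p F) powr p)"
    unfolding N_def .
qed (use p in \<open>auto simp: sobolev_W_norm_nonneg\<close>)

section \<open>Jets of products, steps and Newton polynomials\<close>

lemma DERIV_glue:
  fixes f g h :: "real \<Rightarrow> real"
  assumes g: "(g has_real_derivative d) (at a)" and h: "(h has_real_derivative d) (at a)" and e: "e > 0"
    and left: "\<And>x. \<lbrakk>a - e < x; x \<le> a\<rbrakk> \<Longrightarrow> f x = g x" and right: "\<And>x. \<lbrakk>a \<le> x; x < a + e\<rbrakk> \<Longrightarrow> f x = h x"
  shows "(f has_real_derivative d) (at a)"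
  unfolding has_field_derivative_def has_derivative_at_alt
proof (intro conjI allI impI bounded_linear_mult_right)
  fix \<epsilon> :: real assume "\<epsilon> > 0"
  obtain d1 where d1: "d1 > 0" "\<And>y. norm (y - a) < d1 \<Longrightarrow> norm (g y - g a - d * (y - a)) \<le> \<epsilon> * norm (y - a)"
    using g \<open>\<epsilon> > 0\<close> unfolding has_field_derivative_def has_derivative_at_alt by blast
  obtain d2 where d2: "d2 > 0" "\<And>y. norm (y - a) < d2 \<Longrightarrow> norm (h y - h a - d * (y - a)) \<le> \<epsilon> * norm (y - a)"
    using h \<open>\<epsilon> > 0\<close> unfolding has_field_derivative_def has_derivative_at_alt by blast
  have "norm (f y - f a - d * (y - a)) \<le> \<epsilon> * norm (y - a)" if y: "norm (y - a) < min e (min d1 d2)" for y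
  proof (cases "y \<le> a")
    case True
    then have "f y = g y" "f a = g a" using y e by (auto intro!: left)
    then show ?thesis using d1(2)[of y] y by simp
  next
    case False
    then have "f y = h y" "f a = h a" using y e by (auto intro!: right)
    then show ?thesis using d2(2)[of y] y by simp
  qed
  then show "\<exists>\<delta>>0. \<forall>y. norm (y - a) < \<delta> \<longrightarrow> norm (f y - f a - d * (y - a)) \<le> \<epsilon> * norm (y - a)"
    using d1(1) d2(1) e by (intro exI[of _ "min e (min d1 d2)"]) auto
qed

text \<open>Leibniz' formula for the jet of a product. A jet is a family indexed by the order, so
  that products of polynomials and steps can be formed without iterating
  \<open>deriv\<close>.\<close>

definition leib :: "(nat \<Rightarrow> real \<Rightarrow> real) \<Rightarrow> (nat \<Rightarrow> real \<Rightarrow> real) \<Rightarrow> nat \<Rightarrow> real \<Rightarrow> real" where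
  "leib f g k x = (\<Sum>r\<le>k. real (k choose r) * f r x * g (k - r) x)"

lemma DERIV_leib:
  assumes f: "\<And>r. r \<le> k \<Longrightarrow> (f r has_real_derivative f (Suc r) x) (at x)"
    and g: "\<And>r. r \<le> k \<Longrightarrow> (g r has_real_derivative g (Suc r) x) (at x)"
  shows "(leib f g k has_real_derivative leib f g (Suc k) x) (at x)"
proof -
  have "((\<lambda>x. \<Sum>r\<le>k. real (k choose r) * (f r x * g (k - r) x)) has_real_derivative
      (\<Sum>r\<le>k. real (k choose r) * (f (Suc r) x * g (k - r) x + g (Suc (k - r)) x * f r x))) (at x)"
    by (intro DERIV_sum DERIV_cmult DERIV_mult f g) auto
  moreover have "(\<Sum>r\<le>k. real (k choose r) * (f (Suc r) x * g (k - r) x + g (Suc (k - r)) x * f r x))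
      = leib f g (Suc k) x"
  proof -
    have 1: "(\<Sum>r\<le>k. real (k choose r) * (g (Suc (k - r)) x * f r x))
      = (\<Sum>r\<le>Suc k. real (k choose r) * (g (Suc k - r) x * f r x))"
      by (simp add: Suc_diff_le)
    also have "\<dots> = g (Suc k) x * f 0 x + (\<Sum>r\<le>k. real (k choose Suc r) * (g (k - r) x * f (Suc r) x))"
      by (subst sum.atMost_Suc_shift) simp
    finally have 2: "(\<Sum>r\<le>k. real (k choose r) * (g (Suc (k - r)) x * f r x))
      = g (Suc k) x * f 0 x + (\<Sum>r\<le>k. real (k choose Suc r) * (g (k - r) x * f (Suc r) x))" .
    have "leib f g (Suc k) x = f 0 x * g (Suc k) x + (\<Sum>r\<le>k. real (Suc k choose Suc r) * f (Suc r) x * g (k - r) x)"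
      unfolding leib_def by (subst sum.atMost_Suc_shift) simp
    also have "\<dots> = (\<Sum>r\<le>k. real (k choose r) * (f (Suc r) x * g (k - r) x)) +
        (g (Suc k) x * f 0 x + (\<Sum>r\<le>k. real (k choose Suc r) * (g (k - r) x * f (Suc r) x)))"
      by (simp add: algebra_simps sum.distrib)
    finally show ?thesis unfolding 2[symmetric] by (simp add: algebra_simps sum.distrib)
  qed
  ultimately show ?thesis unfolding leib_def by (simp add: mult.assoc)
qed

text \<open>Bounds of the shape \<open>A / L ^ r\<close> are stable under products of jets;
  \<open>2 ^ k\<close> is the sum of the binomial coefficients.\<close>

lemma abs_leib_le:
  assumes "\<And>r. r \<le> k \<Longrightarrow> \<bar>f r x\<bar> \<le> A / L ^ r" "\<And>r. r \<le> k \<Longrightarrow> \<bar>g r x\<bar> \<le> B / L ^ r" "L > 0" "A \<ge> 0"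
  shows "\<bar>leib f g k x\<bar> \<le> 2 ^ k * (A * B) / L ^ k"
proof -
  have "\<bar>leib f g k x\<bar> \<le> (\<Sum>r\<le>k. real (k choose r) * (A * B / L ^ k))"
    unfolding leib_def
  proof (rule order_trans[OF sum_abs sum_mono])
    fix r assume "r \<in> {..k}"
    then have "\<bar>f r x\<bar> * \<bar>g (k - r) x\<bar> \<le> (A / L ^ r) * (B / L ^ (k - r))"
      using assms by (intro mult_mono) auto
    also have "\<dots> = A * B / L ^ k" using \<open>r \<in> {..k}\<close> by (simp add: power_add[symmetric])
    finally show "\<bar>real (k choose r) * f r x * g (k - r) x\<bar> \<le> real (k choose r) * (A * B / L ^ k)"
      using mult_left_mono[of "\<bar>f r x\<bar> * \<bar>g (k - r) x\<bar>" "A * B / L ^ k" "real (k choose r)"]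
      by (simp add: abs_mult mult.assoc)
  qed
  also have "\<dots> = real (\<Sum>r\<le>k. k choose r) * (A * B / L ^ k)" by (simp only: sum_distrib_right of_nat_sum)
  also have "\<dots> = 2 ^ k * (A * B) / L ^ k" unfolding choose_row_sum by simp
  finally show ?thesis .
qed

text \<open>The jet of the constant one is neutral. At a knot the active switch has this jet, and
  the product keeps the jet of the polynomial.\<close>

lemma leib_unit:
  assumes "g 0 x = 1" "\<And>r. \<lbrakk>0 < r; r \<le> k\<rbrakk> \<Longrightarrow> g r x = 0"
  shows "leib f g k x = f k x"
proof -
  have "leib f g k x = (\<Sum>r\<in>{k}. real (k choose r) * f r x * g (k - r) x)"
    unfolding leib_def using assms(2) by (intro sum.mono_neutral_right) auto
  then show ?thesis using assms(1) by simp
qed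

lemma leib_zero:
  assumes "\<And>r. r \<le> k \<Longrightarrow> g r x = 0"
  shows "leib f g k x = 0"
  using assms by (simp add: leib_def)

section \<open>Smooth steps from polynomials\<close>

lemma dvd_pderiv_power:
  fixes P :: "real poly"
  assumes "[:- a, 1:] ^ Suc n dvd P"
  shows "[:- a, 1:] ^ n dvd pderiv P"
proof -
  obtain R where R: "P = [:- a, 1:] ^ Suc n * R" using assms by (elim dvdE)
  have "pderiv P = [:- a, 1:] ^ n * ([:- a, 1:] * pderiv R + smult (of_nat (Suc n)) (pderiv [:- a, 1:]) * R)"
    unfolding R pderiv_mult pderiv_power_Suc by (simp add: algebra_simps)
  then show ?thesis by (rule dvdI)
qed

lemma poly_higher_pderiv_root:
  fixes P :: "real poly"
  assumes "[:- a, 1:] ^ n dvd P" "k < n"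
  shows "poly ((pderiv ^^ k) P) a = 0"
proof -
  have "[:- a, 1:] ^ (n - k) dvd (pderiv ^^ k) P"
    using assms(2)
  proof (induction k)
    case (Suc k)
    then have "[:- a, 1:] ^ Suc (n - Suc k) dvd (pderiv ^^ k) P" by (simp add: Suc_diff_Suc)
    then show ?case using dvd_pderiv_power by simp
  qed (use assms(1) in simp)
  moreover have "[:- a, 1:] dvd [:- a, 1:] ^ (n - k)" using assms(2) by (intro dvd_power) auto
  ultimately have "[:- a, 1:] dvd (pderiv ^^ k) P" by (rule dvd_trans[rotated])
  then show ?thesis by (simp add: poly_eq_0_iff_dvd)
qed

lemma ex_antiderivative_poly: "\<exists>q :: real poly. pderiv q = p"
proof -
  define q where "q = (\<Sum>i\<le>degree p. monom (coeff p i / real (Suc i)) (Suc i))"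
  have "pderiv q = (\<Sum>i\<le>degree p. monom (coeff p i) i)"
    unfolding q_def by (simp add: higher_pderiv_sum[of 1, simplified] pderiv_monom)
  then show ?thesis by (auto simp: poly_as_sum_of_monoms)
qed

definition step_jet :: "nat \<Rightarrow> (nat \<Rightarrow> real \<Rightarrow> real) \<Rightarrow> real \<Rightarrow> bool" where
  "step_jet n S K \<longleftrightarrow> K \<ge> 1 \<and> (\<forall>k<n. \<forall>t. (S k has_real_derivative S (Suc k) t) (at t)) \<and>
     (\<forall>k\<le>n. \<forall>t\<le>0. S k t = 0) \<and> (\<forall>k\<le>n. \<forall>t\<ge>1. S k t = (if k = 0 then 1 else 0)) \<and>
     (\<forall>k\<le>n. \<forall>t. \<bar>S k t\<bar> \<le> K)"

text \<open>The step is the normalised antiderivative of \<open>t ^ n * (1 - t) ^ n\<close>, which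
  is positive inside the unit interval and vanishes to order \<open>n\<close> at both ends; the
  derivatives up to order \<open>n\<close> therefore match those of the constants zero and
  one.\<close>

lemma ex_step_jet: "\<exists>S K. step_jet n S K"
proof -
  \<comment> \<open>The constant factor corrects the sign, as \<open>[:- 1, 1:]\<close> stands for
    \<open>t - 1\<close>.\<close>
  define b :: "real poly" where "b = [:- 0, 1:] ^ n * [:- 1, 1:] ^ n * [:(- 1) ^ n:]"
  obtain q0 where q0: "pderiv q0 = b" using ex_antiderivative_poly by blast
  have b_pos: "poly b t > 0" if "0 < t" "t < 1" for t
  proof -
    have "poly b t = t ^ n * (1 - t) ^ n"
      by (simp add: b_def power_mult_distrib[symmetric] algebra_simps)
    then show ?thesis using that by simp
  qed
  have "poly q0 0 < poly q0 1"
    using poly_DERIV[of q0] b_pos q0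
    by (intro DERIV_pos_imp_increasing_open[of 0 1 "poly q0"]) (auto intro!: continuous_intros)
  define c where "c = poly q0 1 - poly q0 0"
  have "c > 0" using \<open>poly q0 0 < poly q0 1\<close> by (simp add: c_def)
  define q where "q = smult (1 / c) (q0 - [:poly q0 0:])"
  have q_Suc: "(pderiv ^^ Suc k) q = smult (1 / c) ((pderiv ^^ k) b)" for k
  proof -
    have "pderiv q = smult (1 / c) b" by (simp add: q_def pderiv_smult pderiv_diff pderiv_pCons q0)
    then show ?thesis by (simp only: funpow_Suc_right o_apply higher_pderiv_smult)
  qed
  have q0_val: "poly ((pderiv ^^ k) q) 0 = 0" if "k \<le> n" for k
  proof (cases k)
    case (Suc k')
    have "[:- 0, 1:] ^ n dvd b" unfolding b_def by (intro dvd_mult2) simp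
    then show ?thesis using poly_higher_pderiv_root[of 0 n b k'] that Suc q_Suc[of k'] by simp
  qed (simp add: q_def)
  have q1_val: "poly ((pderiv ^^ k) q) 1 = (if k = 0 then 1 else 0)" if "k \<le> n" for k
  proof (cases k)
    case (Suc k')
    have "[:- 1, 1:] ^ n dvd b" unfolding b_def by (intro dvd_mult2 dvd_mult) simp
    then show ?thesis using poly_higher_pderiv_root[of 1 n b k'] that Suc q_Suc[of k'] by simp
  qed (use \<open>c > 0\<close> in \<open>simp add: q_def c_def\<close>)
  define S where "S k t = (if t \<le> 0 then 0 else if t < 1 then poly ((pderiv ^^ k) q) t else if k = 0 then 1 else 0)" for k :: nat and t :: real
  have S0: "S k t = 0" if "t \<le> 0" for k t using that by (simp add: S_def)
  have S1: "S k t = (if k = 0 then 1 else 0)" if "t \<ge> 1" for k t using that by (simp add: S_def)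
  have Sq: "S k t = poly ((pderiv ^^ k) q) t" if "0 \<le> t" "t \<le> 1" "k \<le> n" for k t
    using that q0_val[of k] q1_val[of k] by (auto simp: S_def not_less)
  have der: "(S k has_real_derivative S (Suc k) t) (at t)" if "k < n" for k t
  proof -
    consider "t < 0" | "t = 0" | "0 < t" "t < 1" | "t = 1" | "t > 1" by linarith
    then show ?thesis
    proof cases
      case 1
      have "((\<lambda>_. 0) has_real_derivative 0) (at t)" by simp
      then have "(S k has_real_derivative 0) (at t)"
        by (rule has_field_derivative_transform_within_open[of _ _ _ "{..<0}"]) (use 1 S0 in auto)
      then show ?thesis using 1 S0 by simp
    next
      case 2
      have "((\<lambda>x. poly ((pderiv ^^ k) q) x) has_real_derivative 0) (at 0)"
        using DERIV_higher_pderiv[of k q 0] unfolding q0_val[OF Suc_leI[OF that]] .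
      then have "(S k has_real_derivative 0) (at 0)"
        by (rule DERIV_glue[OF DERIV_const _ zero_less_one]) (use S0 Sq that in auto)
      then show ?thesis using 2 S0 by simp
    next
      case 3
      have "(S k has_real_derivative poly ((pderiv ^^ Suc k) q) t) (at t)"
        by (rule has_field_derivative_transform_within_open[OF DERIV_higher_pderiv, of "{0<..<1}"]) (use 3 Sq that in auto)
      then show ?thesis using 3 Sq that by simp
    next
      case 4
      have "((\<lambda>x. poly ((pderiv ^^ k) q) x) has_real_derivative 0) (at 1)"
        using DERIV_higher_pderiv[of k q 1] unfolding q1_val[OF Suc_leI[OF that]] by (simp only: nat.distinct if_False)
      then have "(S k has_real_derivative 0) (at 1)"
        by (rule DERIV_glue[OF _ DERIV_const zero_less_one]) (use S1 Sq that in auto)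
      then show ?thesis using 4 S1 by simp
    next
      case 5
      have "((\<lambda>_. if k = 0 then 1 else 0) has_real_derivative 0) (at t)" by simp
      then have "(S k has_real_derivative 0) (at t)"
        by (rule has_field_derivative_transform_within_open[of _ _ _ "{1<..}"]) (use 5 S1 in auto)
      then show ?thesis using 5 S1 by simp
    qed
  qed
  have "\<exists>B. \<forall>t. \<bar>S k t\<bar> \<le> B" if "k \<le> n" for k
  proof -
    have "compact ((\<lambda>t. poly ((pderiv ^^ k) q) t) ` {0..1})"
      by (intro compact_continuous_image continuous_intros) simp
    from compact_imp_bounded[OF this]
    obtain B where "\<forall>z\<in>(\<lambda>t. poly ((pderiv ^^ k) q) t) ` {0..1}. norm z \<le> B"
      unfolding bounded_iff by blast
    then have B: "\<bar>poly ((pderiv ^^ k) q) t\<bar> \<le> B" if "t \<in> {0..1}" for t using that by auto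
    have "\<bar>S k t\<bar> \<le> max B 1" for t
      using B[of t] S0[of t k] S1[of t k] Sq[of t k] that by (cases "t \<le> 0"; cases "t \<ge> 1") auto
    then show ?thesis by blast
  qed
  then obtain B where B: "\<And>k t. k \<le> n \<Longrightarrow> \<bar>S k t\<bar> \<le> B k" by metis
  define K where "K = 1 + (\<Sum>k\<le>n. \<bar>B k\<bar>)"
  have "\<bar>S k t\<bar> \<le> K" if "k \<le> n" for k t
  proof -
    have "\<bar>B k\<bar> \<le> (\<Sum>k\<le>n. \<bar>B k\<bar>)" using that by (intro member_le_sum) auto
    then show ?thesis using B[OF that, of t] by (simp add: K_def)
  qed
  moreover have "K \<ge> 1" by (simp add: K_def sum_nonneg)
  ultimately have "step_jet n S K" unfolding step_jet_def using der S0 S1 by blast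
  then show ?thesis by blast
qed

section \<open>Newton polynomials and bounds for their derivatives\<close>

lemma higher_pderiv_linear_factor:
  fixes P :: "real poly"
  shows "(pderiv ^^ k) (P * [:- z, 1:]) = (pderiv ^^ k) P * [:- z, 1:] + smult (real k) ((pderiv ^^ (k - 1)) P)"
proof (induction k)
  case (Suc k)
  have "(pderiv ^^ Suc k) (P * [:- z, 1:])
    = pderiv ((pderiv ^^ k) P * [:- z, 1:] + smult (real k) ((pderiv ^^ (k - 1)) P))"
    by (simp only: funpow.simps o_apply Suc)
  also have "\<dots> = (pderiv ^^ Suc k) P * [:- z, 1:] + (pderiv ^^ k) P + smult (real k) (pderiv ((pderiv ^^ (k - 1)) P))"
    by (simp only: pderiv_add pderiv_smult pderiv_mult funpow.simps o_apply)
       (simp add: pderiv_pCons)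
  also have "smult (real k) (pderiv ((pderiv ^^ (k - 1)) P)) = smult (real k) ((pderiv ^^ k) P)"
    by (cases k) auto
  finally show ?case by (simp add: smult_add_left algebra_simps)
qed simp

text \<open>At most \<open>s ^ k\<close> choices of the factors to be differentiated, each remaining
  factor being at most \<open>D\<close>. The quotient \<open>D ^ s / D ^ k\<close> also covers
  \<open>k > s\<close>, where the derivative is zero.\<close>

lemma abs_higher_pderiv_linear_prod_le:
  fixes z :: "nat \<Rightarrow> real"
  assumes "\<And>l. l < s \<Longrightarrow> \<bar>x - z l\<bar> \<le> D" "D > 0"
  shows "\<bar>poly ((pderiv ^^ k) (\<Prod>l<s. [:- z l, 1:])) x\<bar> \<le> real s ^ k * D ^ s / D ^ k"
  using assms(1)
proof (induction s arbitrary: k)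
  case 0
  show ?case by (cases k) (simp_all add: funpow_Suc_right del: funpow.simps)
next
  case (Suc s)
  define P where "P = (\<Prod>l<s. [:- z l, 1:])"
  have IH: "\<bar>poly ((pderiv ^^ k) P) x\<bar> \<le> real s ^ k * D ^ s / D ^ k" for k
    unfolding P_def using Suc by auto
  have "\<bar>poly ((pderiv ^^ k) (P * [:- z s, 1:])) x\<bar>
    = \<bar>poly ((pderiv ^^ k) P) x * (x - z s) + real k * poly ((pderiv ^^ (k - 1)) P) x\<bar>"
    unfolding higher_pderiv_linear_factor by (simp del: mult_pCons_right)
  also have "\<dots> \<le> \<bar>poly ((pderiv ^^ k) P) x\<bar> * \<bar>x - z s\<bar> + real k * \<bar>poly ((pderiv ^^ (k - 1)) P) x\<bar>"
    by (rule order_trans[OF abs_triangle_ineq]) (simp add: abs_mult)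
  also have "\<dots> \<le> (real s ^ k * D ^ s / D ^ k) * D + real k * (real s ^ (k - 1) * D ^ s / D ^ (k - 1))"
    using IH Suc.prems[of s] assms(2) by (intro add_mono mult_mono mult_left_mono) auto
  also have "\<dots> = (real s ^ k + real k * real s ^ (k - 1)) * D ^ Suc s / D ^ k"
    using assms(2) by (cases k) (auto simp: field_simps)
  also have "\<dots> \<le> real (Suc s) ^ k * D ^ Suc s / D ^ k"
  proof -
    \<comment> \<open>These are two terms of the binomial expansion of the right side.\<close>
    have "real s ^ k + real k * real s ^ (k - 1) \<le> real (Suc s) ^ k"
    proof (induction k)
      case (Suc k)
      have "real s ^ Suc k + real (Suc k) * real s ^ k = real s * (real s ^ k + real k * real s ^ (k - 1)) + real s ^ k"
        by (cases k) (auto simp: algebra_simps)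
      also have "\<dots> \<le> real s * real (Suc s) ^ k + real (Suc s) ^ k"
        by (intro add_mono mult_left_mono Suc power_mono) auto
      finally show ?case by (simp add: algebra_simps)
    qed simp
    then show ?thesis using assms(2) by (intro divide_right_mono mult_right_mono) auto
  qed
  finally show ?case by (simp add: P_def lessThan_Suc mult.commute)
qed

lemma poly_eq_smult_linear_prod:
  fixes P :: "real poly"
  assumes deg: "degree P \<le> s" and inj: "inj_on z {..<s}" and roots: "\<And>l. l < s \<Longrightarrow> poly P (z l) = 0"
  shows "P = smult (coeff P s) (\<Prod>l<s. [:- z l, 1:])"
proof (rule ccontr)
  define W where "W = (\<Prod>l<s. [:- z l, 1:])"
  define Q where "Q = P - smult (coeff P s) W"
  assume "P \<noteq> smult (coeff P s) (\<Prod>l<s. [:- z l, 1:])"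
  then have "Q \<noteq> 0" by (simp add: Q_def W_def)
  have W: "degree W = s" "coeff W s = 1"
  proof -
    show "degree W = s" unfolding W_def by (subst degree_prod_eq_sum_degree) auto
    have "lead_coeff W = 1" unfolding W_def by (simp add: lead_coeff_prod)
    then show "coeff W s = 1" using \<open>degree W = s\<close> by simp
  qed
  have "degree Q \<le> s" unfolding Q_def using deg W by (intro degree_diff_le) (auto intro: order_trans[OF degree_smult_le])
  moreover have "coeff Q s = 0" by (simp add: Q_def W)
  ultimately have "degree Q < s" using \<open>Q \<noteq> 0\<close> by (metis le_neq_implies_less leading_coeff_0_iff)
  moreover have "z ` {..<s} \<subseteq> {x. poly Q x = 0}"
    using roots by (auto simp: Q_def W_def poly_prod)
  then have "card (z ` {..<s}) \<le> card {x. poly Q x = 0}" by (intro card_mono poly_roots_finite \<open>Q \<noteq> 0\<close>)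
  then have "s \<le> degree Q" using card_poly_roots_bound[OF \<open>Q \<noteq> 0\<close>] card_image[OF inj] by simp
  ultimately show False by simp
qed

lemma neville_Suc_newton:
  assumes y: "strict_mono y"
  shows "neville y v (Suc s) i = neville y v s i + smult (dd y v (Suc s) i) (\<Prod>l<Suc s. [:- y (i + int l), 1:])"
proof -
  define P where "P = neville y v (Suc s) i - neville y v s i"
  have "P = smult (coeff P (Suc s)) (\<Prod>l<Suc s. [:- y (i + int l), 1:])"
  proof (rule poly_eq_smult_linear_prod)
    show "degree P \<le> Suc s" unfolding P_def
      using degree_neville[of y v "Suc s" i] degree_neville[of y v s i] by (intro degree_diff_le) auto
    show "inj_on (\<lambda>l. y (i + int l)) {..<Suc s}"
      using strict_mono_eq[OF y] by (auto simp: inj_on_def)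
    show "poly P (y (i + int l)) = 0" if "l < Suc s" for l
      using poly_neville[OF y, of l "Suc s" v i] poly_neville[OF y, of l s v i] that by (simp add: P_def del: neville.simps)
  qed
  moreover have "coeff P (Suc s) = dd y v (Suc s) i"
    using coeff_neville[of y v "Suc s" i] coeff_eq_0[of "neville y v s i" "Suc s"] degree_neville[of y v s i]
    by (simp add: P_def del: neville.simps dd.simps)
  ultimately show ?thesis unfolding P_def by (metis add_diff_cancel_left' diff_add_cancel add.commute)
qed

text \<open>Both polynomials interpolate at the \<open>s\<close> points that the two windows share,
  and the recursion for \<open>dd\<close> gives the leading coefficient. For
  \<open>s = m - 1\<close> this is the jump that the spline has to absorb when its window moves by
  one.\<close>

lemma neville_shift_diff:
  assumes y: "strict_mono y"
  shows "neville y v s (i + 1) - neville y v s i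
    = smult ((y (i + int (Suc s)) - y i) * dd y v (Suc s) i) (\<Prod>l<s. [:- y (i + 1 + int l), 1:])"
proof -
  define P where "P = neville y v s (i + 1) - neville y v s i"
  have "P = smult (coeff P s) (\<Prod>l<s. [:- y (i + 1 + int l), 1:])"
  proof (rule poly_eq_smult_linear_prod)
    show "degree P \<le> s" unfolding P_def
      using degree_neville by (intro degree_diff_le) auto
    show "inj_on (\<lambda>l. y (i + 1 + int l)) {..<s}"
      using strict_mono_eq[OF y] by (auto simp: inj_on_def)
    show "poly P (y (i + 1 + int l)) = 0" if "l < s" for l
      using poly_neville[OF y, of l s v "i + 1"] poly_neville[OF y, of "Suc l" s v i] that
      by (simp add: P_def algebra_simps del: neville.simps)
  qed
  moreover have co: "coeff P s = (y (i + int (Suc s)) - y i) * dd y v (Suc s) i"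
    using strict_monoD[OF y, of i "i + int (Suc s)"] by (simp add: P_def coeff_neville del: of_nat_Suc)
  ultimately show ?thesis unfolding P_def[symmetric] co[symmetric] by simp
qed

lemma poly_neville_newton_sum:
  assumes y: "strict_mono y"
  shows "neville y v s i = (\<Sum>t\<le>s. smult (dd y v t i) (\<Prod>l<t. [:- y (i + int l), 1:]))"
proof (induction s)
  case (Suc s)
  show ?case unfolding neville_Suc_newton[OF y] Suc by simp
qed simp

text \<open>Downward induction on the order: derivatives from order \<open>m\<close> on vanish, and
  the mean value inequality over a distance of at most one adds one term of the sum.\<close>

lemma abs_higher_pderiv_taylor_le:
  fixes P :: "real poly"
  assumes "degree P < m" "\<bar>x - c\<bar> \<le> 1"
  shows "\<bar>poly ((pderiv ^^ k) P) x\<bar> \<le> (\<Sum>r<m. \<bar>poly ((pderiv ^^ r) P) c\<bar>)"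
proof -
  have "\<bar>poly ((pderiv ^^ k) P) x\<bar> \<le> (\<Sum>r\<in>{k..<m}. \<bar>poly ((pderiv ^^ r) P) c\<bar>)"
    using assms(2)
  proof (induction "m - k" arbitrary: k x)
    case 0
    then have "coeff P (n + k) = 0" for n using assms(1) by (intro coeff_eq_0) simp
    then have "(pderiv ^^ k) P = 0" by (intro poly_eqI) (simp add: coeff_higher_pderiv)
    then show ?case by (simp add: sum_nonneg)
  next
    case (Suc n)
    have IH: "\<bar>poly ((pderiv ^^ Suc k) P) t\<bar> \<le> (\<Sum>r\<in>{Suc k..<m}. \<bar>poly ((pderiv ^^ r) P) c\<bar>)" if "\<bar>t - c\<bar> \<le> 1" for t
      using Suc.hyps(2) that by (intro Suc.hyps(1)) auto
    have "norm (poly ((pderiv ^^ k) P) x - poly ((pderiv ^^ k) P) c)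
        \<le> (\<Sum>r\<in>{Suc k..<m}. \<bar>poly ((pderiv ^^ r) P) c\<bar>) * norm (x - c)"
    proof (rule field_differentiable_bound[of "cball c 1"])
      show "(poly ((pderiv ^^ k) P) has_field_derivative poly ((pderiv ^^ Suc k) P) t) (at t within cball c 1)" for t
        using DERIV_higher_pderiv by (rule DERIV_subset) simp
      show "norm (poly ((pderiv ^^ Suc k) P) t) \<le> (\<Sum>r\<in>{Suc k..<m}. \<bar>poly ((pderiv ^^ r) P) c\<bar>)" if "t \<in> cball c 1" for t
        using IH[of t] that by (simp add: dist_real_def abs_minus_commute)
    qed (use Suc.prems in \<open>auto simp: dist_real_def abs_minus_commute\<close>)
    also have "\<dots> \<le> (\<Sum>r\<in>{Suc k..<m}. \<bar>poly ((pderiv ^^ r) P) c\<bar>) * 1"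
      using Suc.prems by (intro mult_left_mono) (auto simp: sum_nonneg)
    finally have "\<bar>poly ((pderiv ^^ k) P) x\<bar> \<le> \<bar>poly ((pderiv ^^ k) P) c\<bar> + (\<Sum>r\<in>{Suc k..<m}. \<bar>poly ((pderiv ^^ r) P) c\<bar>)"
      by simp
    then show ?case using Suc.hyps(2) by (simp add: sum.atLeast_Suc_lessThan)
  qed
  also have "\<dots> \<le> (\<Sum>r<m. \<bar>poly ((pderiv ^^ r) P) c\<bar>)" by (intro sum_mono2) auto
  finally show ?thesis .
qed

section \<open>The interpolating spline\<close>

text \<open>The step has \<open>m + 1\<close> orders so that the jet of the spline can still be
  differentiated at order \<open>m\<close>.\<close>

locale sobolev_spline =
  fixes m :: nat and y v :: "int \<Rightarrow> real" and S :: "nat \<Rightarrow> real \<Rightarrow> real" and K :: real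
  assumes m_pos: "m > 0" and y_mono: "strict_mono y" and step: "step_jet (Suc m) S K"
begin

text \<open>Half the threshold for big gaps: a transition of length \<open>c\<close> fits at either
  end of a big gap.\<close>

definition c :: real where "c = 1 / (2 * real m)"

definition gap :: "int \<Rightarrow> real" where "gap j = y (j + 1) - y j"

definition big :: "int \<Rightarrow> bool" where "big j \<longleftrightarrow> gap j \<ge> 2 * c"

definition nobig :: "int \<Rightarrow> nat \<Rightarrow> bool" where "nobig i s \<longleftrightarrow> (\<forall>t\<in>{i..<i + int s}. \<not> big t)"

text \<open>The cap makes all big gaps tie for the maximum, so the first longest gap of a window is
  its first big gap if there is one.\<close>

definition capped :: "int \<Rightarrow> real" where "capped j = min (gap j) (2 * c)"

text \<open>Among the gaps of the window starting at \<open>i\<close>, the first one of maximal capped length has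
  index at least \<open>j\<close>.\<close>

definition late :: "int \<Rightarrow> int \<Rightarrow> bool" where
  "late i j \<longleftrightarrow> (\<exists>t\<in>{j..i + int m - 1}. \<forall>s\<in>{i..<j}. capped s < capped t)"

text \<open>As \<open>j\<close> grows, the window starting at \<open>i\<close> is abandoned once its
  first longest gap has been crossed.\<close>

definition start :: "int \<Rightarrow> int" where
  "start j = Min {i \<in> {j - int m + 1..j}. late i j}"

text \<open>The degree of interpolation. It stops before the first big gap, so that data separated
  by a big gap do not interact.\<close>

definition ord :: "int \<Rightarrow> nat" where
  "ord i = Max {s. s \<le> m - 1 \<and> nobig i s}"

definition Q :: "int \<Rightarrow> real poly" where
  "Q j = neville y v (ord (start j)) (start j)"

text \<open>A small gap is used as a whole for the transition, a big one only in a piece of length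
  \<open>c\<close> at each end.\<close>

definition width :: "int \<Rightarrow> real" where "width j = (if big j then c else gap j)"

definition q :: "int \<Rightarrow> nat \<Rightarrow> real \<Rightarrow> real" where "q j k x = poly ((pderiv ^^ k) (Q j)) x"

definition off :: "int \<Rightarrow> nat \<Rightarrow> real \<Rightarrow> real" where
  "off j k x = (if k = 0 then 1 else 0) - S k ((x - y j) / width j) / width j ^ k"

definition on :: "int \<Rightarrow> nat \<Rightarrow> real \<Rightarrow> real" where
  "on j k x = S k ((x - y (j + 1) + width j) / width j) / width j ^ k"

text \<open>Whitney's interpolation between the jets \<open>Q j\<close> and \<open>Q (j + 1)\<close>, through zero if the gap is big.\<close>

definition phi :: "int \<Rightarrow> nat \<Rightarrow> real \<Rightarrow> real" where
  "phi j k x = leib (q j) (off j) k x + leib (q (j + 1)) (on j) k x"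

text \<open>The divided differences to which values of the spline after \<open>y j\<close> are
  charged. A window of \<open>m\<close> steps from any of these starting points contains the gap
  between \<open>y j\<close> and \<open>y (j + 1)\<close>.\<close>

definition A :: "int \<Rightarrow> real" where
  "A j = (\<Sum>d<m. \<Sum>s\<le>m. if nobig (j - int d) s then \<bar>dd y v s (j - int d)\<bar> else 0)"

section \<open>The windows and their longest gaps\<close>

lemma c_pos: "c > 0" and c_le: "2 * real m * c = 1"
  using m_pos by (auto simp: c_def)

lemma c_le_half: "2 * c \<le> 1"
  using m_pos by (auto simp: c_def)

lemma gap_pos: "gap j > 0"
  using strict_monoD[OF y_mono, of j "j + 1"] by (simp add: gap_def)

lemma width_pos: "width j > 0"
  by (simp add: width_def c_pos gap_pos)

lemma width_le_gap: "width j \<le> gap j"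
  using c_pos by (simp add: width_def big_def)

lemma sum_gap: "(\<Sum>t\<in>{i..<i + int n}. gap t) = y (i + int n) - y i"
proof (induction n)
  case (Suc n)
  have "{i..<i + int (Suc n)} = insert (i + int n) {i..<i + int n}" by auto
  then show ?case using Suc by (simp add: gap_def algebra_simps)
qed simp

lemma late_self: "late j j"
  using m_pos by (auto simp: late_def)

lemma start_props: "j - int m + 1 \<le> start j" "start j \<le> j" "late (start j) j"
  "\<And>i. \<lbrakk>j - int m + 1 \<le> i; i < start j\<rbrakk> \<Longrightarrow> \<not> late i j"
proof -
  define B where "B = {i \<in> {j - int m + 1..j}. late i j}"
  have "finite B" unfolding B_def by (rule finite_subset[of _ "{j - int m + 1..j}"]) auto
  moreover have "j \<in> B" using late_self m_pos by (auto simp: B_def)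
  ultimately have B: "finite B" "j \<in> B" by auto
  then have "Min B \<in> B" by (intro Min_in) auto
  then show 1: "j - int m + 1 \<le> start j" "start j \<le> j" "late (start j) j"
    unfolding start_def B_def by auto
  show "\<not> late i j" if "j - int m + 1 \<le> i" "i < start j" for i
  proof
    assume "late i j"
    then have "i \<in> B" using that 1 by (auto simp: B_def)
    then have "start j \<le> i" unfolding start_def B_def[symmetric] using B by (intro Min_le) auto
    then show False using that by simp
  qed
qed

lemma late_mono:
  assumes "late i j" "i \<le> i'" "i' \<le> j"
  shows "late i' j"
proof -
  obtain t where "t \<in> {j..i + int m - 1}" "\<forall>s\<in>{i..<j}. capped s < capped t" using assms(1) by (auto simp: late_def)
  then show ?thesis using assms by (auto simp: late_def intro!: bexI[of _ t])
qed

text \<open>A gap whose capped length is strictly below another one has not reached the cap. Hence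
  the chosen window gets to \<open>y j\<close> without crossing a big gap, and \<open>Q j\<close>
  interpolates there.\<close>

lemma nobig_start: "nobig (start j) (nat (j - start j))"
  unfolding nobig_def
proof
  fix t assume t: "t \<in> {start j..<start j + int (nat (j - start j))}"
  then have "t \<in> {start j..<j}" using start_props(2)[of j] by auto
  moreover obtain u where "\<forall>s\<in>{start j..<j}. capped s < capped u"
    using start_props(3)[of j] unfolding late_def by blast
  ultimately have "capped t < capped u" by blast
  then show "\<not> big t" by (auto simp: capped_def big_def)
qed

lemma ord_props: "ord i \<le> m - 1" "nobig i (ord i)" "\<lbrakk>s \<le> m - 1; nobig i s\<rbrakk> \<Longrightarrow> s \<le> ord i"
proof -
  define B where "B = {s. s \<le> m - 1 \<and> nobig i s}"
  have B: "finite B" "0 \<in> B" by (auto simp: B_def nobig_def)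
  then have "Max B \<in> B" by (intro Max_in) auto
  then show "ord i \<le> m - 1" "nobig i (ord i)" by (auto simp: ord_def B_def)
  show "s \<le> ord i" if "s \<le> m - 1" "nobig i s"
    unfolding ord_def B_def[symmetric] using B that by (intro Max_ge) (auto simp: B_def)
qed

lemma nobig_mono: "nobig i s \<Longrightarrow> s' \<le> s \<Longrightarrow> nobig i s'"
  by (auto simp: nobig_def)

lemma le_ord_start: "nat (j - start j) \<le> ord (start j)"
  using start_props(1,2)[of j] m_pos by (intro ord_props(3) nobig_start) auto

lemma Q_interpolates: "poly (Q j) (y j) = v j"
  using poly_neville[OF y_mono le_ord_start[of j], of v "start j"] start_props(2)[of j]
  by (simp add: Q_def)

lemma degree_Q: "degree (Q j) < m"
  using degree_neville[of y v "ord (start j)" "start j"] ord_props(1)[of "start j"] m_pos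
  by (simp add: Q_def)

lemma window_length:
  assumes "nobig i s" "s \<le> m"
  shows "y (i + int s) - y i \<le> 2 * real s * c"
proof -
  have "y (i + int s) - y i = (\<Sum>t\<in>{i..<i + int s}. gap t)" by (simp add: sum_gap)
  also have "\<dots> \<le> (\<Sum>t\<in>{i..<i + int s}. 2 * c)"
    using assms(1) by (intro sum_mono) (auto simp: nobig_def big_def not_le less_imp_le)
  finally show ?thesis by simp
qed

lemma A_nonneg: "A j \<ge> 0"
  by (auto simp: A_def intro!: sum_nonneg)

text \<open>A start \<open>i\<close> that is dropped between \<open>j\<close> and
  \<open>j + 1\<close> has \<open>gap j\<close> as the first longest gap of its window, in capped
  length. If this gap is small the cap is not attained, so it is longest without the cap, and the
  window is at most \<open>m\<close> times as long.\<close>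

lemma transition_window:
  assumes small: "\<not> big j" and i: "start j \<le> i" "i < start (j + 1)"
  shows "nobig i m" "j - int m + 1 \<le> i" "i \<le> j" "y (i + int m) - y i \<le> real m * gap j"
proof -
  show ij: "j - int m + 1 \<le> i" "i \<le> j" using start_props(1,2)[of j] start_props(2)[of "j + 1"] i by auto
  have L: "late i j" using late_mono[OF start_props(3)[of j]] i ij by auto
  have NL: "\<not> late i (j + 1)"
  proof (cases "j + 1 - int m + 1 \<le> i")
    case True
    then show ?thesis using start_props(4)[of "j + 1" i] i by auto
  next
    \<comment> \<open>Here \<open>i + int m - 1 \<le> j\<close>, so the window has no gap after
      \<open>gap j\<close>.\<close>
    case False
    then show ?thesis by (auto simp: late_def)
  qed
  have "\<exists>t. t \<in> {j..i + int m - 1} \<and> (\<forall>s\<in>{j..i + int m - 1}. capped s \<le> capped t)"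
  proof -
    have fin: "finite (capped ` {j..i + int m - 1})" "capped ` {j..i + int m - 1} \<noteq> {}" using ij by auto
    then have "Max (capped ` {j..i + int m - 1}) \<in> capped ` {j..i + int m - 1}" by (rule Max_in)
    then obtain t where "t \<in> {j..i + int m - 1}" "capped t = Max (capped ` {j..i + int m - 1})" by auto
    then show ?thesis using fin by (intro exI[of _ t]) auto
  qed
  then obtain t where t: "t \<in> {j..i + int m - 1}" "\<And>s. s \<in> {j..i + int m - 1} \<Longrightarrow> capped s \<le> capped t"
    by blast
  have before: "capped s < capped t" if "s \<in> {i..<j}" for s
  proof -
    obtain t' where t': "t' \<in> {j..i + int m - 1}" "\<forall>s\<in>{i..<j}. capped s < capped t'" using L by (auto simp: late_def)
    then have "capped s < capped t'" using that by blast
    then show ?thesis using t(2)[OF t'(1)] by simp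
  qed
  have tj: "capped t \<le> capped j"
  proof (cases "t = j")
    case False
    then have "t \<in> {j + 1..i + int m - 1}" using t(1) by auto
    then obtain s where "s \<in> {i..<j + 1}" "capped t \<le> capped s" using NL by (force simp: late_def not_less)
    then show ?thesis using before[of s] by (cases "s = j") auto
  qed simp
  have max: "capped s \<le> capped j" if "s \<in> {i..<i + int m}" for s
    using that before[of s] t(2)[of s] tj by (cases "s < j") (auto intro: order_trans less_imp_le)
  \<comment> \<open>As the maximum lies below \<open>2 * c\<close>, capped lengths in this window
    are the lengths themselves.\<close>
  have cj: "capped j = gap j" "gap j < 2 * c" using small by (auto simp: capped_def big_def)
  have le: "gap s \<le> gap j" if "s \<in> {i..<i + int m}" for s
    using max[OF that] cj by (auto simp: capped_def min_def split: if_splits)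
  then show "nobig i m" using cj unfolding nobig_def big_def not_le by (meson le_less_trans)
  have "y (i + int m) - y i = (\<Sum>t\<in>{i..<i + int m}. gap t)" by (simp add: sum_gap)
  also have "\<dots> \<le> (\<Sum>t\<in>{i..<i + int m}. gap j)" by (intro sum_mono le)
  finally show "y (i + int m) - y i \<le> real m * gap j" by simp
qed

lemma start_mono: "start j \<le> start (j + 1)"
proof (rule ccontr)
  assume *: "\<not> start j \<le> start (j + 1)"
  define i where "i = start (j + 1)"
  have "late i (j + 1)" "j + 1 - int m + 1 \<le> i" "i \<le> j"
    using start_props[of "j + 1"] start_props(2)[of j] * by (auto simp: i_def)
  then obtain t where "t \<in> {j + 1..i + int m - 1}" "\<forall>s\<in>{i..<j + 1}. capped s < capped t" by (auto simp: late_def)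
  then have "late i j" using \<open>i \<le> j\<close> by (auto simp: late_def intro!: bexI[of _ t])
  then show False using start_props(4)[of j i] * \<open>j + 1 - int m + 1 \<le> i\<close> by (auto simp: i_def)
qed

text \<open>The windows that are dropped contain no big gap, so both polynomials have the full order
  \<open>m - 1\<close> and differ by a sum of shifts of the window by one point.\<close>

lemma Q_telescope:
  assumes small: "\<not> big j"
  shows "Q (j + 1) - Q j = (\<Sum>i\<in>{start j..<start (j + 1)}.
    smult ((y (i + int m) - y i) * dd y v m i) (\<Prod>l<m - 1. [:- y (i + 1 + int l), 1:]))"
proof (cases "start j = start (j + 1)")
  case True
  then show ?thesis by (simp add: Q_def)
next
  case False
  then have lt: "start j < start (j + 1)" using start_mono[of j] by simp
  have "nobig (start j) m" using transition_window(1)[OF small, of "start j"] lt by simp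
  then have o1: "ord (start j) = m - 1"
    using ord_props(1)[of "start j"] ord_props(3)[of "m - 1" "start j"] nobig_mono[of "start j" m "m - 1"] by auto
  have "nobig (start (j + 1) - 1) m" using transition_window(1)[OF small, of "start (j + 1) - 1"] lt by simp
  then have "nobig (start (j + 1)) (m - 1)" by (auto simp: nobig_def)
  then have o2: "ord (start (j + 1)) = m - 1"
    using ord_props(1)[of "start (j + 1)"] ord_props(3)[of "m - 1" "start (j + 1)"] by auto
  have tel: "(\<Sum>i\<in>{a..<a + int n}. neville y v (m - 1) (i + 1) - neville y v (m - 1) i)
      = neville y v (m - 1) (a + int n) - neville y v (m - 1) a" for a :: int and n :: nat
  proof (induction n)
    case (Suc n)
    have "{a..<a + int (Suc n)} = insert (a + int n) {a..<a + int n}" by auto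
    then show ?case using Suc by (simp add: algebra_simps)
  qed simp
  have "Q (j + 1) - Q j = (\<Sum>i\<in>{start j..<start (j + 1)}. neville y v (m - 1) (i + 1) - neville y v (m - 1) i)"
    using tel[where a="start j" and n="nat (start (j + 1) - start j)"] lt by (simp add: Q_def o1 o2)
  also have "\<dots> = (\<Sum>i\<in>{start j..<start (j + 1)}.
    smult ((y (i + int m) - y i) * dd y v m i) (\<Prod>l<m - 1. [:- y (i + 1 + int l), 1:]))"
    using m_pos neville_shift_diff[OF y_mono, of v "m - 1"] by (intro sum.cong) auto
  finally show ?thesis .
qed

section \<open>Derivatives of the pieces and their values at the knots\<close>

lemma step_props:
  "K \<ge> 1" "k \<le> m \<Longrightarrow> (S k has_real_derivative S (Suc k) t) (at t)"
  "\<lbrakk>k \<le> Suc m; t \<le> 0\<rbrakk> \<Longrightarrow> S k t = 0" "\<lbrakk>k \<le> Suc m; t \<ge> 1\<rbrakk> \<Longrightarrow> S k t = (if k = 0 then 1 else 0)"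
  "k \<le> Suc m \<Longrightarrow> \<bar>S k t\<bar> \<le> K"
  using step unfolding step_jet_def by (auto simp: less_Suc_eq_le)

lemma DERIV_q: "(q j k has_real_derivative q j (Suc k) x) (at x)"
  unfolding q_def by (rule DERIV_higher_pderiv)

lemma DERIV_scaled_step:
  assumes k: "k \<le> m" and w: "w > 0"
  shows "((\<lambda>x. S k ((x - a) / w) / w ^ k) has_real_derivative S (Suc k) ((x - a) / w) / w ^ Suc k) (at x)"
proof -
  have "((\<lambda>x. S k ((x - a) / w)) has_real_derivative S (Suc k) ((x - a) / w) * (1 / w)) (at x)"
    by (rule DERIV_chain'[OF _ step_props(2)[OF k]]) (use w in \<open>auto intro!: derivative_eq_intros\<close>)
  then have "((\<lambda>x. S k ((x - a) / w) / w ^ k) has_real_derivative S (Suc k) ((x - a) / w) * (1 / w) / w ^ k) (at x)"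
    by (rule DERIV_cdivide)
  then show ?thesis by simp
qed

lemma DERIV_off:
  assumes "k \<le> m"
  shows "(off j k has_real_derivative off j (Suc k) x) (at x)"
proof -
  have "((\<lambda>x. (if k = 0 then 1 else 0) - S k ((x - y j) / width j) / width j ^ k)
      has_real_derivative 0 - S (Suc k) ((x - y j) / width j) / width j ^ Suc k) (at x)"
    by (intro DERIV_diff DERIV_const DERIV_scaled_step assms width_pos)
  then show ?thesis by (simp add: off_def[abs_def])
qed

lemma DERIV_on:
  assumes "k \<le> m"
  shows "(on j k has_real_derivative on j (Suc k) x) (at x)"
  using DERIV_scaled_step[OF assms width_pos, of "y (j + 1) - width j" j x]
  by (simp add: on_def[abs_def] algebra_simps)

lemma DERIV_phi:
  assumes "k \<le> m"
  shows "(phi j k has_real_derivative phi j (Suc k) x) (at x)"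
  unfolding phi_def[abs_def]
  using assms by (intro DERIV_add DERIV_leib DERIV_q DERIV_off DERIV_on) auto

lemma on_zero: "\<lbrakk>k \<le> Suc m; x \<le> y (j + 1) - width j\<rbrakk> \<Longrightarrow> on j k x = 0"
  using width_pos[of j] by (simp add: on_def step_props(3) divide_nonpos_pos)

lemma off_zero: "\<lbrakk>k \<le> Suc m; x \<ge> y j + width j\<rbrakk> \<Longrightarrow> off j k x = 0"
  using width_pos[of j] by (auto simp: off_def step_props(4) le_divide_eq)

lemma phi_left: "k \<le> Suc m \<Longrightarrow> phi j k (y j) = q j k (y j)"
proof -
  assume k: "k \<le> Suc m"
  have "leib (q j) (off j) k (y j) = q j k (y j)"
    using k width_pos[of j] by (intro leib_unit) (auto simp: off_def step_props(3))
  moreover have "leib (q (j + 1)) (on j) k (y j) = 0"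
    using k width_le_gap[of j] by (intro leib_zero on_zero) (auto simp: gap_def)
  ultimately show ?thesis by (simp add: phi_def)
qed

lemma phi_right: "k \<le> Suc m \<Longrightarrow> phi j k (y (j + 1)) = q (j + 1) k (y (j + 1))"
proof -
  assume k: "k \<le> Suc m"
  have "leib (q (j + 1)) (on j) k (y (j + 1)) = q (j + 1) k (y (j + 1))"
    using k width_pos[of j] by (intro leib_unit) (auto simp: on_def step_props(4))
  moreover have "leib (q j) (off j) k (y (j + 1)) = 0"
    using k width_le_gap[of j] by (intro leib_zero off_zero) (auto simp: gap_def)
  ultimately show ?thesis by (simp add: phi_def)
qed

section \<open>Pointwise bounds on a single gap\<close>

definition C1 :: real where "C1 = 2 * (2 ^ m * (1 + K) * (2 * real m) ^ (2 * m))"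

definition C2 :: real where "C2 = 2 ^ m * (K * (2 * real m) ^ m)"

lemma one_le_power_2m: "1 \<le> (2 * real m) ^ k"
  by (rule one_le_power) (use m_pos in auto)

text \<open>A step of own length \<open>w\<close> is measured at the larger scale \<open>D\<close>,
  and \<open>B\<close> bounds their ratio. It is used with \<open>D\<close> the length of a window
  across a small gap, and with \<open>D = 1\<close> across a big one.\<close>

lemma scaled_step_le:
  assumes "k \<le> m" "w > 0" "D > 0" "w \<le> D" "D \<le> B * w" "B \<ge> 1"
  shows "\<bar>S k t / w ^ k\<bar> \<le> K * B ^ m / D ^ k"
proof -
  have "D ^ k \<le> (B * w) ^ k" using assms by (intro power_mono) auto
  also have "\<dots> \<le> B ^ m * w ^ k"
    using assms by (simp add: power_mult_distrib mult_right_mono power_increasing)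
  finally have "1 / w ^ k \<le> B ^ m / D ^ k" using assms by (simp add: field_simps)
  then have "\<bar>S k t\<bar> * (1 / w ^ k) \<le> K * (B ^ m / D ^ k)"
    using step_props(1) step_props(5)[of k t] assms by (intro mult_mono) auto
  then show ?thesis using assms by (simp add: abs_mult)
qed

text \<open>The interpolation window consists of at most \<open>m - 1\<close> small gaps and
  \<open>x\<close> exceeds \<open>y j\<close> by at most \<open>2 * c\<close>. All distances are
  thus at most \<open>2 * m * c = 1\<close>, and every factor in Newton's form is at most
  one.\<close>

lemma abs_q_le:
  assumes k: "k \<le> m" and x: "y j \<le> x" "x \<le> y j + 2 * c"
  shows "\<bar>q j k x\<bar> \<le> real m ^ m * A j"
proof -
  define a where "a = start j"
  define d where "d = nat (j - a)"
  have d: "a = j - int d" "d < m" "d \<le> ord a"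
    using start_props(1,2)[of j] le_ord_start[of j] by (auto simp: d_def a_def)
  have near: "\<bar>x - y (a + int l)\<bar> \<le> 1" if l: "l < s" "s \<le> ord a" for s l
  proof -
    have o: "ord a \<le> m - 1" "nobig a (ord a)" by (rule ord_props)+
    have "y (a + int (ord a)) - y a \<le> 2 * real (ord a) * c" using window_length[OF o(2)] o(1) by simp
    moreover have "real (ord a) * c \<le> real (m - 1) * c" using o(1) c_pos by (intro mult_right_mono) auto
    moreover have "2 * real (m - 1) * c + 2 * c = 1" using c_le m_pos by (simp add: of_nat_diff algebra_simps)
    moreover have "y a \<le> y (a + int l)" "y (a + int l) \<le> y (a + int (ord a))" "y a \<le> y j" "y j \<le> y (a + int (ord a))"
      using l d by (auto simp: strict_mono_less_eq[OF y_mono])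
    ultimately show ?thesis using x by (simp add: abs_le_iff)
  qed
  have term_le: "\<bar>poly ((pderiv ^^ k) (\<Prod>l<s. [:- y (a + int l), 1:])) x\<bar> \<le> real m ^ m" if "s \<le> ord a" for s
  proof -
    have "\<bar>poly ((pderiv ^^ k) (\<Prod>l<s. [:- y (a + int l), 1:])) x\<bar> \<le> real s ^ k * 1 ^ s / 1 ^ k"
      using near that by (intro abs_higher_pderiv_linear_prod_le) auto
    also have "\<dots> \<le> real m ^ k" using that ord_props(1)[of a] by (auto intro!: power_mono)
    also have "\<dots> \<le> real m ^ m" using k m_pos by (intro power_increasing) auto
    finally show ?thesis .
  qed
  have "q j k x = (\<Sum>s\<le>ord a. dd y v s a * poly ((pderiv ^^ k) (\<Prod>l<s. [:- y (a + int l), 1:])) x)"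
    unfolding q_def Q_def a_def[symmetric] poly_neville_newton_sum[OF y_mono, of v "ord a" a]
    by (simp add: higher_pderiv_sum higher_pderiv_smult poly_sum)
  also have "\<bar>\<dots>\<bar> \<le> (\<Sum>s\<le>ord a. \<bar>dd y v s a\<bar> * real m ^ m)"
    by (rule order_trans[OF sum_abs sum_mono]) (auto simp: abs_mult intro!: mult_left_mono term_le)
  also have "\<dots> = real m ^ m * (\<Sum>s\<le>ord a. \<bar>dd y v s a\<bar>)" by (simp add: sum_distrib_left mult.commute)
  also have "(\<Sum>s\<le>ord a. \<bar>dd y v s a\<bar>) \<le> A j"
  proof -
    have "(\<Sum>s\<le>ord a. \<bar>dd y v s a\<bar>) = (\<Sum>s\<le>ord a. if nobig a s then \<bar>dd y v s a\<bar> else 0)"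
      using nobig_mono[OF ord_props(2)[of a]] by (intro sum.cong) auto
    also have "\<dots> \<le> (\<Sum>s\<le>m. if nobig a s then \<bar>dd y v s a\<bar> else 0)"
      using ord_props(1)[of a] by (intro sum_mono2) auto
    also have "\<dots> \<le> A j"
      unfolding A_def d(1) using d(2)
      by (intro member_le_sum[of d "{..<m}" "\<lambda>d. \<Sum>s\<le>m. if nobig (j - int d) s then \<bar>dd y v s (j - int d)\<bar> else 0"])
        (auto intro!: sum_nonneg)
    finally show ?thesis .
  qed
  finally show ?thesis by (simp add: mult_left_mono)
qed

lemma C1_nonneg: "C1 \<ge> 0" and C2_nonneg: "C2 \<ge> 0"
  using step_props(1) by (simp_all add: C1_def C2_def)

text \<open>The leading factor two in \<open>C1\<close> leaves one half for \<open>q j\<close> and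
  one half for the change of the polynomial.\<close>

lemma const_le:
  assumes "k \<le> m"
  shows "2 ^ k * (real m ^ m * ((1 + K) * (2 * real m) ^ m)) \<le> C1 / 2" "real m ^ m \<le> C1 / 2"
    "2 ^ k * (real m ^ m * (K * real m ^ m)) \<le> C1 / 2"
proof -
  have K: "K \<ge> 1" by (rule step_props)
  have mm: "real m ^ m \<le> (2 * real m) ^ m" "1 \<le> (2 * real m) ^ m"
    by (rule power_mono; simp) (rule one_le_power_2m)
  have C1: "C1 / 2 = 2 ^ m * ((2 * real m) ^ m * ((1 + K) * (2 * real m) ^ m))"
  proof -
    have "(2 * real m) ^ (2 * m) = (2 * real m) ^ m * (2 * real m) ^ m" by (simp only: mult_2 power_add)
    then show ?thesis unfolding C1_def by (simp only: mult_ac)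
  qed
  have k2: "(2::real) ^ k \<le> 2 ^ m" using assms by (intro power_increasing) auto
  show "2 ^ k * (real m ^ m * ((1 + K) * (2 * real m) ^ m)) \<le> C1 / 2"
    unfolding C1 using K mm k2 by (intro mult_mono) auto
  show "2 ^ k * (real m ^ m * (K * real m ^ m)) \<le> C1 / 2"
    unfolding C1 using K mm k2 by (intro mult_mono) auto
  have "1 * (real m ^ m * (1 * 1)) \<le> C1 / 2"
    unfolding C1 using K mm by (intro mult_mono) auto
  then show "real m ^ m \<le> C1 / 2" by simp
qed

text \<open>On a small gap switching off is one minus switching on, so \<open>phi j\<close> is
  \<open>q j\<close> plus the step times \<open>Q (j + 1) - Q j\<close>. Each summand of this
  difference is handled at the scale \<open>L\<close> of its window, which is comparable to the
  gap.\<close>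

lemma abs_phi_small_le:
  assumes small: "\<not> big j" and k: "k \<le> m" and x: "y j \<le> x" "x \<le> y (j + 1)"
  shows "\<bar>phi j k x\<bar> \<le> C1 * A j"
proof -
  have w: "width j = gap j" "gap j < 2 * c" using small by (auto simp: width_def big_def)
  have off: "off j r x = (if r = 0 then 1 else 0) - on j r x" for r
    by (simp add: off_def on_def w gap_def)
  define W where "W i = (\<Prod>l<m - 1. [:- y (i + 1 + int l), 1:])" for i
  define wt where "wt i = (y (i + int m) - y i) * dd y v m i" for i
  define I where "I = {start j..<start (j + 1)}"
  have qd: "q (j + 1) r x - q j r x = (\<Sum>i\<in>I. wt i * poly ((pderiv ^^ r) (W i)) x)" for r
  proof -
    have "q (j + 1) r x - q j r x = poly ((pderiv ^^ r) (Q (j + 1) - Q j)) x"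
      unfolding q_def by (metis higher_pderiv_add add_diff_cancel_right' diff_add_cancel poly_diff)
    then show ?thesis unfolding Q_telescope[OF small]
      by (simp add: I_def wt_def W_def higher_pderiv_sum higher_pderiv_smult poly_sum)
  qed
  have "leib (q (j + 1)) (on j) k x - leib (q j) (on j) k x
      = (\<Sum>r\<le>k. real (k choose r) * (\<Sum>i\<in>I. wt i * poly ((pderiv ^^ r) (W i)) x) * on j (k - r) x)"
    unfolding leib_def qd[symmetric] by (simp add: sum_subtractf[symmetric] algebra_simps)
  also have "\<dots> = (\<Sum>i\<in>I. leib (\<lambda>r x. wt i * poly ((pderiv ^^ r) (W i)) x) (on j) k x)"
    unfolding leib_def sum_distrib_left sum_distrib_right by (subst sum.swap) (simp add: mult_ac)
  finally have diff: "leib (q (j + 1)) (on j) k x - leib (q j) (on j) k x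
      = (\<Sum>i\<in>I. leib (\<lambda>r x. wt i * poly ((pderiv ^^ r) (W i)) x) (on j) k x)" .
  have "leib (q j) (off j) k x = q j k x - leib (q j) (on j) k x"
  proof -
    have "leib (q j) (off j) k x = leib (q j) (\<lambda>r x. if r = 0 then 1 else 0) k x - leib (q j) (on j) k x"
      unfolding leib_def off by (simp add: sum_subtractf[symmetric] algebra_simps)
    then show ?thesis by (simp add: leib_unit)
  qed
  then have phi: "phi j k x = q j k x + (\<Sum>i\<in>I. leib (\<lambda>r x. wt i * poly ((pderiv ^^ r) (W i)) x) (on j) k x)"
    unfolding phi_def using diff by simp
  have term_le: "\<bar>leib (\<lambda>r x. wt i * poly ((pderiv ^^ r) (W i)) x) (on j) k x\<bar> \<le> C1 / 2 * \<bar>dd y v m i\<bar>"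
    if i: "i \<in> I" for i
  proof -
    define L where "L = y (i + int m) - y i"
    note tw = transition_window[OF small, of i]
    have i': "start j \<le> i" "i < start (j + 1)" using i by (auto simp: I_def)
    have L: "L > 0" "L \<le> 1" "L \<le> real m * gap j" "gap j \<le> L"
    proof -
      show "L > 0" using strict_monoD[OF y_mono, of i "i + int m"] m_pos by (simp add: L_def)
      show "L \<le> 1" using window_length[OF tw(1)[OF i']] c_le by (simp add: L_def)
      show "L \<le> real m * gap j" using tw(4)[OF i'] by (simp add: L_def)
      have "y i \<le> y j" "y (j + 1) \<le> y (i + int m)"
        using tw(2,3)[OF i'] by (auto simp: strict_mono_less_eq[OF y_mono])
      then show "gap j \<le> L" by (simp add: L_def gap_def)
    qed
    have W: "\<bar>wt i * poly ((pderiv ^^ r) (W i)) x\<bar> \<le> (L * \<bar>dd y v m i\<bar> * (real m ^ m * L ^ (m - 1))) / L ^ r" if r: "r \<le> k" for r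
    proof -
      have "\<bar>poly ((pderiv ^^ r) (W i)) x\<bar> \<le> real (m - 1) ^ r * L ^ (m - 1) / L ^ r"
        unfolding W_def
      proof (rule abs_higher_pderiv_linear_prod_le)
        fix l assume "l < m - 1"
        then have "y i \<le> y (i + 1 + int l)" "y (i + 1 + int l) \<le> y (i + int m)" "y i \<le> y j" "y (j + 1) \<le> y (i + int m)"
          using tw(2,3)[OF i'] by (auto simp: strict_mono_less_eq[OF y_mono])
        then show "\<bar>x - y (i + 1 + int l)\<bar> \<le> L" using x by (simp add: L_def abs_le_iff)
      qed (rule L)
      also have "\<dots> \<le> real m ^ m * L ^ (m - 1) / L ^ r"
      proof -
        have "real (m - 1) ^ r \<le> real m ^ r" by (intro power_mono) auto
        also have "\<dots> \<le> real m ^ m" using r k m_pos by (intro power_increasing) auto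
        finally show ?thesis using L by (intro divide_right_mono mult_right_mono) auto
      qed
      finally have "\<bar>wt i\<bar> * \<bar>poly ((pderiv ^^ r) (W i)) x\<bar> \<le> \<bar>wt i\<bar> * (real m ^ m * L ^ (m - 1) / L ^ r)"
        by (intro mult_left_mono) auto
      moreover have "\<bar>wt i\<bar> = L * \<bar>dd y v m i\<bar>" using L by (simp add: wt_def L_def abs_mult)
      ultimately show ?thesis by (simp add: abs_mult)
    qed
    have on_le: "\<bar>on j r x\<bar> \<le> (K * real m ^ m) / L ^ r" if "r \<le> k" for r
      unfolding on_def w using that k L gap_pos[of j] m_pos by (intro scaled_step_le) auto
    have "\<bar>leib (\<lambda>r x. wt i * poly ((pderiv ^^ r) (W i)) x) (on j) k x\<bar>
      \<le> 2 ^ k * ((L * \<bar>dd y v m i\<bar> * (real m ^ m * L ^ (m - 1))) * (K * real m ^ m)) / L ^ k"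
      using W on_le L by (intro abs_leib_le) auto
    \<comment> \<open>The factor \<open>L\<close> of the jump and \<open>L ^ (m - 1)\<close> of the
      product make up \<open>L ^ m\<close>, which pays for the \<open>k\<close> derivatives because
      \<open>L \<le> 1\<close>.\<close>
    also have "\<dots> = 2 ^ k * (real m ^ m * (K * real m ^ m)) * (L ^ m / L ^ k) * \<bar>dd y v m i\<bar>"
      using m_pos by (simp add: power_eq_if mult_ac)
    also have "\<dots> \<le> C1 / 2 * 1 * \<bar>dd y v m i\<bar>"
    proof -
      have "L ^ m \<le> L ^ k" using L k by (intro power_decreasing) auto
      then have "L ^ m / L ^ k \<le> 1" using L by simp
      then show ?thesis using const_le(3)[OF k] L C1_nonneg
        by (intro mult_right_mono mult_mono) auto
    qed
    finally show ?thesis by simp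
  qed
  have dd_le: "(\<Sum>i\<in>I. \<bar>dd y v m i\<bar>) \<le> A j"
  proof -
    have "(\<Sum>i\<in>I. \<bar>dd y v m i\<bar>) = (\<Sum>i\<in>I. if nobig i m then \<bar>dd y v m i\<bar> else 0)"
      using transition_window(1)[OF small] by (intro sum.cong) (auto simp: I_def)
    also have "\<dots> \<le> (\<Sum>i\<in>I. \<Sum>s\<le>m. if nobig i s then \<bar>dd y v s i\<bar> else 0)"
      by (intro sum_mono member_le_sum[of m "{..m}" "\<lambda>s. if nobig _ s then \<bar>dd y v s _\<bar> else 0"]) auto
    also have "\<dots> \<le> (\<Sum>i\<in>(\<lambda>d. j - int d) ` {..<m}. \<Sum>s\<le>m. if nobig i s then \<bar>dd y v s i\<bar> else 0)"
    proof (intro sum_mono2)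
      show "I \<subseteq> (\<lambda>d. j - int d) ` {..<m}"
      proof
        fix i assume "i \<in> I"
        then have "j - int m + 1 \<le> i" "i \<le> j" using transition_window(2,3)[OF small, of i] by (auto simp: I_def)
        then show "i \<in> (\<lambda>d. j - int d) ` {..<m}" by (intro image_eqI[of _ _ "nat (j - i)"]) auto
      qed
    qed (auto intro!: sum_nonneg)
    also have "\<dots> = A j" unfolding A_def by (subst sum.reindex) (auto simp: inj_on_def)
    finally show ?thesis .
  qed
  have "\<bar>phi j k x\<bar> \<le> \<bar>q j k x\<bar> + (\<Sum>i\<in>I. \<bar>leib (\<lambda>r x. wt i * poly ((pderiv ^^ r) (W i)) x) (on j) k x\<bar>)"
    unfolding phi by (rule order_trans[OF abs_triangle_ineq]) (simp add: sum_abs)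
  also have "\<dots> \<le> real m ^ m * A j + (\<Sum>i\<in>I. C1 / 2 * \<bar>dd y v m i\<bar>)"
    using w x by (intro add_mono abs_q_le k sum_mono term_le) (auto simp: gap_def)
  also have "\<dots> \<le> C1 / 2 * A j + C1 / 2 * A j"
    unfolding sum_distrib_left[symmetric]
    using const_le(2)[OF k] dd_le A_nonneg[of j] C1_nonneg
    by (intro add_mono mult_right_mono mult_left_mono) auto
  finally show ?thesis by simp
qed

text \<open>Away from the right end of a big gap only \<open>Q j\<close> is felt, and it is switched
  off after a length \<open>c\<close>; from there on the piece is zero.\<close>

lemma abs_phi_big_left_le:
  assumes big: "big j" and k: "k \<le> m" and x: "y j \<le> x" "x \<le> y (j + 1) - c"
  shows "\<bar>phi j k x\<bar> \<le> C1 * A j * indicator {y j..y j + c} x"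
proof -
  have w: "width j = c" using big by (simp add: width_def)
  have on: "leib (q (j + 1)) (on j) k x = 0" using k x w by (intro leib_zero on_zero) auto
  show ?thesis
  proof (cases "x \<le> y j + c")
    case True
    have "\<bar>leib (q j) (off j) k x\<bar> \<le> 2 ^ k * ((real m ^ m * A j) * ((1 + K) * (2 * real m) ^ m)) / 1 ^ k"
    proof (rule abs_leib_le)
      show "\<bar>q j r x\<bar> \<le> real m ^ m * A j / 1 ^ r" if "r \<le> k" for r
        using abs_q_le[of r j x] that k x True c_pos by simp
      show "\<bar>off j r x\<bar> \<le> (1 + K) * (2 * real m) ^ m / 1 ^ r" if "r \<le> k" for r
      proof -
        have "\<bar>S r ((x - y j) / c) / c ^ r\<bar> \<le> K * (2 * real m) ^ m / 1 ^ r"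
          using that k c_pos c_le c_le_half m_pos by (intro scaled_step_le) auto
        moreover have "1 \<le> (2 * real m) ^ m" by (rule one_le_power_2m)
        moreover have "\<bar>off j r x\<bar> \<le> 1 + \<bar>S r ((x - y j) / c) / c ^ r\<bar>" unfolding off_def w by auto
        ultimately show ?thesis by (simp add: algebra_simps)
      qed
    qed (auto simp: A_nonneg)
    also have "\<dots> = 2 ^ k * (real m ^ m * ((1 + K) * (2 * real m) ^ m)) * A j" by simp
    also have "\<dots> \<le> C1 / 2 * A j" by (intro mult_right_mono const_le k A_nonneg)
    also have "\<dots> \<le> C1 * A j"
      using C1_nonneg A_nonneg[of j] by (intro mult_right_mono) auto
    finally show ?thesis using True x on by (simp add: phi_def)
  next
    case False
    then have "leib (q j) (off j) k x = 0" using k x w by (intro leib_zero off_zero) auto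
    then show ?thesis using on False by (simp add: phi_def)
  qed
qed

text \<open>Windows starting at \<open>y (j + 1)\<close> may be much shorter than \<open>c\<close>,
  so their weights cannot pay for a strip of length \<open>c\<close> in front of them. Hence the
  bound is in terms of the jet at \<open>y (j + 1)\<close> and not of
  \<open>A (j + 1)\<close>.\<close>

lemma abs_phi_big_right_le:
  assumes big: "big j" and k: "k \<le> m" and x: "y (j + 1) - c \<le> x" "x \<le> y (j + 1)"
  shows "\<bar>phi j k x\<bar> \<le> C2 * (\<Sum>r<m. \<bar>q (j + 1) r (y (j + 1))\<bar>)"
proof -
  have w: "width j = c" using big by (simp add: width_def)
  have off: "leib (q j) (off j) k x = 0"
    using k x w big c_pos by (intro leib_zero off_zero) (auto simp: big_def gap_def)
  define T where "T = (\<Sum>r<m. \<bar>q (j + 1) r (y (j + 1))\<bar>)"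
  have T: "T \<ge> 0" by (simp add: T_def sum_nonneg)
  have "\<bar>leib (q (j + 1)) (on j) k x\<bar> \<le> 2 ^ k * (T * (K * (2 * real m) ^ m)) / 1 ^ k"
  proof (rule abs_leib_le)
    show "\<bar>q (j + 1) r x\<bar> \<le> T / 1 ^ r" for r
      using abs_higher_pderiv_taylor_le[OF degree_Q[of "j + 1"], of x "y (j + 1)" r] x c_le_half c_pos
      by (simp add: q_def T_def abs_le_iff)
    show "\<bar>on j r x\<bar> \<le> K * (2 * real m) ^ m / 1 ^ r" if "r \<le> k" for r
      unfolding on_def w using that k c_pos c_le c_le_half m_pos by (intro scaled_step_le) auto
  qed (auto simp: T)
  also have "\<dots> \<le> C2 * T"
  proof -
    have "(2::real) ^ k \<le> 2 ^ m" using k by (intro power_increasing) auto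
    then have "2 ^ k * (T * (K * (2 * real m) ^ m)) \<le> 2 ^ m * (T * (K * (2 * real m) ^ m))"
      using T step_props(1) by (intro mult_right_mono) auto
    then show ?thesis by (simp add: C2_def mult_ac)
  qed
  finally show ?thesis using off by (simp add: phi_def T_def)
qed

end

section \<open>The norm of the spline\<close>

text \<open>Each term is at most the largest one. The factor is written as a power \<open>p\<close>,
  so that it becomes \<open>card I\<close> after taking roots, whatever \<open>p\<close> is.\<close>

lemma powr_sum_le:
  fixes a :: "'i \<Rightarrow> real"
  assumes "finite I" "\<And>i. i \<in> I \<Longrightarrow> 0 \<le> a i" "p > 0"
  shows "(\<Sum>i\<in>I. a i) powr p \<le> real (card I) powr p * (\<Sum>i\<in>I. a i powr p)"
proof (cases "I = {}")
  case False
  define M where "M = Max (a ` I)"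
  have "M \<in> a ` I" unfolding M_def using assms(1) False by (intro Max_in) auto
  then obtain i where i: "i \<in> I" "a i = M" by auto
  have "a i \<le> M" if "i \<in> I" for i unfolding M_def using assms(1) that by (intro Max_ge) auto
  then have "(\<Sum>i\<in>I. a i) \<le> real (card I) * M" by (intro sum_bounded_above) auto
  then have "(\<Sum>i\<in>I. a i) powr p \<le> (real (card I) * M) powr p"
    using assms by (intro powr_mono2) (auto intro: sum_nonneg)
  also have "\<dots> = real (card I) powr p * M powr p" using assms(2)[OF i(1)] i by (simp add: powr_mult)
  also have "M powr p \<le> (\<Sum>i\<in>I. a i powr p)"
    unfolding i(2)[symmetric] using assms i by (intro member_le_sum) auto
  finally show ?thesis by (simp add: mult_left_mono)
qed simp

text \<open>Sums over the integers are integrals against \<open>count_space UNIV\<close> throughout,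
  so that they can be interchanged with Lebesgue integrals; the enumeration reduces measurability to
  that of series.\<close>

lemma nn_integral_count_space_int_suminf:
  fixes f :: "int \<Rightarrow> ennreal"
  shows "(\<integral>\<^sup>+j. f j \<partial>count_space UNIV) = (\<Sum>n. f (int_decode n))"
  using nn_integral_bij_count_space[OF bij_int_decode, of f] by (simp add: nn_integral_count_space_nat)

lemma borel_measurable_nn_integral_count_space_int [measurable (raw)]:
  fixes f :: "int \<Rightarrow> 'a \<Rightarrow> ennreal"
  assumes [measurable]: "\<And>j. f j \<in> borel_measurable M"
  shows "(\<lambda>x. \<integral>\<^sup>+j. f j x \<partial>count_space UNIV) \<in> borel_measurable M"
  unfolding nn_integral_count_space_int_suminf by measurable

lemma nn_integral_count_space_int_shift:
  fixes f :: "int \<Rightarrow> ennreal"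
  shows "(\<integral>\<^sup>+j. f (j - d) \<partial>count_space UNIV) = (\<integral>\<^sup>+j. f j \<partial>count_space UNIV)"
proof (rule nn_integral_bij_count_space)
  show "bij (\<lambda>j. j - d)" by (rule bij_betwI[of _ _ _ "\<lambda>j. j + d"]) auto
qed

lemma nn_integral_count_space_int_le_infsum:
  fixes f :: "int \<Rightarrow> ennreal"
  assumes "\<And>j. j \<notin> A \<Longrightarrow> f j = 0"
  shows "(\<integral>\<^sup>+j. f j \<partial>count_space UNIV) \<le> (\<Sum>\<^sub>\<infinity>j\<in>A. f j)"
proof -
  have "(\<Sum>n<N. f (int_decode n)) \<le> (\<Sum>\<^sub>\<infinity>j\<in>A. f j)" for N
  proof -
    have "(\<Sum>n<N. f (int_decode n)) = sum f (int_decode ` {..<N})"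
      using bij_int_decode by (subst sum.reindex) (auto intro: inj_on_subset[of int_decode UNIV] simp: bij_def)
    also have "\<dots> = sum f (int_decode ` {..<N} \<inter> A)"
      using assms by (intro sum.mono_neutral_right) auto
    also have "\<dots> \<le> (\<Sum>\<^sub>\<infinity>j\<in>A. f j)"
      by (subst nonneg_infsum_complete) (auto intro!: SUP_upper)
    finally show ?thesis .
  qed
  then show ?thesis
    unfolding nn_integral_count_space_int_suminf suminf_eq_SUP by (intro SUP_least)
qed

lemma nn_integral_count_space_le_one:
  assumes "\<And>i j. \<lbrakk>P i; P j\<rbrakk> \<Longrightarrow> i = j"
  shows "(\<integral>\<^sup>+j. (if P j then 1 else 0) \<partial>count_space UNIV) \<le> (1::ennreal)"
proof (cases "\<exists>j. P j")
  case True
  then obtain j where "P j" by blast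
  then have "(\<lambda>i. if P i then 1 else 0 :: ennreal) = indicator {j}"
    using assms by (auto simp: fun_eq_iff indicator_def)
  then show ?thesis by simp
qed simp

context sobolev_spline
begin

section \<open>Gluing the pieces\<close>

definition U :: "real set" where "U = {x. \<exists>j. y j \<le> x \<and> x < y (j + 1)}"

definition idx :: "real \<Rightarrow> int" where "idx x = (THE j. y j \<le> x \<and> x < y (j + 1))"

definition G :: "nat \<Rightarrow> real \<Rightarrow> real" where "G k x = (if x \<in> U then phi (idx x) k x else 0)"

lemma idx_eq: "\<lbrakk>y j \<le> x; x < y (j + 1)\<rbrakk> \<Longrightarrow> idx x = j"
  unfolding idx_def
proof (rule the_equality)
  fix i assume x: "y j \<le> x" "x < y (j + 1)" and i: "y i \<le> x \<and> x < y (i + 1)"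
  then have "y j < y (i + 1)" "y i < y (j + 1)" by auto
  then show "i = j" by (simp add: strict_mono_less[OF y_mono])
qed auto

lemma G_eq_phi: "\<lbrakk>y j \<le> x; x < y (j + 1)\<rbrakk> \<Longrightarrow> G k x = phi j k x"
  using idx_eq[of j x] by (auto simp: G_def U_def)

lemma U_iff: "x \<in> U \<longleftrightarrow> (\<exists>i j. y i \<le> x \<and> x < y j)"
proof
  assume "\<exists>i j. y i \<le> x \<and> x < y j"
  then obtain i j where ij: "y i \<le> x" "x < y j" by blast
  define B where "B = {t \<in> {i..j}. y t \<le> x}"
  have "y i < y j" using ij by simp
  then have "i < j" by (simp add: strict_mono_less[OF y_mono])
  have "finite B" unfolding B_def by (rule finite_subset[of _ "{i..j}"]) auto
  moreover have "i \<in> B" using ij \<open>i < j\<close> by (auto simp: B_def)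
  ultimately have t: "Max B \<in> B" "\<And>s. s \<in> B \<Longrightarrow> s \<le> Max B" by (auto intro: Max_in)
  have "Max B < j" using t(1) ij by (cases "Max B = j") (auto simp: B_def)
  have "x < y (Max B + 1)"
  proof (rule ccontr)
    assume "\<not> x < y (Max B + 1)"
    then have "Max B + 1 \<in> B" using t(1) \<open>Max B < j\<close> by (auto simp: B_def)
    then show False using t(2) by fastforce
  qed
  then show "x \<in> U" using t(1) by (auto simp: U_def B_def)
qed (auto simp: U_def)

lemma U_convex: "\<lbrakk>a \<in> U; b \<in> U; a \<le> x; x \<le> b\<rbrakk> \<Longrightarrow> x \<in> U"
  unfolding U_iff by (meson le_less_trans order_trans)

lemma y_in_U: "y j \<in> U"
  using gap_pos[of j] by (auto simp: U_def gap_def)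

text \<open>There is neither a first nor a last knot, so every knot is interior. Thus
  \<open>U\<close> is the open interval between the infimum and the supremum of the knots.\<close>

lemma open_U: "open U"
proof -
  have "U = (\<Union>j. {y (j - 1)<..<y (j + 1)})"
  proof safe
    fix x assume "x \<in> U"
    then obtain j where "y j \<le> x" "x < y (j + 1)" by (auto simp: U_def)
    moreover have "y (j - 1) < y j" using strict_monoD[OF y_mono, of "j - 1" j] by simp
    ultimately show "x \<in> (\<Union>j. {y (j - 1)<..<y (j + 1)})" by force
  next
    fix x j assume "x \<in> {y (j - 1)<..<y (j + 1)}"
    then show "x \<in> U" unfolding U_iff by (intro exI[of _ "j - 1"] exI[of _ "j + 1"]) auto
  qed
  then show ?thesis by (simp add: open_UN)
qed

lemma G_knot: "k \<le> Suc m \<Longrightarrow> G k (y j) = q j k (y j)"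
  using G_eq_phi[of j "y j" k] gap_pos[of j] phi_left[of k j] by (simp add: gap_def)

lemma G_interpolates: "G 0 (y j) = v j"
  using G_knot[of 0 j] Q_interpolates[of j] by (simp add: q_def)

lemma G_eq_phi_closed: "\<lbrakk>k \<le> Suc m; y j \<le> x; x \<le> y (j + 1)\<rbrakk> \<Longrightarrow> G k x = phi j k x"
  using G_eq_phi[of j x k] G_knot[of k "j + 1"] phi_right[of k j] by (cases "x = y (j + 1)") auto

text \<open>At the knot \<open>y j\<close> both neighbouring pieces have the jet of
  \<open>Q j\<close>, up to order \<open>Suc m\<close>, so their derivatives agree.\<close>

lemma DERIV_G:
  assumes k: "k \<le> m" and x: "x \<in> U"
  shows "(G k has_real_derivative G (Suc k) x) (at x)"
proof -
  obtain j where j: "y j \<le> x" "x < y (j + 1)" using x by (auto simp: U_def)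
  show ?thesis
  proof (cases "x = y j")
    case False
    have "(G k has_real_derivative phi j (Suc k) x) (at x)"
      by (rule has_field_derivative_transform_within_open[OF DERIV_phi[OF k], of "{y j<..<y (j + 1)}"])
        (use False j in \<open>auto intro!: G_eq_phi[symmetric]\<close>)
    then show ?thesis using j by (simp add: G_eq_phi)
  next
    case True
    have jj: "j - 1 + 1 = j" by simp
    have pos: "min (gap (j - 1)) (gap j) > 0" using gap_pos by simp
    have d1: "(phi (j - 1) k has_real_derivative G (Suc k) (y j)) (at (y j))"
      using DERIV_phi[OF k, of "j - 1" "y j"] phi_right[of "Suc k" "j - 1"] G_knot[of "Suc k" j] k by simp
    have d2: "(phi j k has_real_derivative G (Suc k) (y j)) (at (y j))"
      using DERIV_phi[OF k, of j "y j"] phi_left[of "Suc k" j] G_knot[of "Suc k" j] k by simp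
    show ?thesis unfolding True
      by (rule DERIV_glue[OF d1 d2 pos])
        (use k in \<open>auto simp: gap_def intro!: G_eq_phi_closed[of _ "j - 1", unfolded jj] G_eq_phi_closed\<close>)
  qed
qed

lemma measurable_G: "k \<le> m \<Longrightarrow> G k \<in> borel_measurable borel"
proof -
  assume k: "k \<le> m"
  have "continuous_on U (G k)"
    using DERIV_G[OF k] by (intro continuous_at_imp_continuous_on ballI) (auto intro: DERIV_isCont)
  then have "(\<lambda>x. indicator U x *\<^sub>R G k x) \<in> borel_measurable borel"
    using open_U by (intro borel_measurable_continuous_on_indicator) auto
  moreover have "(\<lambda>x. indicator U x *\<^sub>R G k x) = G k" by (auto simp: fun_eq_iff G_def indicator_def)
  ultimately show ?thesis by simp
qed

lemma measurable_G_lebesgue: "k \<le> m \<Longrightarrow> G k \<in> borel_measurable lebesgue"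
  by (intro measurable_completion) (simp add: measurable_G)

lemma G_increment:
  assumes k: "k < m" and ab: "a \<in> U" "b \<in> U" "a \<le> b"
  shows "ennreal \<bar>G k b - G k a\<bar> \<le> (\<integral>\<^sup>+t\<in>{a..b}. ennreal \<bar>G (Suc k) t\<bar> \<partial>lebesgue)"
proof (rule has_integral_abs_le_nn_integral)
  show "(G (Suc k) has_integral G k b - G k a) {a..b}"
  proof (rule fundamental_theorem_of_calculus[OF ab(3)])
    fix x assume "x \<in> {a..b}"
    then have "x \<in> U" using U_convex[OF ab(1,2)] by auto
    then show "(G k has_vector_derivative G (Suc k) x) (at x within {a..b})"
      using DERIV_G[of k x] k by (simp add: has_real_derivative_iff_has_vector_derivative has_vector_derivative_at_within)
  qed
qed (use k in \<open>auto intro: measurable_G_lebesgue\<close>)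

section \<open>Charging the spline to the divided differences\<close>

definition weight :: "int \<Rightarrow> real" where "weight i = min 1 (y (i + int m) - y i)"

text \<open>The part of the functional that the spline uses. For a prolonged sequence, leaving out
  the windows across big gaps removes every window of positive order that touches a new
  point.\<close>

definition energy :: "real \<Rightarrow> ennreal" where
  "energy p = (\<Sum>s\<le>m. \<integral>\<^sup>+i. (if nobig i s then ennreal (weight i * \<bar>dd y v s i\<bar> powr p) else 0) \<partial>count_space UNIV)"

text \<open>A majorant away from the strips in front of clusters; as a sum of multiples of
  indicators it has an explicit integral.\<close>

definition D1 :: "real \<Rightarrow> real \<Rightarrow> ennreal" where
  "D1 p x = (\<integral>\<^sup>+j. ennreal ((C1 * A j) powr p) * indicator {y j..y j + width j} x \<partial>count_space UNIV)"

text \<open>The bad points lie in the last piece of length \<open>c\<close> of a big gap, where the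
  spline is governed by the cluster to the right.\<close>

definition good :: "real \<Rightarrow> bool" where
  "good x \<longleftrightarrow> x \<in> U \<and> (\<forall>j. big j \<longrightarrow> \<not> (y (j + 1) - c \<le> x \<and> x < y (j + 1)))"

lemma powr_G_le_good:
  assumes x: "good x" and k: "k \<le> m" and p: "p > 0"
  shows "ennreal (\<bar>G k x\<bar> powr p) \<le> D1 p x"
proof -
  obtain j where j: "y j \<le> x" "x < y (j + 1)" using x by (auto simp: good_def U_def)
  have "\<bar>G k x\<bar> \<le> C1 * A j * indicator {y j..y j + width j} x"
  proof (cases "big j")
    case True
    then have "x \<le> y (j + 1) - c" using x j by (auto simp: good_def)
    then show ?thesis using abs_phi_big_left_le[OF True k j(1)] G_eq_phi[OF j] True by (simp add: width_def)
  next
    case False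
    then show ?thesis using abs_phi_small_le[OF False k, of x] G_eq_phi[OF j] j by (simp add: width_def gap_def)
  qed
  then have "\<bar>G k x\<bar> powr p \<le> (C1 * A j * indicator {y j..y j + width j} x) powr p"
    using p by (intro powr_mono2) auto
  also have "\<dots> = (C1 * A j) powr p * indicator {y j..y j + width j} x"
    by (auto simp: indicator_def)
  finally have "ennreal (\<bar>G k x\<bar> powr p) \<le> ennreal ((C1 * A j) powr p) * indicator {y j..y j + width j} x"
    by (auto simp: indicator_def ennreal_leI)
  also have "\<dots> \<le> D1 p x" unfolding D1_def
    by (rule nn_integral_ge_point[of j UNIV "\<lambda>j. ennreal ((C1 * A j) powr p) * indicator {y j..y j + width j} x"]) simp
  finally show ?thesis .
qed

lemma measurable_D1 [measurable]: "D1 p \<in> borel_measurable lebesgue"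
proof -
  have [measurable]: "{a..b} \<in> sets lebesgue" for a b :: real by simp
  show ?thesis unfolding D1_def[abs_def] by measurable
qed

text \<open>The window of \<open>m\<close> steps from \<open>j - int d\<close> contains the gap
  after \<open>y j\<close>. This is how the weights pay for the piece on which \<open>A j\<close> is
  charged.\<close>

lemma width_le_weight: "d < m \<Longrightarrow> width j \<le> weight (j - int d)"
proof -
  assume d: "d < m"
  have "width j \<le> 1" using c_le_half c_pos by (auto simp: width_def big_def)
  moreover have "y (j - int d) \<le> y j" "y (j + 1) \<le> y (j - int d + int m)"
    using d by (auto simp: strict_mono_less_eq[OF y_mono])
  ultimately show ?thesis using width_le_gap[of j] by (simp add: weight_def gap_def)
qed

lemma weight_nonneg: "weight i \<ge> 0"
  by (simp add: weight_def strict_mono_less_eq[OF y_mono])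

text \<open>The power of the sum \<open>A j\<close> splits into \<open>m * Suc m\<close> terms, the
  width is paid by the weights, and shifting the index turns each of the \<open>m\<close> offsets
  \<open>d\<close> into the same energy.\<close>

lemma nn_integral_D1_le:
  assumes p: "p > 0"
  shows "(\<integral>\<^sup>+x. D1 p x \<partial>lebesgue) \<le> ennreal ((C1 * real (m * Suc m)) powr p * real m) * energy p"
proof -
  define e where "e s i = (if nobig i s then weight i * \<bar>dd y v s i\<bar> powr p else 0)" for s i
  have e_nonneg: "e s i \<ge> 0" for s i by (simp add: e_def weight_nonneg)
  define N where "N = (C1 * real (m * Suc m)) powr p"
  have "N \<ge> 0" by (simp add: N_def)
  have main: "(C1 * A j) powr p * width j \<le> N * (\<Sum>d<m. \<Sum>s\<le>m. e s (j - int d))" for j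
  proof -
    have "A j = (\<Sum>(d, s)\<in>{..<m} \<times> {..m}. if nobig (j - int d) s then \<bar>dd y v s (j - int d)\<bar> else 0)"
      unfolding A_def by (simp add: sum.cartesian_product)
    also have "\<dots> powr p \<le> real (card ({..<m} \<times> {..m})) powr p *
        (\<Sum>z\<in>{..<m} \<times> {..m}. (case z of (d, s) \<Rightarrow> if nobig (j - int d) s then \<bar>dd y v s (j - int d)\<bar> else 0) powr p)"
      using p by (intro powr_sum_le) auto
    also have "\<dots> = real (m * Suc m) powr p *
        (\<Sum>d<m. \<Sum>s\<le>m. (if nobig (j - int d) s then \<bar>dd y v s (j - int d)\<bar> else 0) powr p)"
      by (simp add: sum.cartesian_product case_prod_beta)
    finally have Ap: "A j powr p \<le> real (m * Suc m) powr p *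
        (\<Sum>d<m. \<Sum>s\<le>m. (if nobig (j - int d) s then \<bar>dd y v s (j - int d)\<bar> else 0) powr p)" .
    have "(C1 * A j) powr p * width j = C1 powr p * (A j powr p * width j)"
      using C1_nonneg A_nonneg by (simp add: powr_mult)
    also have "\<dots> \<le> C1 powr p * ((real (m * Suc m) powr p *
        (\<Sum>d<m. \<Sum>s\<le>m. (if nobig (j - int d) s then \<bar>dd y v s (j - int d)\<bar> else 0) powr p)) * width j)"
      using Ap width_pos[of j] by (intro mult_left_mono mult_right_mono) auto
    also have "\<dots> = N * (\<Sum>d<m. \<Sum>s\<le>m. (if nobig (j - int d) s then \<bar>dd y v s (j - int d)\<bar> else 0) powr p * width j)"
      using C1_nonneg by (simp add: N_def powr_mult sum_distrib_right mult.assoc del: of_nat_mult)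
    also have "\<dots> \<le> N * (\<Sum>d<m. \<Sum>s\<le>m. e s (j - int d))"
      using \<open>N \<ge> 0\<close> width_le_weight p
      by (intro mult_left_mono sum_mono) (auto simp: e_def mult.commute intro!: mult_right_mono)
    finally show ?thesis .
  qed
  have [measurable]: "{a..b} \<in> sets lebesgue" for a b :: real by simp
  have "(\<integral>\<^sup>+x. D1 p x \<partial>lebesgue)
      = (\<integral>\<^sup>+j. (\<integral>\<^sup>+x. ennreal ((C1 * A j) powr p) * indicator {y j..y j + width j} x \<partial>lebesgue) \<partial>count_space UNIV)"
    unfolding D1_def by (rule nn_integral_count_space_nn_integral) auto
  also have "\<dots> = (\<integral>\<^sup>+j. ennreal ((C1 * A j) powr p * width j) \<partial>count_space UNIV)"
    using width_pos by (intro nn_integral_cong) (simp add: nn_integral_cmult_indicator ennreal_mult less_imp_le)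
  also have "\<dots> \<le> (\<integral>\<^sup>+j. ennreal N * (\<Sum>d<m. \<Sum>s\<le>m. ennreal (e s (j - int d))) \<partial>count_space UNIV)"
    using main e_nonneg \<open>N \<ge> 0\<close>
    by (intro nn_integral_mono) (auto simp: ennreal_mult[symmetric] sum_nonneg intro!: ennreal_leI)
  also have "\<dots> = ennreal N * (\<Sum>d<m. \<Sum>s\<le>m. (\<integral>\<^sup>+j. ennreal (e s (j - int d)) \<partial>count_space UNIV))"
    by (simp add: nn_integral_cmult nn_integral_sum)
  also have "\<dots> = ennreal N * (\<Sum>d<m. \<Sum>s\<le>m. (\<integral>\<^sup>+j. ennreal (e s j) \<partial>count_space UNIV))"
    by (simp add: nn_integral_count_space_int_shift[of "\<lambda>j. ennreal (e _ j)"])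
  also have "(\<Sum>s\<le>m. (\<integral>\<^sup>+j. ennreal (e s j) \<partial>count_space UNIV)) = energy p"
    unfolding energy_def e_def by (intro sum.cong nn_integral_cong) auto
  also have "ennreal N * (\<Sum>d<m. energy p) = ennreal (N * real m) * energy p"
    using \<open>N \<ge> 0\<close> by (simp add: ennreal_mult ennreal_of_nat_eq_real_of_nat mult.assoc)
  finally show ?thesis by (simp add: N_def)
qed

text \<open>The strip in front of a cluster carries, as a constant, the integral of
  \<open>D1\<close> over an interval of length \<open>c'\<close> behind the first knot of the
  cluster.\<close>

definition D2 :: "real \<Rightarrow> real \<Rightarrow> real \<Rightarrow> ennreal" where
  "D2 c' p x = (\<integral>\<^sup>+j. (if big j then (\<integral>\<^sup>+t\<in>{y (j + 1)..y (j + 1) + c'}. D1 p t \<partial>lebesgue) *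
      indicator {y (j + 1) - c..y (j + 1)} x else 0) \<partial>count_space UNIV)"

text \<open>Any later big gap begins at or after \<open>y (j + 1)\<close>, and its bad strip begins
  at least \<open>c > c'\<close> further on.\<close>

lemma good_after_big:
  assumes "big j" "c' < c" "y (j + 1) + c' \<in> U" "t \<in> {y (j + 1)..y (j + 1) + c'}"
  shows "good t"
  unfolding good_def
proof (intro conjI allI impI notI)
  show "t \<in> U" using U_convex[OF y_in_U assms(3)] assms(4) by auto
  fix i assume i: "big i" "y (i + 1) - c \<le> t \<and> t < y (i + 1)"
  then have "y (j + 1) < y (i + 1)" using assms(4) by auto
  then have "y (j + 1) \<le> y i" by (simp add: strict_mono_less_eq[OF y_mono] strict_mono_less[OF y_mono])
  moreover have "y (i + 1) \<ge> y i + 2 * c" using i(1) by (simp add: big_def gap_def)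
  ultimately show False using i(2) assms(2,4) by auto
qed

text \<open>\<open>C2\<close> is the cost of the switch, \<open>m\<close> that of the power of a sum
  of \<open>m\<close> terms, \<open>4\<close> that of the local Sobolev inequality. The last factor
  collects what is left outside the power: two integrals, \<open>m\<close> terms and the length
  \<open>c'\<close>. It is at least one.\<close>

definition C3 :: "real \<Rightarrow> real" where "C3 c' = C2 * real m * 4 * (2 * real m / c')"

text \<open>The jet at \<open>y (j + 1)\<close> is estimated by the local Sobolev inequality on the
  interval of length \<open>c'\<close> to its right, where all points are good and \<open>D1\<close>
  is already a majorant.\<close>

lemma powr_G_le_bad:
  assumes j: "big j" and c': "0 < c'" "c' < c" and in_U: "y (j + 1) + c' \<in> U" and k: "k \<le> m" and p: "1 < p"
    and x: "y (j + 1) - c \<le> x" "x < y (j + 1)"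
  shows "ennreal (\<bar>G k x\<bar> powr p) \<le> ennreal (C3 c' powr p) * (\<integral>\<^sup>+t\<in>{y (j + 1)..y (j + 1) + c'}. D1 p t \<partial>lebesgue)"
proof -
  define \<xi> where "\<xi> = y (j + 1)"
  define I where "I = (\<integral>\<^sup>+t\<in>{\<xi>..\<xi> + c'}. D1 p t \<partial>lebesgue)"
  have [measurable]: "{a..b} \<in> sets lebesgue" for a b :: real by simp
  have sub: "t \<in> U" if "t \<in> {\<xi>..\<xi> + c'}" for t
    using good_after_big[OF j c'(2) in_U, of t] that by (auto simp: \<xi>_def good_def)
  have le_D1: "(\<integral>\<^sup>+t\<in>{\<xi>..\<xi> + c'}. ennreal (\<bar>G r t\<bar> powr p) \<partial>lebesgue) \<le> I" if "r \<le> m" for r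
    unfolding I_def using good_after_big[OF j c'(2) in_U] powr_G_le_good[OF _ that, of _ p] p
    by (intro nn_integral_mono) (auto simp: indicator_def \<xi>_def)
  have jet: "ennreal (\<bar>G r \<xi>\<bar> powr p) \<le> ennreal (4 powr p * (2 / c')) * I" if r: "r < m" for r
  proof -
    have "ennreal ((\<xi> + c' - \<xi>) * \<bar>G r \<xi>\<bar> powr p) \<le> ennreal (4 powr p) *
      ((\<integral>\<^sup>+t\<in>{\<xi>..\<xi> + c'}. ennreal (\<bar>G r t\<bar> powr p) \<partial>lebesgue) + (\<integral>\<^sup>+t\<in>{\<xi>..\<xi> + c'}. ennreal (\<bar>G (Suc r) t\<bar> powr p) \<partial>lebesgue))"
    proof (rule local_sobolev[OF p])
      fix t assume t: "t \<in> {\<xi>..\<xi> + c'}"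
      have "ennreal \<bar>G r \<xi> - G r t\<bar> \<le> (\<integral>\<^sup>+t\<in>{\<xi>..t}. ennreal \<bar>G (Suc r) t\<bar> \<partial>lebesgue)"
        using G_increment[OF r, of \<xi> t] sub t c' by (simp add: abs_minus_commute)
      also have "\<dots> \<le> (\<integral>\<^sup>+t\<in>{\<xi>..\<xi> + c'}. ennreal \<bar>G (Suc r) t\<bar> \<partial>lebesgue)"
        using t by (intro nn_integral_mono) (auto simp: indicator_def)
      finally show "ennreal \<bar>G r \<xi> - G r t\<bar> \<le> (\<integral>\<^sup>+t\<in>{\<xi>..\<xi> + c'}. ennreal \<bar>G (Suc r) t\<bar> \<partial>lebesgue)" .
    qed (use c' c_le_half r in \<open>auto intro: measurable_G_lebesgue\<close>)
    also have "\<dots> \<le> ennreal (4 powr p) * (I + I)"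
      using r by (intro mult_left_mono add_mono le_D1) auto
    also have "I + I = ennreal 2 * I" by (metis distrib_right ennreal_numeral mult_1 one_add_one zero_le_numeral)
    finally have *: "ennreal (c' * \<bar>G r \<xi>\<bar> powr p) \<le> ennreal (4 powr p) * (ennreal 2 * I)" by simp
    have "ennreal (\<bar>G r \<xi>\<bar> powr p) = ennreal (1 / c') * ennreal (c' * \<bar>G r \<xi>\<bar> powr p)"
      using c' by (simp add: ennreal_mult[symmetric])
    also have "\<dots> \<le> ennreal (1 / c') * (ennreal (4 powr p) * (ennreal 2 * I))"
      by (intro mult_left_mono *) simp
    also have "\<dots> = ennreal (1 / c' * (4 powr p * 2)) * I"
    proof -
      have "ennreal (1 / c' * (4 powr p * 2)) = ennreal (1 / c') * ennreal (4 powr p * 2)"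
        using c' by (intro ennreal_mult) auto
      also have "ennreal (4 powr p * 2) = ennreal (4 powr p) * ennreal 2" by (intro ennreal_mult) auto
      finally show ?thesis by (simp only: mult.assoc)
    qed
    finally show ?thesis by (simp add: mult_ac)
  qed
  define X where "X = 4 powr p * (2 / c')"
  have X: "X \<ge> 0" using c' by (simp add: X_def)
  have "\<bar>G k x\<bar> \<le> C2 * (\<Sum>r<m. \<bar>G r \<xi>\<bar>)"
  proof -
    have "y j \<le> x" using x j c_pos by (simp add: big_def gap_def)
    then show ?thesis
      using abs_phi_big_right_le[OF j k, of x] G_eq_phi[of j x k] x by (simp add: G_knot \<xi>_def)
  qed
  then have "\<bar>G k x\<bar> powr p \<le> (C2 * (\<Sum>r<m. \<bar>G r \<xi>\<bar>)) powr p" using p by (intro powr_mono2) auto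
  also have "\<dots> = C2 powr p * (\<Sum>r<m. \<bar>G r \<xi>\<bar>) powr p" using C2_nonneg by (simp add: powr_mult sum_nonneg)
  also have "\<dots> \<le> C2 powr p * (real (card {..<m}) powr p * (\<Sum>r<m. \<bar>G r \<xi>\<bar> powr p))"
    using p by (intro mult_left_mono powr_sum_le) auto
  finally have "ennreal (\<bar>G k x\<bar> powr p) \<le> ennreal (C2 powr p * real m powr p) * (\<Sum>r<m. ennreal (\<bar>G r \<xi>\<bar> powr p))"
    by (simp add: ennreal_mult[symmetric] sum_nonneg mult.assoc ennreal_leI)
  also have "\<dots> \<le> ennreal (C2 powr p * real m powr p) * (\<Sum>r<m. ennreal X * I)"
    using jet by (intro mult_left_mono sum_mono) (auto simp: X_def)
  also have "\<dots> = ennreal (C2 powr p * real m powr p * (real m * X)) * I"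
    using X by (simp add: ennreal_mult ennreal_of_nat_eq_real_of_nat mult.assoc)
  also have "\<dots> \<le> ennreal (C3 c' powr p) * I"
  proof (intro mult_right_mono ennreal_leI)
    have "c' \<le> real m" using c' c_le_half c_pos m_pos
      by (metis One_nat_def Suc_leI add_increasing2 less_imp_le mult_2 of_nat_1 of_nat_mono order_trans)
    then have "1 \<le> 2 * real m / c'" using c' by simp
    then have "(2 * real m / c') powr 1 \<le> (2 * real m / c') powr p" using p by (intro powr_mono) auto
    then have "2 * real m / c' \<le> (2 * real m / c') powr p" using c' by simp
    then have "C2 powr p * real m powr p * 4 powr p * (2 * real m / c')
        \<le> C2 powr p * real m powr p * 4 powr p * (2 * real m / c') powr p"
      by (intro mult_left_mono) auto
    also have "\<dots> = C3 c' powr p"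
    proof -
      have "(C2 * real m * 4 * B) powr p = C2 powr p * real m powr p * 4 powr p * B powr p" if "B \<ge> 0" for B
        using C2_nonneg that by (simp add: powr_mult)
      from this[of "2 * real m / c'"] show ?thesis unfolding C3_def using c' by simp
    qed
    finally show "C2 powr p * real m powr p * (real m * X) \<le> C3 c' powr p"
      by (simp add: X_def mult_ac)
  qed simp
  finally show ?thesis unfolding I_def \<xi>_def .
qed

text \<open>The strips have length \<open>c \<le> 1\<close>, and the intervals behind different big
  gaps are disjoint because \<open>c' < 2 * c\<close>; so \<open>D1\<close> is counted at most
  once.\<close>

lemma nn_integral_D2_le:
  assumes c': "0 < c'" "c' < c"
  shows "(\<integral>\<^sup>+x. D2 c' p x \<partial>lebesgue) \<le> (\<integral>\<^sup>+x. D1 p x \<partial>lebesgue)"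
proof -
  have [measurable]: "{a..b} \<in> sets lebesgue" for a b :: real by simp
  define I where "I j = (\<integral>\<^sup>+t\<in>{y (j + 1)..y (j + 1) + c'}. D1 p t \<partial>lebesgue)" for j
  have "(\<integral>\<^sup>+x. D2 c' p x \<partial>lebesgue)
     = (\<integral>\<^sup>+j. (\<integral>\<^sup>+x. (if big j then I j * indicator {y (j + 1) - c..y (j + 1)} x else 0) \<partial>lebesgue) \<partial>count_space UNIV)"
    unfolding D2_def I_def by (rule nn_integral_count_space_nn_integral) auto
  also have "\<dots> \<le> (\<integral>\<^sup>+j. (if big j then I j else 0) \<partial>count_space UNIV)"
  proof (rule nn_integral_mono)
    fix j
    have "ennreal c \<le> 1" using c_le_half c_pos by (simp add: ennreal_le_1)
    then show "(\<integral>\<^sup>+x. (if big j then I j * indicator {y (j + 1) - c..y (j + 1)} x else 0) \<partial>lebesgue)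
        \<le> (if big j then I j else 0)"
      using c_pos mult_left_mono[of "ennreal c" 1 "I j"] by (simp add: nn_integral_cmult_indicator)
  qed
  also have "\<dots> = (\<integral>\<^sup>+j. (\<integral>\<^sup>+t. D1 p t * (if big j \<and> t \<in> {y (j + 1)..y (j + 1) + c'} then 1 else 0) \<partial>lebesgue) \<partial>count_space UNIV)"
    unfolding I_def by (intro nn_integral_cong) (auto simp: indicator_def intro!: nn_integral_cong)
  also have "\<dots> = (\<integral>\<^sup>+t. (\<integral>\<^sup>+j. D1 p t * (if big j \<and> t \<in> {y (j + 1)..y (j + 1) + c'} then 1 else 0) \<partial>count_space UNIV) \<partial>lebesgue)"
    by (rule nn_integral_count_space_nn_integral[symmetric]) measurable
  also have "\<dots> \<le> (\<integral>\<^sup>+t. D1 p t * 1 \<partial>lebesgue)"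
  proof (rule nn_integral_mono)
    fix t
    have "(\<integral>\<^sup>+j. (if big j \<and> t \<in> {y (j + 1)..y (j + 1) + c'} then 1 else 0) \<partial>count_space UNIV) \<le> (1::ennreal)"
    proof (rule nn_integral_count_space_le_one)
      have *: "\<not> i < j" if ij: "big i \<and> t \<in> {y (i + 1)..y (i + 1) + c'}" "big j \<and> t \<in> {y (j + 1)..y (j + 1) + c'}" for i j
      proof
        assume "i < j"
        then have "y (i + 1) \<le> y j" by (simp add: strict_mono_less_eq[OF y_mono])
        moreover have "y j + 2 * c \<le> y (j + 1)" using ij(2) by (auto simp: big_def gap_def)
        ultimately show False using ij c' c_pos by auto
      qed
      show "i = j" if "big i \<and> t \<in> {y (i + 1)..y (i + 1) + c'}" "big j \<and> t \<in> {y (j + 1)..y (j + 1) + c'}" for i j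
        using *[OF that] *[OF that(2) that(1)] by simp
    qed
    then show "(\<integral>\<^sup>+j. D1 p t * (if big j \<and> t \<in> {y (j + 1)..y (j + 1) + c'} then 1 else 0) \<partial>count_space UNIV) \<le> D1 p t * 1"
      using mult_left_mono[of "\<integral>\<^sup>+j. (if big j \<and> t \<in> {y (j + 1)..y (j + 1) + c'} then 1 else 0) \<partial>count_space UNIV" 1 "D1 p t"]
      by (subst nn_integral_cmult) auto
  qed
  finally show ?thesis by simp
qed

definition C4 :: "real \<Rightarrow> real" where "C4 c' = 2 * (1 + C3 c') * (C1 * real (m * Suc m) * real m)"

proposition nn_integral_powr_G_le:
  assumes c': "0 < c'" "c' < c" and in_U: "\<And>j. big j \<Longrightarrow> y (j + 1) + c' \<in> U" and k: "k \<le> m" and p: "1 < p"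
  shows "(\<integral>\<^sup>+x. ennreal (\<bar>G k x\<bar> powr p) \<partial>lebesgue) \<le> ennreal (C4 c' powr p) * energy p"
proof -
  have [measurable]: "{a..b} \<in> sets lebesgue" for a b :: real by simp
  have [measurable]: "D2 c' p \<in> borel_measurable lebesgue" unfolding D2_def[abs_def] by measurable
  have C3: "C3 c' \<ge> 0" using C2_nonneg c' by (simp add: C3_def)
  have "ennreal (\<bar>G k x\<bar> powr p) \<le> D1 p x + ennreal (C3 c' powr p) * D2 c' p x" for x
  proof (cases "x \<in> U")
    case False
    then show ?thesis using p by (simp add: G_def)
  next
    case True
    show ?thesis
    proof (cases "good x")
      case True
      then show ?thesis using powr_G_le_good[OF True k, of p] p by (intro add_increasing2) auto
    next
      case False
      then obtain j where j: "big j" "y (j + 1) - c \<le> x" "x < y (j + 1)" using True by (auto simp: good_def)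
      have "(if big j then (\<integral>\<^sup>+t\<in>{y (j + 1)..y (j + 1) + c'}. D1 p t \<partial>lebesgue) *
          indicator {y (j + 1) - c..y (j + 1)} x else 0) \<le> D2 c' p x"
        unfolding D2_def by (rule nn_integral_ge_point) simp
      then have "(\<integral>\<^sup>+t\<in>{y (j + 1)..y (j + 1) + c'}. D1 p t \<partial>lebesgue) \<le> D2 c' p x"
        using j by simp
      then have "ennreal (\<bar>G k x\<bar> powr p) \<le> ennreal (C3 c' powr p) * D2 c' p x"
        using powr_G_le_bad[OF j(1) c' in_U[OF j(1)] k p j(2,3)] by (meson mult_left_mono order_trans zero_le)
      then show ?thesis by (intro add_increasing) auto
    qed
  qed
  then have "(\<integral>\<^sup>+x. ennreal (\<bar>G k x\<bar> powr p) \<partial>lebesgue)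
      \<le> (\<integral>\<^sup>+x. D1 p x + ennreal (C3 c' powr p) * D2 c' p x \<partial>lebesgue)"
    by (intro nn_integral_mono)
  also have "\<dots> = (\<integral>\<^sup>+x. D1 p x \<partial>lebesgue) + ennreal (C3 c' powr p) * (\<integral>\<^sup>+x. D2 c' p x \<partial>lebesgue)"
    by (simp add: nn_integral_add nn_integral_cmult)
  also have "\<dots> \<le> (\<integral>\<^sup>+x. D1 p x \<partial>lebesgue) + ennreal (C3 c' powr p) * (\<integral>\<^sup>+x. D1 p x \<partial>lebesgue)"
    by (intro add_left_mono mult_left_mono nn_integral_D2_le c') simp
  also have "\<dots> = ennreal (1 + C3 c' powr p) * (\<integral>\<^sup>+x. D1 p x \<partial>lebesgue)"
    by (simp add: ennreal_plus distrib_right)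
  also have "\<dots> \<le> ennreal (1 + C3 c' powr p) * (ennreal ((C1 * real (m * Suc m)) powr p * real m) * energy p)"
    using p by (intro mult_left_mono nn_integral_D1_le) auto
  also have "\<dots> = ennreal ((1 + C3 c' powr p) * ((C1 * real (m * Suc m)) powr p * real m)) * energy p"
    by (simp add: ennreal_mult mult.assoc)
  also have "\<dots> \<le> ennreal (C4 c' powr p) * energy p"
  proof (intro mult_right_mono ennreal_leI)
    have "1 + C3 c' powr p \<le> 2 * (1 + C3 c') powr p"
      using C3 p powr_mono2[of p 1 "1 + C3 c'"] powr_mono2[of p "C3 c'" "1 + C3 c'"] by simp
    also have "\<dots> \<le> 2 powr p * (1 + C3 c') powr p"
      using p powr_mono[of 1 p 2] by (intro mult_right_mono) auto
    finally have "1 + C3 c' powr p \<le> 2 powr p * (1 + C3 c') powr p" .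
    then have 1: "1 + C3 c' powr p \<le> (2 * (1 + C3 c')) powr p" using C3 by (subst powr_mult) auto
    have "real m powr 1 \<le> real m powr p" using m_pos p by (intro powr_mono) auto
    then have 2: "real m \<le> real m powr p" using m_pos by simp
    have "(1 + C3 c' powr p) * ((C1 * real (m * Suc m)) powr p * real m)
        \<le> (2 * (1 + C3 c')) powr p * ((C1 * real (m * Suc m)) powr p * real m powr p)"
      using 1 2 by (intro mult_mono) auto
    also have "\<dots> = C4 c' powr p"
      unfolding C4_def using C3 C1_nonneg by (simp add: powr_mult del: of_nat_mult)
    finally show "(1 + C3 c' powr p) * ((C1 * real (m * Suc m)) powr p * real m) \<le> C4 c' powr p" .
  qed simp
  finally show ?thesis .
qed

end

section \<open>Extension beyond the end points\<close>

text \<open>The finite set \<open>X\<close> is there for the end points: a continuation matches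
  derivatives below order \<open>m\<close> only, and the one of order \<open>m\<close> may
  jump.\<close>

definition jets_on :: "nat \<Rightarrow> real set \<Rightarrow> real set \<Rightarrow> (nat \<Rightarrow> real \<Rightarrow> real) \<Rightarrow> bool" where
  "jets_on m R X G \<longleftrightarrow> open R \<and> finite X \<and> (\<forall>k<m. continuous_on R (G k)) \<and>
     (\<forall>k<m. \<forall>x\<in>R - X. (G k has_real_derivative G (Suc k) x) (at x)) \<and>
     (\<forall>k\<le>m. G k \<in> borel_measurable borel)"

lemma jets_on_measurable_lebesgue:
  assumes "jets_on m R X G" "k \<le> m"
  shows "G k \<in> borel_measurable lebesgue"
  using assms by (intro measurable_completion) (simp add: jets_on_def)

lemma jets_on_has_integral:
  assumes J: "jets_on m R X G" and k: "k < m" and ab: "a \<le> b" "{a..b} \<subseteq> R"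
  shows "(G (Suc k) has_integral G k b - G k a) {a..b}"
proof (rule fundamental_theorem_of_calculus_interior_strong)
  show "finite X" using J by (simp add: jets_on_def)
  show "continuous_on {a..b} (G k)" using J k ab(2) unfolding jets_on_def by (meson continuous_on_subset)
  show "(G k has_vector_derivative G (Suc k) x) (at x)" if "x \<in> {a<..<b} - X" for x
  proof -
    have "x \<in> R - X" using that ab(2) by auto
    then show ?thesis using J k by (simp add: jets_on_def has_real_derivative_iff_has_vector_derivative)
  qed
qed (rule ab)

text \<open>Absolute continuity speaks of disjoint open intervals, so end points have to be
  discarded before integrals are added.\<close>

lemma nn_integral_closed_eq_open_interval:
  "(\<integral>\<^sup>+t\<in>{u..v::real}. f t \<partial>lebesgue) = (\<integral>\<^sup>+t\<in>{u<..<v}. f t \<partial>lebesgue)"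
proof (rule nn_integral_cong_AE)
  have "{u, v} \<in> null_sets lebesgue"
    by (intro null_sets_completionI countable_imp_null_set_lborel) auto
  then have "AE t in lebesgue. t \<notin> {u, v}" by (rule AE_not_in)
  then show "AE t in lebesgue. f t * indicator {u..v} t = f t * indicator {u<..<v} t"
    by eventually_elim (auto simp: indicator_def)
qed

text \<open>Cutting \<open>\<bar>g\<bar>\<close> at a level \<open>t\<close>, the excess costs at
  most \<open>t powr (1 - p) * B\<close> over all intervals together and the rest costs
  \<open>t\<close> times their total length.\<close>

lemma abs_continuous_on_of_integral_bound:
  assumes p: "1 < p" and g[measurable]: "g \<in> borel_measurable lebesgue"
    and fin: "(\<integral>\<^sup>+t. ennreal (\<bar>g t\<bar> powr p) \<partial>lebesgue) < \<infinity>"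
    and le: "\<And>u v. u \<le> v \<Longrightarrow> ennreal \<bar>F v - F u\<bar> \<le> (\<integral>\<^sup>+t\<in>{u..v}. ennreal \<bar>g t\<bar> \<partial>lebesgue)"
  shows "abs_continuous_on S F"
  unfolding abs_continuous_on_def
proof (intro allI impI)
  fix \<epsilon> :: real assume "\<epsilon> > 0"
  obtain B where B: "B \<ge> 0" "(\<integral>\<^sup>+t. ennreal (\<bar>g t\<bar> powr p) \<partial>lebesgue) = ennreal B"
    using fin by (metis ennreal_cases less_irrefl infinity_ennreal_def)
  \<comment> \<open>Solves \<open>t powr (1 - p) = 1 / (2 * B / \<epsilon> + 1)\<close>; the summand
    one keeps the base positive if \<open>B = 0\<close>.\<close>
  define t where "t = (2 * B / \<epsilon> + 1) powr (1 / (p - 1))"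
  have base: "2 * B / \<epsilon> + 1 > 0" using B(1) \<open>\<epsilon> > 0\<close> by (simp add: add_nonneg_pos)
  have "t > 0" using base by (simp add: t_def)
  have exp: "1 / (p - 1) * (1 - p) = - 1" using p by (simp add: field_simps)
  have t_eq: "t powr (1 - p) = 1 / (2 * B / \<epsilon> + 1)"
    using base unfolding t_def powr_powr exp by (simp add: powr_minus_divide)
  have "B / (2 * B / \<epsilon> + 1) < \<epsilon> / 2"
    using \<open>\<epsilon> > 0\<close> by (subst pos_divide_less_eq[OF base]) (simp add: field_simps)
  then have tB: "t powr (1 - p) * B < \<epsilon> / 2" by (simp add: t_eq)
  show "\<exists>\<delta>>0. \<forall>(n::nat) u v. (\<forall>j<n. u j \<le> v j \<and> {u j..v j} \<subseteq> S) \<longrightarrow>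
        disjoint_family_on (\<lambda>j. {u j<..<v j}) {..<n} \<longrightarrow>
        (\<Sum>j<n. v j - u j) < \<delta> \<longrightarrow> (\<Sum>j<n. \<bar>F (v j) - F (u j)\<bar>) < \<epsilon>"
  proof (intro exI[of _ "\<epsilon> / (2 * t)"] conjI allI impI)
    show "\<epsilon> / (2 * t) > 0" using \<open>\<epsilon> > 0\<close> \<open>t > 0\<close> by simp
    fix n :: nat and u v :: "nat \<Rightarrow> real"
    assume uv: "\<forall>j<n. u j \<le> v j \<and> {u j..v j} \<subseteq> S"
      and disj: "disjoint_family_on (\<lambda>j. {u j<..<v j}) {..<n}"
      and sum: "(\<Sum>j<n. v j - u j) < \<epsilon> / (2 * t)"
    have [measurable]: "{a<..<b} \<in> sets lebesgue" for a b :: real by simp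
    define h where "h x = ennreal (t powr (1 - p)) * ennreal (\<bar>g x\<bar> powr p)" for x
    have hm[measurable]: "h \<in> borel_measurable lebesgue" unfolding h_def by measurable
    have "ennreal (\<Sum>j<n. \<bar>F (v j) - F (u j)\<bar>) = (\<Sum>j<n. ennreal \<bar>F (v j) - F (u j)\<bar>)"
      by (simp add: sum_ennreal)
    also have "\<dots> \<le> (\<Sum>j<n. \<integral>\<^sup>+x\<in>{u j..v j}. ennreal \<bar>g x\<bar> \<partial>lebesgue)"
      using uv by (intro sum_mono le) auto
    also have "\<dots> \<le> (\<Sum>j<n. \<integral>\<^sup>+x\<in>{u j<..<v j}. (ennreal t + h x) \<partial>lebesgue)"
      unfolding nn_integral_closed_eq_open_interval
    proof (intro sum_mono nn_integral_mono mult_right_mono)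
      fix x
      show "ennreal \<bar>g x\<bar> \<le> ennreal t + h x"
        using abs_le_cutoff_powr[OF \<open>t > 0\<close> p, of "g x"] \<open>t > 0\<close> unfolding h_def
        by (simp add: ennreal_plus[symmetric] ennreal_mult[symmetric] del: ennreal_plus)
    qed simp
    also have "\<dots> = (\<Sum>j<n. (\<integral>\<^sup>+x. ennreal t * indicator {u j<..<v j} x \<partial>lebesgue) + (\<integral>\<^sup>+x\<in>{u j<..<v j}. h x \<partial>lebesgue))"
      unfolding distrib_right by (intro sum.cong refl nn_integral_add) measurable
    also have "\<dots> = (\<Sum>j<n. ennreal (t * (v j - u j))) + (\<Sum>j<n. \<integral>\<^sup>+x\<in>{u j<..<v j}. h x \<partial>lebesgue)"
      using uv \<open>t > 0\<close> unfolding sum.distrib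
      by (intro arg_cong2[of _ _ _ _ "(+)"] sum.cong) (auto simp: nn_integral_cmult_indicator ennreal_mult)
    also have "(\<Sum>j<n. ennreal (t * (v j - u j))) = ennreal (t * (\<Sum>j<n. v j - u j))"
      unfolding sum_distrib_left using uv \<open>t > 0\<close> by (intro sum_ennreal) auto
    also have "(\<Sum>j<n. \<integral>\<^sup>+x\<in>{u j<..<v j}. h x \<partial>lebesgue) = (\<integral>\<^sup>+x. (\<Sum>j<n. h x * indicator {u j<..<v j} x) \<partial>lebesgue)"
      by (rule nn_integral_sum[symmetric]) measurable
    also have "\<dots> \<le> (\<integral>\<^sup>+x. h x \<partial>lebesgue)"
    proof (rule nn_integral_mono)
      fix x
      show "(\<Sum>j<n. h x * indicator {u j<..<v j} x) \<le> h x"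
      proof (cases "\<exists>j<n. x \<in> {u j<..<v j}")
        case True
        then obtain j where j: "j < n" "x \<in> {u j<..<v j}" by blast
        have "(\<Sum>i<n. h x * indicator {u i<..<v i} x) = (\<Sum>i\<in>{j}. h x * indicator {u i<..<v i} x)"
        proof (rule sum.mono_neutral_right)
          show "\<forall>i\<in>{..<n} - {j}. h x * indicator {u i<..<v i} x = 0"
          proof
            fix i assume "i \<in> {..<n} - {j}"
            then have "{u i<..<v i} \<inter> {u j<..<v j} = {}" using disj j(1) by (auto simp: disjoint_family_on_def)
            then show "h x * indicator {u i<..<v i} x = 0" using j(2) by (auto simp: indicator_def)
          qed
        qed (use j in auto)
        also have "\<dots> = h x" using j(2) by simp
        finally show ?thesis by (simp only: order_refl)
      next
        case False
        then have "(\<Sum>j<n. h x * indicator {u j<..<v j} x) = 0" by (intro sum.neutral) (auto simp: indicator_def)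
        then show ?thesis by (simp only: zero_le)
      qed
    qed
    also have "(\<integral>\<^sup>+x. h x \<partial>lebesgue) = ennreal (t powr (1 - p) * B)"
      using B unfolding h_def by (simp add: nn_integral_cmult ennreal_mult)
    also have "ennreal (t * (\<Sum>j<n. v j - u j)) + ennreal (t powr (1 - p) * B)
        = ennreal (t * (\<Sum>j<n. v j - u j) + t powr (1 - p) * B)"
      using uv \<open>t > 0\<close> B by (intro ennreal_plus[symmetric] mult_nonneg_nonneg sum_nonneg) auto
    finally have fin_le: "ennreal (\<Sum>j<n. \<bar>F (v j) - F (u j)\<bar>)
      \<le> ennreal (t * (\<Sum>j<n. v j - u j) + t powr (1 - p) * B)" by simp
    have "0 \<le> t * (\<Sum>j<n. v j - u j) + t powr (1 - p) * B"
      using uv \<open>t > 0\<close> B by (intro add_nonneg_nonneg mult_nonneg_nonneg sum_nonneg) auto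
    then have "(\<Sum>j<n. \<bar>F (v j) - F (u j)\<bar>) \<le> t * (\<Sum>j<n. v j - u j) + t powr (1 - p) * B"
      using fin_le by (subst (asm) ennreal_le_iff)
    moreover have "t * (\<Sum>j<n. v j - u j) < \<epsilon> / 2"
      using sum \<open>t > 0\<close> by (simp add: field_simps)
    ultimately show "(\<Sum>j<n. \<bar>F (v j) - F (u j)\<bar>) < \<epsilon>" using tB by linarith
  qed
qed

text \<open>Below the top order exceptional points disappear: \<open>G k\<close> is an integral of
  the continuous function \<open>G (Suc k)\<close>.\<close>

lemma jets_on_UNIV_derivative:
  assumes J: "jets_on m UNIV X G" and k: "Suc k < m"
  shows "(G k has_real_derivative G (Suc k) x) (at x)"
proof -
  have cont: "continuous_on {x - 1..x + 1} (G (Suc k))"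
    using J k unfolding jets_on_def by (meson continuous_on_subset subset_UNIV)
  have "((\<lambda>t. integral {x - 1..t} (G (Suc k))) has_real_derivative G (Suc k) x) (at x within {x - 1..x + 1})"
    by (rule integral_has_real_derivative[OF cont]) auto
  then have "((\<lambda>t. integral {x - 1..t} (G (Suc k))) has_real_derivative G (Suc k) x) (at x)"
    by (subst (asm) at_within_interior) (auto simp: interior_atLeastAtMost_real)
  then have "((\<lambda>t. G k (x - 1) + integral {x - 1..t} (G (Suc k))) has_real_derivative 0 + G (Suc k) x) (at x)"
    by (intro DERIV_add DERIV_const)
  then have "((\<lambda>t. G k (x - 1) + integral {x - 1..t} (G (Suc k))) has_real_derivative G (Suc k) x) (at x)" by simp
  then show ?thesis
  proof (rule has_field_derivative_transform_within_open[of _ _ _ "{x - 1<..<x + 1}"])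
    fix t assume "t \<in> {x - 1<..<x + 1}"
    then have "(G (Suc k) has_integral G k t - G k (x - 1)) {x - 1..t}"
      using k by (intro jets_on_has_integral[OF J]) auto
    then show "G k (x - 1) + integral {x - 1..t} (G (Suc k)) = G k t" by (simp add: integral_unique)
  qed auto
qed

text \<open>Below order \<open>m\<close> the iterates of \<open>deriv\<close> are the jet
  everywhere; at order \<open>m\<close> they agree with it off the finite set \<open>X\<close>,
  which integrals do not see.\<close>

proposition sobolev_W_of_jets:
  assumes J: "jets_on m UNIV X G" and m: "m > 0" and p: "1 < p"
    and fin: "\<And>k. k \<le> m \<Longrightarrow> (\<integral>\<^sup>+t. ennreal (\<bar>G k t\<bar> powr p) \<partial>lebesgue) \<le> ennreal (N powr p)" and N: "0 \<le> N"
  shows "G 0 \<in> sobolev_W m p" "sobolev_W_norm m p (G 0) \<le> real (m + 1) * N"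
proof -
  have iter: "(deriv ^^ k) (G 0) = G k" if "k < m" for k
    using that
  proof (induction k)
    case (Suc k)
    have "deriv (G k) = G (Suc k)"
      using jets_on_UNIV_derivative[OF J Suc.prems] by (intro ext DERIV_imp_deriv)
    then show ?case using Suc by simp
  qed simp
  have top: "(deriv ^^ m) (G 0) x = G m x" if "x \<notin> X" for x
  proof -
    have "(deriv ^^ m) (G 0) = deriv (G (m - 1))"
      using m iter[of "m - 1"] by (cases m) auto
    moreover have "(G (m - 1) has_real_derivative G m x) (at x)"
      using J m that unfolding jets_on_def by (metis DiffI Suc_diff_1 UNIV_I diff_less zero_less_one)
    ultimately show ?thesis by (simp add: DERIV_imp_deriv)
  qed
  have X: "finite X" using J by (simp add: jets_on_def)
  have top_meas: "(deriv ^^ m) (G 0) \<in> borel_measurable lebesgue"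
    by (rule measurable_discrete_difference[OF jets_on_measurable_lebesgue[OF J order_refl], of X])
      (use X top in \<open>auto intro: countable_finite\<close>)
  have meas: "(deriv ^^ k) (G 0) \<in> borel_measurable lebesgue" if "k \<le> m" for k
    using top_meas iter[of k] jets_on_measurable_lebesgue[OF J that] that by (cases "k = m") auto
  have AE_eq: "AE x in lebesgue. (deriv ^^ k) (G 0) x = G k x" if "k \<le> m" for k
  proof (cases "k = m")
    case True
    have "X \<in> null_sets lebesgue"
      using X by (intro null_sets_completionI countable_imp_null_set_lborel) (auto intro: countable_finite)
    then have "AE x in lebesgue. x \<notin> X" by (rule AE_not_in)
    then show ?thesis unfolding True by eventually_elim (rule top)
  qed (use iter that in auto)
  have int_eq: "(\<integral>\<^sup>+x. ennreal (\<bar>(deriv ^^ k) (G 0) x\<bar> powr p) \<partial>lebesgue) \<le> ennreal (N powr p)" if "k \<le> m" for k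
  proof -
    have "(\<integral>\<^sup>+x. ennreal (\<bar>(deriv ^^ k) (G 0) x\<bar> powr p) \<partial>lebesgue) = (\<integral>\<^sup>+x. ennreal (\<bar>G k x\<bar> powr p) \<partial>lebesgue)"
      using AE_eq[OF that] by (intro nn_integral_cong_AE) auto
    then show ?thesis using fin[OF that] by simp
  qed
  have Lp: "(deriv ^^ k) (G 0) \<in> Lp_space p" if "k \<le> m" for k
    unfolding Lp_space_def
  proof (intro CollectI conjI meas[OF that] integrableI_bounded)
    show "(\<lambda>x. \<bar>(deriv ^^ k) (G 0) x\<bar> powr p) \<in> borel_measurable lebesgue"
      using meas[OF that] by measurable
    show "(\<integral>\<^sup>+x. ennreal (norm (\<bar>(deriv ^^ k) (G 0) x\<bar> powr p)) \<partial>lebesgue) < \<infinity>"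
      using int_eq[OF that] by (auto intro: le_less_trans)
  qed
  have ac: "abs_continuous_on S (G (m - 1))" for S
  proof (rule abs_continuous_on_of_integral_bound[OF p jets_on_measurable_lebesgue[OF J order_refl]])
    show "(\<integral>\<^sup>+t. ennreal (\<bar>G m t\<bar> powr p) \<partial>lebesgue) < \<infinity>" using fin[of m] by (auto intro: le_less_trans)
    show "ennreal \<bar>G (m - 1) v - G (m - 1) u\<bar> \<le> (\<integral>\<^sup>+t\<in>{u..v}. ennreal \<bar>G m t\<bar> \<partial>lebesgue)" if "u \<le> v" for u v
      using jets_on_has_integral[OF J, of "m - 1" u v] that m
      by (intro has_integral_abs_le_nn_integral jets_on_measurable_lebesgue[OF J]) auto
  qed
  show "G 0 \<in> sobolev_W m p"
    unfolding sobolev_W_def sobolev_L_def locally_abs_continuous_def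
  proof (intro CollectI conjI allI impI Lp)
    fix k x assume "k < m - 1"
    then have "Suc k < m" "k < m" by auto
    then show "(deriv ^^ k) (G 0) differentiable at x"
      using jets_on_UNIV_derivative[OF J, of k x] iter[of k] by (auto simp: real_differentiable_def)
  qed (use m ac iter[of "m - 1"] in auto)
  have "Lp_norm p ((deriv ^^ k) (G 0)) \<le> N" if "k \<le> m" for k
  proof -
    have "ennreal (Lp_norm p ((deriv ^^ k) (G 0)) powr p) \<le> ennreal (N powr p)"
      using int_eq[OF that] nn_integral_Lp_norm[OF Lp[OF that]] p by simp
    then have "Lp_norm p ((deriv ^^ k) (G 0)) powr p \<le> N powr p" by simp
    then show ?thesis using p N Lp_norm_nonneg
      by (metis le_less_linear powr_less_mono2 not_less less_trans zero_less_one)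
  qed
  then have "sobolev_W_norm m p (G 0) \<le> (\<Sum>k\<le>m. N)" unfolding sobolev_W_norm_def by (intro sum_mono) auto
  then show "sobolev_W_norm m p (G 0) \<le> real (m + 1) * N" by simp
qed

section \<open>Continuation past a finite end\<close>

lemma ex_poly_with_jet:
  fixes l :: "nat \<Rightarrow> real"
  assumes "m > 0"
  shows "\<exists>P. degree P < m \<and> (\<forall>k<m. poly ((pderiv ^^ k) P) a = l k)"
  using assms
proof (induction m)
  case (Suc m)
  show ?case
  proof (cases "m = 0")
    case True
    then show ?thesis by (intro exI[of _ "[:l 0:]"]) auto
  next
    case False
    then obtain P where P: "degree P < m" "\<And>k. k < m \<Longrightarrow> poly ((pderiv ^^ k) P) a = l k" using Suc.IH by auto
    \<comment> \<open>A multiple of this power corrects the derivative of order \<open>m\<close> at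
      \<open>a\<close> and leaves the lower ones unchanged.\<close>
    define W where "W = [:- a, 1:] ^ m"
    have W_low: "poly ((pderiv ^^ k) W) a = 0" if "k < m" for k
      using poly_higher_pderiv_root[of a m W k] that by (simp add: W_def)
    have degW: "degree W = m" by (simp add: W_def degree_linear_power)
    have "degree ((pderiv ^^ m) W) = 0" by (simp add: degree_higher_pderiv degW)
    moreover have "coeff ((pderiv ^^ m) W) 0 = fact m"
      using lead_coeff_power[of "[:- a, 1:]" m] degW
      by (simp add: coeff_higher_pderiv pochhammer_fact W_def)
    ultimately have W_top: "poly ((pderiv ^^ m) W) a = fact m"
      by (metis degree_eq_zeroE coeff_pCons_0 poly_pCons poly_0 mult_zero_right add_0_right)
    define P' where "P' = P + smult ((l m - poly ((pderiv ^^ m) P) a) / fact m) W"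
    have "degree P' \<le> m" unfolding P'_def using P(1) degW
      by (intro degree_add_le order_trans[OF degree_smult_le]) auto
    moreover have "poly ((pderiv ^^ k) P') a = l k" if "k < Suc m" for k
      using that P(2)[of k] W_low[of k] W_top
      by (cases "k = m") (auto simp: P'_def higher_pderiv_add higher_pderiv_smult)
    ultimately show ?thesis by (intro exI[of _ P']) auto
  qed
qed simp

text \<open>The summand one stands for the given jet and the other for the cut-off Taylor
  polynomial, composed as in \<open>C3\<close>; \<open>d\<close> is the length on which the Sobolev
  inequality is applied.\<close>

definition C5 :: "nat \<Rightarrow> real \<Rightarrow> real \<Rightarrow> real" where
  "C5 m K d = 2 * (1 + 2 ^ m * K * real m * 4 * (2 * real m / d))"

text \<open>At a finite end of its domain a jet is continued by its Taylor polynomial, cut off over a unit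
  interval.\<close>

lemma left_extension:
  fixes M :: ennreal
  assumes J: "jets_on m (V \<inter> {\<alpha><..}) X G" and V: "open V" "\<And>x z. x \<in> V \<Longrightarrow> z \<le> x \<Longrightarrow> z \<in> V"
    and d: "0 < d" "d \<le> 1" "\<alpha> + d \<in> V" and p: "1 < p" and m: "m > 0" and S: "step_jet (Suc m) S K"
    and M: "M < top" "\<And>k. k \<le> m \<Longrightarrow> (\<integral>\<^sup>+t. ennreal (\<bar>G k t\<bar> powr p) \<partial>lebesgue) \<le> M"
  shows "\<exists>G'. jets_on m V (insert \<alpha> X) G' \<and> (\<forall>k. \<forall>x>\<alpha>. G' k x = G k x) \<and>
    (\<forall>k\<le>m. (\<integral>\<^sup>+t. ennreal (\<bar>G' k t\<bar> powr p) \<partial>lebesgue) \<le> ennreal (C5 m K d powr p) * M)"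
proof -
  have [measurable]: "{a..b} \<in> sets lebesgue" for a b :: real by simp
  have meas[measurable]: "G k \<in> borel_measurable borel" if "k \<le> m" for k using J that by (simp add: jets_on_def)
  have meas': "G k \<in> borel_measurable lebesgue" if "k \<le> m" for k using jets_on_measurable_lebesgue[OF J that] .
  have V_sub: "x \<in> V" if "x \<le> \<alpha> + d" for x using V(2)[OF d(3) that] .
  have X: "finite X" using J by (simp add: jets_on_def)
  have der: "(G k has_real_derivative G (Suc k) x) (at x)" if "k < m" "x \<in> V" "x > \<alpha>" "x \<notin> X" for k x
    using J that by (simp add: jets_on_def)
  have cont: "continuous_on (V \<inter> {\<alpha><..}) (G k)" if "k < m" for k using J that by (simp add: jets_on_def)
  \<comment> \<open>On a bounded interval
    \<open>\<bar>G k\<bar> \<le> 1 + \<bar>G k\<bar> powr p\<close> makes the jet integrable up to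
    the end point.\<close>
  have integ: "G k integrable_on {\<alpha>..\<alpha> + d}" if k: "k \<le> m" for k
  proof -
    have "set_integrable lebesgue {\<alpha>..\<alpha> + d} (G k)"
      unfolding set_integrable_def
    proof (rule integrableI_bounded)
      show "(\<lambda>x. indicator {\<alpha>..\<alpha> + d} x *\<^sub>R G k x) \<in> borel_measurable lebesgue"
        using meas'[OF k] by measurable
      have "(\<integral>\<^sup>+x. ennreal (norm (indicator {\<alpha>..\<alpha> + d} x *\<^sub>R G k x)) \<partial>lebesgue)
        \<le> (\<integral>\<^sup>+x. indicator {\<alpha>..\<alpha> + d} x + ennreal (\<bar>G k x\<bar> powr p) \<partial>lebesgue)"
      proof (rule nn_integral_mono)
        fix x
        have "\<bar>G k x\<bar> \<le> 1 + \<bar>G k x\<bar> powr p" using abs_le_cutoff_powr[of 1 p "G k x"] p by simp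
        then show "ennreal (norm (indicator {\<alpha>..\<alpha> + d} x *\<^sub>R G k x)) \<le> indicator {\<alpha>..\<alpha> + d} x + ennreal (\<bar>G k x\<bar> powr p)"
          by (auto simp: indicator_def ennreal_1[symmetric] ennreal_plus[symmetric] simp del: ennreal_plus ennreal_1 intro: ennreal_leI)
      qed
      also have "\<dots> = ennreal d + (\<integral>\<^sup>+x. ennreal (\<bar>G k x\<bar> powr p) \<partial>lebesgue)"
        using meas'[OF k] d by (subst nn_integral_add) auto
      also have "\<dots> < \<infinity>" using M(1) M(2)[OF k] by (auto intro: le_less_trans)
      finally show "(\<integral>\<^sup>+x. ennreal (norm (indicator {\<alpha>..\<alpha> + d} x *\<^sub>R G k x)) \<partial>lebesgue) < \<infinity>" .
    qed
    then show ?thesis by (rule set_lebesgue_integral_eq_integral(1))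
  qed
  \<comment> \<open>Continues \<open>G k\<close> to \<open>\<alpha>\<close> continuously; the values
    there are the one-sided jet \<open>l\<close>.\<close>
  define g where "g k s = G k (\<alpha> + d) - integral {s..\<alpha> + d} (G (Suc k))" for k s
  have g_cont: "continuous_on {\<alpha>..\<alpha> + d} (g k)" if "k < m" for k
    unfolding g_def using that by (intro continuous_intros indefinite_integral_continuous_1' integ) auto
  have g_eq: "g k s = G k s" if "k < m" "s \<in> {\<alpha><..\<alpha> + d}" for k s
  proof -
    have "(G (Suc k) has_integral G k (\<alpha> + d) - G k s) {s..\<alpha> + d}"
      using that V_sub by (intro jets_on_has_integral[OF J]) auto
    then show ?thesis by (simp add: g_def integral_unique)
  qed
  define l where "l k = g k \<alpha>" for k
  obtain P where P: "degree P < m" "\<And>k. k < m \<Longrightarrow> poly ((pderiv ^^ k) P) \<alpha> = l k"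
    using ex_poly_with_jet[OF m, of \<alpha> l] by blast
  \<comment> \<open>The step rises from zero at \<open>\<alpha> - 1\<close> to one at
    \<open>\<alpha>\<close>, where its jet is that of the constant one.\<close>
  define B where "B = leib (\<lambda>r x. poly ((pderiv ^^ r) P) x) (\<lambda>r x. S r (x - (\<alpha> - 1)))"
  have S': "K \<ge> 1" "\<And>k t. k \<le> m \<Longrightarrow> (S k has_real_derivative S (Suc k) t) (at t)"
    "\<And>k t. \<lbrakk>k \<le> m; t \<le> 0\<rbrakk> \<Longrightarrow> S k t = 0" "\<And>k t. \<lbrakk>k \<le> m; t \<ge> 1\<rbrakk> \<Longrightarrow> S k t = (if k = 0 then 1 else 0)"
    "\<And>k t. k \<le> m \<Longrightarrow> \<bar>S k t\<bar> \<le> K"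
    using S unfolding step_jet_def by auto
  have B_der: "(B k has_real_derivative B (Suc k) x) (at x)" if "k \<le> m" for k x
    unfolding B_def
  proof (intro DERIV_leib DERIV_higher_pderiv)
    fix r assume "r \<le> k"
    then have "(S r has_real_derivative S (Suc r) (x + (1 - \<alpha>))) (at (x + (1 - \<alpha>)))" using that S'(2)[of r] by simp
    then have "((\<lambda>x. S r (x + (1 - \<alpha>))) has_real_derivative S (Suc r) (x + (1 - \<alpha>))) (at x)"
      unfolding DERIV_shift .
    then show "((\<lambda>x. S r (x - (\<alpha> - 1))) has_real_derivative S (Suc r) (x - (\<alpha> - 1))) (at x)"
      by (simp add: algebra_simps)
  qed
  have B_cont: "continuous_on T (B k)" if "k \<le> m" for k T
    using B_der[OF that] by (intro continuous_at_imp_continuous_on ballI) (auto intro: DERIV_isCont)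
  have B_end: "B k \<alpha> = l k" if "k < m" for k
    unfolding B_def using that S'(4) P(2) by (subst leib_unit) auto
  define T where "T = (\<Sum>r<m. \<bar>l r\<bar>)"
  have T: "T \<ge> 0" by (simp add: T_def sum_nonneg)
  have B_le: "\<bar>B k x\<bar> \<le> 2 ^ m * K * T * indicator {\<alpha> - 1..\<alpha>} x" if "k \<le> m" "x \<le> \<alpha>" for k x
  proof (cases "x \<ge> \<alpha> - 1")
    case True
    have "\<bar>B k x\<bar> \<le> 2 ^ k * (T * K) / 1 ^ k"
      unfolding B_def
    proof (rule abs_leib_le)
      show "\<bar>poly ((pderiv ^^ r) P) x\<bar> \<le> T / 1 ^ r" for r
        using abs_higher_pderiv_taylor_le[OF P(1), of x \<alpha> r] P(2) True that(2) by (simp add: T_def)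
    qed (use S'(5) that T in auto)
    also have "\<dots> \<le> 2 ^ m * (T * K)"
      using that T S'(1) by (simp add: mult_right_mono)
    finally show ?thesis using True that(2) by (simp add: mult_ac)
  next
    case False
    then have "B k x = 0" unfolding B_def using that S'(3) by (intro leib_zero) auto
    then show ?thesis using False by simp
  qed
  define G' where "G' k x = (if x \<le> \<alpha> then B k x else G k x)" for k x
  have G'_meas: "G' k \<in> borel_measurable borel" if "k \<le> m" for k
  proof -
    have [measurable]: "B k \<in> borel_measurable borel" by (rule borel_measurable_continuous_onI[OF B_cont[OF that]])
    show ?thesis unfolding G'_def using that by measurable
  qed
  have G'_isCont: "isCont (G' k) x" if k: "k < m" and x: "x \<in> V" for k x
  proof -
    consider "x < \<alpha>" | "x = \<alpha>" | "x > \<alpha>" by linarith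
    then show ?thesis
    proof cases
      case 1
      have "isCont (B k) x" using B_der[of k x] k by (auto intro: DERIV_isCont)
      moreover have "\<forall>\<^sub>F t in nhds x. B k t = G' k t"
        by (rule eventually_nhds_in_open[of "{..<\<alpha>}", THEN eventually_mono]) (use 1 in \<open>auto simp: G'_def\<close>)
      ultimately show ?thesis by (subst (asm) isCont_cong) auto
    next
      case 2
      have "continuous_on {\<alpha> - 1..\<alpha> + d} (\<lambda>t. if t \<le> \<alpha> then B k t else g k t)"
      proof (rule continuous_on_cases_le)
        show "continuous_on {t \<in> {\<alpha> - 1..\<alpha> + d}. \<alpha> \<le> t} (g k)"
          by (rule continuous_on_subset[OF g_cont[OF k]]) auto
      qed (use k B_end in \<open>auto intro: B_cont simp: l_def continuous_intros\<close>)
      then have "isCont (\<lambda>t. if t \<le> \<alpha> then B k t else g k t) \<alpha>"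
        by (rule continuous_on_interior) (use d in \<open>auto simp: interior_atLeastAtMost_real\<close>)
      moreover have "\<forall>\<^sub>F t in nhds \<alpha>. (if t \<le> \<alpha> then B k t else g k t) = G' k t"
        by (rule eventually_nhds_in_open[of "{..<\<alpha> + d}", THEN eventually_mono])
          (use d k g_eq in \<open>auto simp: G'_def\<close>)
      ultimately show ?thesis unfolding 2 by (subst (asm) isCont_cong) auto
    next
      case 3
      have op: "open (V \<inter> {\<alpha><..})" using V(1) by auto
      have "isCont (G k) x" using cont[OF k] op 3 x by (simp add: continuous_on_eq_continuous_at)
      moreover have "\<forall>\<^sub>F t in nhds x. G k t = G' k t"
        by (rule eventually_nhds_in_open[of "{\<alpha><..}", THEN eventually_mono]) (use 3 in \<open>auto simp: G'_def\<close>)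
      ultimately show ?thesis by (subst (asm) isCont_cong) auto
    qed
  qed
  have J': "jets_on m V (insert \<alpha> X) G'"
    unfolding jets_on_def
  proof (intro conjI allI impI ballI V(1) G'_meas)
    show "finite (insert \<alpha> X)" using X by simp
    show "continuous_on V (G' k)" if "k < m" for k
      using G'_isCont[OF that] by (intro continuous_at_imp_continuous_on) auto
    fix k x assume k: "k < m" and x: "x \<in> V - insert \<alpha> X"
    show "(G' k has_real_derivative G' (Suc k) x) (at x)"
    proof (cases "x < \<alpha>")
      case True
      have "(G' k has_real_derivative B (Suc k) x) (at x)"
        by (rule has_field_derivative_transform_within_open[OF B_der, of _ "{..<\<alpha>}"]) (use k True in \<open>auto simp: G'_def\<close>)
      then show ?thesis using True by (simp add: G'_def)
    next
      case False
      then have "x > \<alpha>" using x by auto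
      have "(G' k has_real_derivative G (Suc k) x) (at x)"
        by (rule has_field_derivative_transform_within_open[OF der, of _ _ "{\<alpha><..}"])
          (use k x \<open>x > \<alpha>\<close> in \<open>auto simp: G'_def\<close>)
      then show ?thesis using \<open>x > \<alpha>\<close> by (simp add: G'_def)
    qed
  qed
  \<comment> \<open>The Sobolev inequality is applied to \<open>G'\<close>, which attains the limit
    \<open>l r\<close> at the end point \<open>\<alpha>\<close>; on the open interval it is still
    \<open>G\<close>.\<close>
  have l_le: "ennreal (\<bar>l r\<bar> powr p) \<le> ennreal (4 powr p * (2 / d)) * M" if r: "r < m" for r
  proof -
    have G'l: "G' r \<alpha> = l r" using B_end[OF r] by (simp add: G'_def)
    have half_open: "(\<integral>\<^sup>+t\<in>{\<alpha>..\<alpha> + d}. ennreal (\<bar>G' i t\<bar> powr p) \<partial>lebesgue) \<le> M" if "i \<le> m" for i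
    proof -
      have "(\<integral>\<^sup>+t\<in>{\<alpha>..\<alpha> + d}. ennreal (\<bar>G' i t\<bar> powr p) \<partial>lebesgue) \<le> (\<integral>\<^sup>+t. ennreal (\<bar>G i t\<bar> powr p) \<partial>lebesgue)"
        unfolding nn_integral_closed_eq_open_interval
        by (intro nn_integral_mono) (auto simp: indicator_def G'_def)
      then show ?thesis using M(2)[OF that] by simp
    qed
    have "ennreal ((\<alpha> + d - \<alpha>) * \<bar>G' r \<alpha>\<bar> powr p) \<le> ennreal (4 powr p) *
      ((\<integral>\<^sup>+t\<in>{\<alpha>..\<alpha> + d}. ennreal (\<bar>G' r t\<bar> powr p) \<partial>lebesgue) + (\<integral>\<^sup>+t\<in>{\<alpha>..\<alpha> + d}. ennreal (\<bar>G' (Suc r) t\<bar> powr p) \<partial>lebesgue))"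
    proof (rule local_sobolev[OF p])
      fix t assume t: "t \<in> {\<alpha>..\<alpha> + d}"
      have "(G' (Suc r) has_integral G' r t - G' r \<alpha>) {\<alpha>..t}"
        using t V_sub r by (intro jets_on_has_integral[OF J']) auto
      then have "ennreal \<bar>G' r t - G' r \<alpha>\<bar> \<le> (\<integral>\<^sup>+t\<in>{\<alpha>..t}. ennreal \<bar>G' (Suc r) t\<bar> \<partial>lebesgue)"
        using r by (intro has_integral_abs_le_nn_integral jets_on_measurable_lebesgue[OF J']) auto
      also have "\<dots> \<le> (\<integral>\<^sup>+t\<in>{\<alpha>..\<alpha> + d}. ennreal \<bar>G' (Suc r) t\<bar> \<partial>lebesgue)"
        using t by (intro nn_integral_mono) (auto simp: indicator_def)
      finally show "ennreal \<bar>G' r \<alpha> - G' r t\<bar> \<le> (\<integral>\<^sup>+t\<in>{\<alpha>..\<alpha> + d}. ennreal \<bar>G' (Suc r) t\<bar> \<partial>lebesgue)"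
        by (simp add: abs_minus_commute)
    qed (use d r in \<open>auto intro: jets_on_measurable_lebesgue[OF J']\<close>)
    also have "\<dots> \<le> ennreal (4 powr p) * (M + M)"
      using r by (intro mult_left_mono add_mono half_open) auto
    also have "M + M = ennreal 2 * M" by (metis distrib_right ennreal_numeral mult_1 one_add_one zero_le_numeral)
    finally have *: "ennreal (d * \<bar>l r\<bar> powr p) \<le> ennreal (4 powr p) * (ennreal 2 * M)" by (simp add: G'l)
    have "ennreal (\<bar>l r\<bar> powr p) = ennreal (1 / d) * ennreal (d * \<bar>l r\<bar> powr p)"
      using d by (simp add: ennreal_mult[symmetric])
    also have "\<dots> \<le> ennreal (1 / d) * (ennreal (4 powr p) * (ennreal 2 * M))"
      by (intro mult_left_mono *) simp
    also have "\<dots> = ennreal (1 / d * (4 powr p * 2)) * M"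
    proof -
      have "ennreal (1 / d * (4 powr p * 2)) = ennreal (1 / d) * ennreal (4 powr p * 2)"
        using d by (intro ennreal_mult) auto
      also have "ennreal (4 powr p * 2) = ennreal (4 powr p) * ennreal 2" by (intro ennreal_mult) auto
      finally show ?thesis by (simp only: mult.assoc)
    qed
    finally show ?thesis by (simp add: mult_ac)
  qed
  define D where "D = 2 ^ m * K * real m * 4 * (2 * real m / d)"
  have K: "K \<ge> 1" by (rule S')
  have D: "D \<ge> 0" using d K by (simp add: D_def)
  have T_le: "ennreal ((2 ^ m * K * T) powr p) \<le> ennreal (D powr p) * M"
  proof -
    define Y where "Y = 4 powr p * (2 / d)"
    have Y: "Y \<ge> 0" using d by (simp add: Y_def)
    define Z where "Z = (2 ^ m * K) powr p * real m powr p"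
    have Z: "Z \<ge> 0" by (simp add: Z_def)
    have "(2 ^ m * K * T) powr p = (2 ^ m * K) powr p * T powr p" using T K by (simp add: powr_mult)
    also have "\<dots> \<le> (2 ^ m * K) powr p * (real (card {..<m}) powr p * (\<Sum>r<m. \<bar>l r\<bar> powr p))"
      unfolding T_def using p by (intro mult_left_mono powr_sum_le) auto
    finally have "ennreal ((2 ^ m * K * T) powr p) \<le> ennreal Z * (\<Sum>r<m. ennreal (\<bar>l r\<bar> powr p))"
      using Z by (simp add: Z_def ennreal_mult[symmetric] sum_nonneg mult.assoc ennreal_leI)
    also have "\<dots> \<le> ennreal Z * (\<Sum>r<m. ennreal Y * M)"
      unfolding Y_def by (intro mult_left_mono sum_mono l_le) auto
    also have "\<dots> = ennreal (Z * (real m * Y)) * M"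
      using Y Z by (simp add: ennreal_mult ennreal_of_nat_eq_real_of_nat mult.assoc)
    also have "\<dots> \<le> ennreal (D powr p) * M"
    proof (intro mult_right_mono ennreal_leI)
      have "d \<le> real m" using d m by linarith
      then have "1 \<le> 2 * real m / d" using d by simp
      then have "(2 * real m / d) powr 1 \<le> (2 * real m / d) powr p" using p by (intro powr_mono) auto
      then have "2 * real m / d \<le> (2 * real m / d) powr p" using d by simp
      then have "Z * 4 powr p * (2 * real m / d) \<le> Z * 4 powr p * (2 * real m / d) powr p"
        using Z by (intro mult_left_mono) auto
      also have "\<dots> = D powr p"
      proof -
        have "(2 ^ m * K * real m * 4 * E) powr p = (2 ^ m * K) powr p * real m powr p * 4 powr p * E powr p" if "E \<ge> 0" for E
          using K that by (simp add: powr_mult)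
        from this[of "2 * real m / d"] show ?thesis unfolding D_def Z_def using d by simp
      qed
      finally show "Z * (real m * Y) \<le> D powr p" by (simp add: Y_def mult_ac)
    qed simp
    finally show ?thesis .
  qed
  have bound: "(\<integral>\<^sup>+t. ennreal (\<bar>G' k t\<bar> powr p) \<partial>lebesgue) \<le> ennreal (C5 m K d powr p) * M" if k: "k \<le> m" for k
  proof -
    have "(\<integral>\<^sup>+t. ennreal (\<bar>G' k t\<bar> powr p) \<partial>lebesgue) \<le>
      (\<integral>\<^sup>+t. ennreal (\<bar>G k t\<bar> powr p) + ennreal ((2 ^ m * K * T) powr p) * indicator {\<alpha> - 1..\<alpha>} t \<partial>lebesgue)"
    proof (rule nn_integral_mono)
      fix t
      show "ennreal (\<bar>G' k t\<bar> powr p) \<le> ennreal (\<bar>G k t\<bar> powr p) + ennreal ((2 ^ m * K * T) powr p) * indicator {\<alpha> - 1..\<alpha>} t"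
      proof (cases "t \<le> \<alpha>")
        case True
        have "\<bar>B k t\<bar> powr p \<le> (2 ^ m * K * T * indicator {\<alpha> - 1..\<alpha>} t) powr p"
          using B_le[OF k True] p by (intro powr_mono2) auto
        also have "\<dots> = (2 ^ m * K * T) powr p * indicator {\<alpha> - 1..\<alpha>} t" by (auto simp: indicator_def)
        finally have "ennreal (\<bar>B k t\<bar> powr p) \<le> ennreal ((2 ^ m * K * T) powr p) * indicator {\<alpha> - 1..\<alpha>} t"
          by (auto simp: indicator_def ennreal_leI)
        then show ?thesis using True by (simp add: G'_def add_increasing)
      qed (simp add: G'_def)
    qed
    also have "\<dots> = (\<integral>\<^sup>+t. ennreal (\<bar>G k t\<bar> powr p) \<partial>lebesgue) + ennreal ((2 ^ m * K * T) powr p)"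
      using meas'[OF k] by (subst nn_integral_add) (auto simp: nn_integral_cmult_indicator)
    also have "\<dots> \<le> M + ennreal (D powr p) * M" by (intro add_mono M(2) k T_le)
    also have "\<dots> = ennreal (1 + D powr p) * M" by (simp add: ennreal_plus distrib_right)
    also have "\<dots> \<le> ennreal (C5 m K d powr p) * M"
    proof (intro mult_right_mono ennreal_leI)
      have "1 + D powr p \<le> 2 * (1 + D) powr p"
        using D p powr_mono2[of p 1 "1 + D"] powr_mono2[of p D "1 + D"] by simp
      also have "\<dots> \<le> 2 powr p * (1 + D) powr p"
        using p powr_mono[of 1 p 2] by (intro mult_right_mono) auto
      finally have "1 + D powr p \<le> 2 powr p * (1 + D) powr p" .
      then have "1 + D powr p \<le> (2 * (1 + D)) powr p" using D by (subst powr_mult) auto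
      then show "1 + D powr p \<le> C5 m K d powr p" by (simp add: C5_def D_def)
    qed simp
    finally show ?thesis .
  qed
  show ?thesis
    using J' bound by (intro exI[of _ G'] conjI) (auto simp: G'_def)
qed

text \<open>The jet of the mirror image of \<open>G 0\<close>. It turns a right end into a left one,
  so a single continuation lemma serves both.\<close>

definition reflect :: "(nat \<Rightarrow> real \<Rightarrow> real) \<Rightarrow> nat \<Rightarrow> real \<Rightarrow> real" where
  "reflect G k x = (- 1) ^ k * G k (- x)"

lemma jets_on_reflect:
  assumes J: "jets_on m R X G"
  shows "jets_on m (uminus ` R) (uminus ` X) (reflect G)"
  unfolding jets_on_def
proof (intro conjI allI impI ballI)
  show "open (uminus ` R)" using J by (auto simp: jets_on_def intro: open_negations)
  show "finite (uminus ` X)" using J by (simp add: jets_on_def)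
  show "continuous_on (uminus ` R) (reflect G k)" if "k < m" for k
  proof -
    have "continuous_on R (G k)" using J that by (simp add: jets_on_def)
    then have "continuous_on (uminus ` R) (\<lambda>x. G k (- x))"
      by (rule continuous_on_compose2) (auto intro: continuous_on_minus continuous_on_id)
    then show ?thesis unfolding reflect_def by (intro continuous_on_mult continuous_on_const)
  qed
  show "reflect G k \<in> borel_measurable borel" if "k \<le> m" for k
  proof -
    have [measurable]: "G k \<in> borel_measurable borel" using J that by (simp add: jets_on_def)
    show ?thesis unfolding reflect_def by measurable
  qed
  fix k x assume k: "k < m" and x: "x \<in> uminus ` R - uminus ` X"
  then have "(G k has_real_derivative G (Suc k) (- x)) (at (- x))" using J by (force simp: jets_on_def)
  then have "((\<lambda>x. G k (- x)) has_real_derivative G (Suc k) (- x) * (- 1)) (at x)"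
    by (rule DERIV_chain2) (auto intro!: derivative_eq_intros)
  then have "((\<lambda>x. (- 1) ^ k * G k (- x)) has_real_derivative (- 1) ^ k * (G (Suc k) (- x) * (- 1))) (at x)"
    by (rule DERIV_cmult)
  then show "(reflect G k has_real_derivative reflect G (Suc k) x) (at x)"
    by (simp add: reflect_def[abs_def])
qed

lemma nn_integral_reflect:
  assumes [measurable]: "G k \<in> borel_measurable borel"
  shows "(\<integral>\<^sup>+t. ennreal (\<bar>reflect G k t\<bar> powr p) \<partial>lebesgue) = (\<integral>\<^sup>+t. ennreal (\<bar>G k t\<bar> powr p) \<partial>lebesgue)"
proof -
  have "(\<integral>\<^sup>+t. ennreal (\<bar>reflect G k t\<bar> powr p) \<partial>lebesgue) = (\<integral>\<^sup>+t. ennreal (\<bar>G k (- t)\<bar> powr p) \<partial>lebesgue)"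
    by (intro nn_integral_cong) (simp add: reflect_def abs_mult power_abs)
  also have "\<dots> = (\<integral>\<^sup>+t. ennreal (\<bar>G k (- t)\<bar> powr p) \<partial>lborel)" by (rule nn_integral_completion)
  also have "\<dots> = (\<integral>\<^sup>+t. ennreal (\<bar>G k t\<bar> powr p) \<partial>lborel)"
    using nn_integral_real_affine[of "\<lambda>t. ennreal (\<bar>G k t\<bar> powr p)" "- 1" 0] by simp
  also have "\<dots> = (\<integral>\<^sup>+t. ennreal (\<bar>G k t\<bar> powr p) \<partial>lebesgue)" by (rule nn_integral_completion[symmetric])
  finally show ?thesis .
qed

section \<open>Sufficiency\<close>

context sobolev_spline
begin

lemma jets_on_G: "jets_on m U {} G"
  unfolding jets_on_def
proof (intro conjI allI impI ballI open_U measurable_G)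
  fix k assume "k < m"
  then show "continuous_on U (G k)"
    by (intro continuous_at_imp_continuous_on ballI DERIV_isCont[OF DERIV_G]) auto
qed (auto intro: DERIV_G)

lemma C4_nonneg: "c' > 0 \<Longrightarrow> C4 c' \<ge> 0"
  using C1_nonneg C2_nonneg by (simp add: C4_def C3_def)

lemma C5_ge_one: "d > 0 \<Longrightarrow> C5 m K d \<ge> 1"
  using step_props(1) by (simp add: C5_def)

lemma U_eq: "U = {x. (\<exists>i. y i < x) \<and> (\<exists>j. x < y j)}"
proof safe
  fix x assume "x \<in> U"
  then obtain i j where ij: "y i \<le> x" "x < y j" unfolding U_iff by blast
  have "y (i - 1) < y i" using strict_monoD[OF y_mono, of "i - 1" i] by simp
  then show "\<exists>i. y i < x" "\<exists>j. x < y j" using ij by (auto intro: less_le_trans)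
qed (auto simp: U_iff intro: less_imp_le)

text \<open>If the knots tend to \<open>\<beta>\<close>, the gaps from some \<open>y n\<close> on
  are too short to be big, so all big gaps end at or before \<open>y n < \<beta>\<close> and a
  common margin exists, depending on the sequence. Without an upper bound \<open>c / 2\<close>
  always fits.\<close>

lemma ex_gap_margin:
  obtains c' where "0 < c'" "c' < c" "\<And>j. big j \<Longrightarrow> y (j + 1) + c' \<in> U"
    "\<not> bdd_above (range y) \<Longrightarrow> c' = c / 2"
proof (cases "bdd_above (range y)")
  case False
  show thesis
  proof (rule that[of "c / 2"])
    show "y (j + 1) + c / 2 \<in> U" for j
    proof -
      obtain i where "y (j + 1) + c / 2 < y i" using False by (force simp: bdd_above_def not_le)
      then show ?thesis unfolding U_iff using c_pos by (intro exI[of _ "j + 1"] exI[of _ i]) auto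
    qed
  qed (use c_pos in auto)
next
  case True
  define \<beta> where "\<beta> = Sup (range y)"
  have le: "y i \<le> \<beta>" for i unfolding \<beta>_def using True by (intro cSup_upper) auto
  have below: "\<exists>i. t < y i" if "t < \<beta>" for t
    using less_cSup_iff[OF _ True, of t] that by (auto simp: \<beta>_def)
  obtain n where n: "\<beta> - 2 * c < y n" using below[of "\<beta> - 2 * c"] c_pos by auto
  have "y n < y (n + 1)" using strict_monoD[OF y_mono, of n "n + 1"] by simp
  then have "y n < \<beta>" using le[of "n + 1"] by simp
  define c' where "c' = min (c / 2) ((\<beta> - y n) / 2)"
  show thesis
  proof (rule that[of c'])
    fix j assume "big j"
    have "j < n"
    proof (rule ccontr)
      assume "\<not> j < n"
      then have "y n \<le> y j" by (simp add: strict_mono_less_eq[OF y_mono])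
      then show False using n le[of "j + 1"] \<open>big j\<close> by (auto simp: big_def gap_def)
    qed
    then have "y (j + 1) \<le> y n" by (simp add: strict_mono_less_eq[OF y_mono])
    then have "y (j + 1) + c' < \<beta>" using \<open>y n < \<beta>\<close> by (auto simp: c'_def min_def field_simps)
    then obtain i where "y (j + 1) + c' < y i" using below by blast
    then show "y (j + 1) + c' \<in> U" unfolding U_iff
      using c_pos \<open>y n < \<beta>\<close> by (intro exI[of _ "j + 1"] exI[of _ i]) (auto simp: c'_def)
  qed (use c_pos \<open>y n < \<beta>\<close> True in \<open>auto simp: c'_def\<close>)
qed

lemma ex_left_closed_jets:
  assumes p: "1 < p" and fin: "energy p < \<infinity>"
  defines "V \<equiv> {x. \<exists>j. x < y j}"
  shows "\<exists>G' X M. jets_on m V X G' \<and> (\<forall>j. G' 0 (y j) = v j) \<and> M < top \<and>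
    (\<forall>k\<le>m. (\<integral>\<^sup>+t. ennreal (\<bar>G' k t\<bar> powr p) \<partial>lebesgue) \<le> M) \<and>
    (\<not> bdd_above (range y) \<longrightarrow> M \<le> ennreal ((C5 m K 1 * C4 (c / 2)) powr p) * energy p)"
proof -
  obtain c' where c': "0 < c'" "c' < c" "\<And>j. big j \<Longrightarrow> y (j + 1) + c' \<in> U"
    "\<not> bdd_above (range y) \<Longrightarrow> c' = c / 2" by (rule ex_gap_margin) blast
  define M where "M = ennreal (C4 c' powr p) * energy p"
  have M: "M < top" using fin by (simp add: M_def ennreal_mult_less_top)
  have G_le: "(\<integral>\<^sup>+t. ennreal (\<bar>G k t\<bar> powr p) \<partial>lebesgue) \<le> M" if "k \<le> m" for k
    unfolding M_def by (rule nn_integral_powr_G_le[OF c'(1-3) that p])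
  have scaled: "ennreal (C5 m K d powr p) * M \<le> ennreal ((C5 m K 1 * C4 (c / 2)) powr p) * energy p"
    if "\<not> bdd_above (range y)" "d = 1" for d
    using C4_nonneg[of "c / 2"] C5_ge_one[of 1] c_pos
    unfolding M_def c'(4)[OF that(1)] that(2) by (simp add: powr_mult ennreal_mult mult.assoc)
  show ?thesis
  proof (cases "bdd_below (range y)")
    case False
    have "\<exists>i. y i < x" for x using False by (force simp: bdd_below_def not_le)
    then have "U = V" by (auto simp: U_eq V_def)
    have "M \<le> ennreal ((C5 m K 1 * C4 (c / 2)) powr p) * energy p" if "\<not> bdd_above (range y)"
    proof -
      have "1 powr p \<le> C5 m K 1 powr p" using C5_ge_one[of 1] p by (intro powr_mono2) auto
      then have "1 * M \<le> ennreal (C5 m K 1 powr p) * M"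
        by (intro mult_right_mono) (auto simp: ennreal_1[symmetric] simp del: ennreal_1)
      then show ?thesis using scaled[OF that refl] by simp
    qed
    then show ?thesis
      using jets_on_G G_interpolates M G_le unfolding \<open>U = V\<close> by blast
  next
    case True
    define \<alpha> where "\<alpha> = Inf (range y)"
    have le: "\<alpha> \<le> y i" for i unfolding \<alpha>_def using True by (intro cInf_lower) auto
    have less: "\<alpha> < y i" for i
      using le[of "i - 1"] strict_monoD[OF y_mono, of "i - 1" i] by simp
    have above: "(\<exists>i. y i < t) \<longleftrightarrow> \<alpha> < t" for t
      using cInf_less_iff[OF _ True, of t] by (auto simp: \<alpha>_def)
    have UV: "U = V \<inter> {\<alpha><..}" by (auto simp: U_eq V_def above)
    \<comment> \<open>Without an upper bound the whole unit interval to the right of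
      \<open>\<alpha>\<close> lies in the domain; taking \<open>d = 1\<close> keeps the constant
      dependent on \<open>m\<close> only.\<close>
    define d where "d = (if bdd_above (range y) then min 1 ((y 0 - \<alpha>) / 2) else 1)"
    have d: "0 < d" "d \<le> 1" using less[of 0] by (auto simp: d_def)
    have dV: "\<alpha> + d \<in> V"
    proof (cases "bdd_above (range y)")
      case True
      then have "\<alpha> + d < y 0" using less[of 0] by (auto simp: d_def min_def field_simps)
      then show ?thesis by (auto simp: V_def)
    next
      case False
      then show ?thesis unfolding V_def by (force simp: bdd_above_def not_le)
    qed
    have "V = (\<Union>j. {..<y j})" by (auto simp: V_def)
    then have "open V" by (simp add: open_UN)
    moreover have "z \<in> V" if "x \<in> V" "z \<le> x" for x z using that by (auto simp: V_def intro: le_less_trans)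
    ultimately obtain G' where G': "jets_on m V (insert \<alpha> {}) G'" "\<forall>k. \<forall>x>\<alpha>. G' k x = G k x"
      "\<forall>k\<le>m. (\<integral>\<^sup>+t. ennreal (\<bar>G' k t\<bar> powr p) \<partial>lebesgue) \<le> ennreal (C5 m K d powr p) * M"
      using left_extension[OF jets_on_G[unfolded UV] _ _ d dV p m_pos step M G_le] by blast
    have d1: "d = 1" if "\<not> bdd_above (range y)" using that by (simp add: d_def)
    have fin': "ennreal (C5 m K d powr p) * M < top" using M by (simp add: ennreal_mult_less_top)
    have interp: "\<forall>j. G' 0 (y j) = v j"
    proof
      fix j show "G' 0 (y j) = v j" using G'(2) less[of j] G_interpolates[of j] by simp
    qed
    have "\<not> bdd_above (range y) \<longrightarrow>
        ennreal (C5 m K d powr p) * M \<le> ennreal ((C5 m K 1 * C4 (c / 2)) powr p) * energy p"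
    proof
      assume nb: "\<not> bdd_above (range y)"
      show "ennreal (C5 m K d powr p) * M \<le> ennreal ((C5 m K 1 * C4 (c / 2)) powr p) * energy p"
        by (rule scaled[OF nb d1[OF nb]])
    qed
    then show ?thesis
      by (intro exI[of _ G'] exI[of _ "insert \<alpha> {}"] exI[of _ "ennreal (C5 m K d powr p) * M"] conjI
          G'(1) interp fin' G'(3))
  qed
qed

text \<open>If the knots are bounded above, the margin \<open>c'\<close> and the length
  \<open>d\<close> depend on them, so only membership is claimed in that case.\<close>

proposition ex_sobolev_interpolant:
  assumes p: "1 < p" and fin: "energy p < \<infinity>"
  shows "\<exists>F\<in>sobolev_W m p. (\<forall>j. F (y j) = v j) \<and> (\<not> bdd_above (range y) \<longrightarrow>
    sobolev_W_norm m p F \<le> real (m + 1) * (C5 m K 1 * C4 (c / 2) * enn2real (energy p) powr (1 / p)))"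
proof -
  define V where "V = {x. \<exists>j. x < y j}"
  obtain G' X M where G': "jets_on m V X G'" "\<And>j. G' 0 (y j) = v j" and M: "M < top"
    "\<And>k. k \<le> m \<Longrightarrow> (\<integral>\<^sup>+t. ennreal (\<bar>G' k t\<bar> powr p) \<partial>lebesgue) \<le> M"
    "\<not> bdd_above (range y) \<Longrightarrow> M \<le> ennreal ((C5 m K 1 * C4 (c / 2)) powr p) * energy p"
    using ex_left_closed_jets[OF p fin] unfolding V_def by blast
  show ?thesis
  proof (cases "bdd_above (range y)")
    case False
    have "V = UNIV" using False by (force simp: V_def bdd_above_def not_le)
    define e where "e = enn2real (energy p)"
    define N where "N = C5 m K 1 * C4 (c / 2) * e powr (1 / p)"
    have pos: "0 \<le> C5 m K 1 * C4 (c / 2)" using C5_ge_one[of 1] C4_nonneg[of "c / 2"] c_pos by simp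
    have e: "e \<ge> 0" "energy p = ennreal e" using fin by (auto simp: e_def)
    have "N powr p = (C5 m K 1 * C4 (c / 2)) powr p * e"
      using pos e p unfolding N_def by (simp add: powr_mult[of "C5 m K 1 * C4 (c / 2)"] powr_powr)
    then have "M \<le> ennreal (N powr p)" using M(3)[OF False] e by (simp add: ennreal_mult)
    then have "\<And>k. k \<le> m \<Longrightarrow> (\<integral>\<^sup>+t. ennreal (\<bar>G' k t\<bar> powr p) \<partial>lebesgue) \<le> ennreal (N powr p)"
      using M(2) by (meson order_trans)
    moreover have "N \<ge> 0" using pos by (simp add: N_def)
    ultimately have "G' 0 \<in> sobolev_W m p" "sobolev_W_norm m p (G' 0) \<le> real (m + 1) * N"
      using sobolev_W_of_jets[OF G'(1)[unfolded \<open>V = UNIV\<close>] m_pos p] by blast+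
    then show ?thesis using G'(2) by (auto simp: N_def e_def)
  next
    case True
    define \<beta> where "\<beta> = Sup (range y)"
    have le: "y i \<le> \<beta>" for i unfolding \<beta>_def using True by (intro cSup_upper) auto
    have less: "y i < \<beta>" for i
      using le[of "i + 1"] strict_monoD[OF y_mono, of i "i + 1"] by simp
    have "V = {..<\<beta>}"
      using less_cSup_iff[OF _ True] by (auto simp: V_def \<beta>_def)
    then have "uminus ` V = UNIV \<inter> {- \<beta><..}" by (auto simp: image_iff intro!: bexI[of _ "- _"])
    then have J: "jets_on m (UNIV \<inter> {- \<beta><..}) (uminus ` X) (reflect G')"
      using jets_on_reflect[OF G'(1)] by simp
    have R_le: "(\<integral>\<^sup>+t. ennreal (\<bar>reflect G' k t\<bar> powr p) \<partial>lebesgue) \<le> M" if "k \<le> m" for k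
      using M(2)[OF that] G'(1) that by (subst nn_integral_reflect) (auto simp: jets_on_def)
    obtain H where H: "jets_on m UNIV (insert (- \<beta>) (uminus ` X)) H" "\<forall>k. \<forall>x>- \<beta>. H k x = reflect G' k x"
      "\<forall>k\<le>m. (\<integral>\<^sup>+t. ennreal (\<bar>H k t\<bar> powr p) \<partial>lebesgue) \<le> ennreal (C5 m K 1 powr p) * M"
      using left_extension[OF J open_UNIV _ zero_less_one order_refl _ p m_pos step M(1) R_le] by auto
    define M' where "M' = ennreal (C5 m K 1 powr p) * M"
    have "M' < top" using M(1) by (simp add: M'_def ennreal_mult_less_top)
    then obtain e where e: "e \<ge> 0" "M' = ennreal e" by (metis ennreal_cases less_irrefl)
    have JH: "jets_on m UNIV (uminus ` insert (- \<beta>) (uminus ` X)) (reflect H)"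
      using jets_on_reflect[OF H(1)] by (simp add: surj_uminus)
    have "(\<integral>\<^sup>+t. ennreal (\<bar>reflect H k t\<bar> powr p) \<partial>lebesgue) \<le> ennreal ((e powr (1 / p)) powr p)" if "k \<le> m" for k
    proof -
      have "(\<integral>\<^sup>+t. ennreal (\<bar>reflect H k t\<bar> powr p) \<partial>lebesgue) \<le> M'"
        unfolding M'_def using H(1,3) that by (subst nn_integral_reflect) (auto simp: jets_on_def)
      then show ?thesis using e p by (simp add: powr_powr)
    qed
    then have "reflect H 0 \<in> sobolev_W m p"
      by (rule sobolev_W_of_jets(1)[OF JH m_pos p]) simp_all
    moreover have "reflect H 0 (y j) = v j" for j
      using H(2) less[of j] G'(2)[of j] by (simp add: reflect_def)
    ultimately show ?thesis using True by blast
  qed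
qed

text \<open>Every gap with a new point at one end has length at least one and is big. A window
  without a big gap is therefore inside the index range, or it is a single new point, which carries
  the value zero.\<close>

lemma energy_le_W_sum:
  assumes ext: "seq_extension l1 l2 x y" and x: "strict_mono_on (indices l1 l2 0) x"
    and v: "\<And>i. v i = (if i \<in> indices l1 l2 0 then f (x i) else 0)" and p: "p > 0"
  shows "energy p \<le> W_sum m p l1 l2 x f"
proof -
  define h where "h s i = ennreal (min 1 (y (i + int m) - y i) * \<bar>dd y v s i\<bar> powr p)" for s i
  define h' where "h' s i = (if nobig i s then h s i else 0)" for s i
  have big: "big t" if "\<not> (t \<in> indices l1 l2 0 \<and> t + 1 \<in> indices l1 l2 0)" for t
  proof -
    have "y t + 1 \<le> y (t + 1)" using ext that by (auto simp: seq_extension_def)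
    then show ?thesis using c_le_half by (simp add: big_def gap_def)
  qed
  have zero: "h' s i = 0" if i: "i \<notin> indices l1 l2 s" for s i
  proof (cases "nobig i s")
    case True
    have "s = 0"
    proof (rule ccontr)
      assume "s \<noteq> 0"
      then have "\<not> big i" "\<not> big (i + int s - 1)" using True by (auto simp: nobig_def)
      then have "i \<in> indices l1 l2 0" "i + int s - 1 + 1 \<in> indices l1 l2 0" using big by blast+
      then show False using i indices_iff[of i l1 l2 s] by simp
    qed
    then show ?thesis using i v[of i] p by (simp add: h'_def h_def)
  qed (simp add: h'_def)
  have empty: "h' s i = 0" if "s \<le> m" "\<not> s \<le> m_of m (points l1 l2 x)" for s i
    using zero le_m_of[OF x _ that(1)] that(2) by blast
  have "energy p = (\<Sum>s\<le>m. \<integral>\<^sup>+i. h' s i \<partial>count_space UNIV)"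
    by (simp only: energy_def h'_def h_def weight_def)
  also have "\<dots> = (\<Sum>s\<le>m_of m (points l1 l2 x). \<integral>\<^sup>+i. h' s i \<partial>count_space UNIV)"
    using m_of_le[of m "points l1 l2 x"] empty by (intro sum.mono_neutral_right) auto
  also have "\<dots> \<le> (\<Sum>s\<le>m_of m (points l1 l2 x). \<Sum>\<^sub>\<infinity>i\<in>indices l1 l2 s. h s i)"
  proof (rule sum_mono)
    fix s
    have "(\<integral>\<^sup>+i. h' s i \<partial>count_space UNIV) \<le> (\<Sum>\<^sub>\<infinity>i\<in>indices l1 l2 s. h' s i)"
      by (rule nn_integral_count_space_int_le_infsum[OF zero])
    also have "\<dots> \<le> (\<Sum>\<^sub>\<infinity>i\<in>indices l1 l2 s. h s i)"
      by (intro infsum_mono nonneg_summable_on_complete) (auto simp: h'_def)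
    finally show "(\<integral>\<^sup>+i. h' s i \<partial>count_space UNIV) \<le> (\<Sum>\<^sub>\<infinity>i\<in>indices l1 l2 s. h s i)" .
  qed
  also have "\<dots> = W_sum m p l1 l2 x f"
    unfolding h_def using v by (intro W_sum_eq[OF ext m_pos, symmetric]) simp
  finally show ?thesis .
qed

end

text \<open>For a finite \<open>l2\<close> the new points advance by at least one at each step; for
  \<open>l2 = Pinf\<close> a bound would make the sequence right accumulating.\<close>

lemma seq_extension_unbounded:
  assumes ext: "seq_extension l1 l2 x y" and ne: "indices l1 l2 0 \<noteq> {}" and nr: "\<not> right_accumulating l1 l2 x"
  shows "\<not> bdd_above (range y)"
proof
  assume "bdd_above (range y)"
  then obtain B where B: "\<And>i. y i \<le> B" by (auto simp: bdd_above_def)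
  show False
  proof (cases l2)
    case (Fin b)
    have step: "y t + 1 \<le> y (t + 1)" if "t \<ge> b" for t
    proof -
      have "t + 1 \<notin> indices l1 l2 0" using Fin that by (auto simp: indices_def)
      then show ?thesis using ext by (auto simp: seq_extension_def)
    qed
    have far: "y b + real n \<le> y (b + int n)" for n
    proof (induction n)
      case (Suc n)
      then show ?case using step[of "b + int n"] by (simp add: algebra_simps)
    qed simp
    obtain n :: nat where "real n > B - y b" using reals_Archimedean2 by blast
    then show False using far[of n] B[of "b + int n"] by linarith
  next
    case Pinf
    have "points l1 l2 x \<subseteq> range y" using ext unfolding points_def seq_extension_def by (metis image_subsetI rangeI)
    then have "bdd_above (points l1 l2 x)" by (rule bdd_above_mono[OF \<open>bdd_above (range y)\<close>])
    then show False using nr ne Pinf by (auto simp: right_accumulating_def points_def)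
  next
    case Minf
    then show False using ne by (cases l1) (auto simp: indices_def)
  qed
qed

text \<open>Serves the empty sequence, which occurs for instance if \<open>l1\<close> and
  \<open>l2\<close> are the same infinity.\<close>

lemma zero_in_sobolev_W:
  assumes "m > 0" "1 < p"
  shows "(\<lambda>_. 0) \<in> sobolev_W m p" "sobolev_W_norm m p (\<lambda>_. 0) = 0"
proof -
  have J: "jets_on m UNIV {} (\<lambda>_ _. 0)" by (simp add: jets_on_def)
  have "(\<lambda>_. 0) \<in> sobolev_W m p" "sobolev_W_norm m p (\<lambda>_. 0) \<le> real (m + 1) * 0"
    using sobolev_W_of_jets[OF J assms, of 0] by simp_all
  then show "(\<lambda>_. 0) \<in> sobolev_W m p" "sobolev_W_norm m p (\<lambda>_. 0) = 0"
    using sobolev_W_norm_nonneg[of m p "\<lambda>_. 0"] by auto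
qed

lemma trace_W_norm_le:
  assumes "F \<in> sobolev_W m p" "\<forall>z\<in>E. F z = f z"
  shows "trace_W_norm m p E f \<le> sobolev_W_norm m p F"
  unfolding trace_W_norm_def using assms
  by (intro cInf_lower) (auto intro!: bdd_belowI[of _ 0] simp: sobolev_W_norm_nonneg)

theorem theorem1p3:
  fixes m :: nat
  assumes "m > 0"
  shows "\<exists>C::real. C \<ge> 1 \<and>
    (\<forall>(p::real) (l1::int extended) (l2::int extended) (x::int \<Rightarrow> real) (f::real \<Rightarrow> real).
       1 < p \<longrightarrow> l1 \<le> l2 \<longrightarrow> strict_mono_on (indices l1 l2 0) x \<longrightarrow>
         (f \<in> trace_W m p (points l1 l2 x) \<longleftrightarrow> W_tilde m p l1 l2 x f < top) \<and>
         (f \<in> trace_W m p (points l1 l2 x) \<longrightarrow>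
            W_tilde m p l1 l2 x f \<le> ennreal C * ennreal (trace_W_norm m p (points l1 l2 x) f) \<and>
            (\<not> right_accumulating l1 l2 x \<longrightarrow>
               ennreal (trace_W_norm m p (points l1 l2 x) f) \<le> ennreal C * W_tilde m p l1 l2 x f)))"
proof -
  \<comment> \<open>The step is fixed before \<open>p\<close>, the sequence and \<open>f\<close>, so
    that the constants built from \<open>K\<close> depend on \<open>m\<close> alone.\<close>
  obtain S K where SK: "step_jet (Suc m) S K" using ex_step_jet by blast
  define Ca where "Ca = 4 * real (m + 1) ^ 3"
  define Cb where "Cb = real (m + 1) * (C5 m K 1 * sobolev_spline.C4 m K (sobolev_spline.c m / 2))"
  define C where "C = max Ca Cb"
  have "(1::real) \<le> real (m + 1) ^ 3" by (rule one_le_power) simp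
  then have "Ca \<ge> 1" unfolding Ca_def by linarith
  then have "C \<ge> 1" by (simp add: C_def)
  have main: "(f \<in> trace_W m p (points l1 l2 x) \<longleftrightarrow> W_tilde m p l1 l2 x f < top) \<and>
         (f \<in> trace_W m p (points l1 l2 x) \<longrightarrow>
            W_tilde m p l1 l2 x f \<le> ennreal C * ennreal (trace_W_norm m p (points l1 l2 x) f) \<and>
            (\<not> right_accumulating l1 l2 x \<longrightarrow>
               ennreal (trace_W_norm m p (points l1 l2 x) f) \<le> ennreal C * W_tilde m p l1 l2 x f))"
    if p: "1 < p" and x: "strict_mono_on (indices l1 l2 0) x"
    for p l1 l2 and x :: "int \<Rightarrow> real" and f
  proof (cases "indices l1 l2 0 = {}")
    case True
    have pts: "points l1 l2 x = {}" using True by (simp add: points_def)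
    have "indices l1 l2 k = {}" for k using True indices_iff[of _ l1 l2 k] by blast
    then have "W_sum m p l1 l2 x f = 0" by (simp add: W_sum_def)
    then have W: "W_tilde m p l1 l2 x f = 0" by (simp add: W_tilde_def)
    have "trace_W_norm m p {} f \<le> 0"
      using trace_W_norm_le[OF zero_in_sobolev_W(1)[OF \<open>m > 0\<close> p], of "{}" f] zero_in_sobolev_W(2)[OF \<open>m > 0\<close> p] by simp
    then have "ennreal (trace_W_norm m p {} f) = 0" by (rule ennreal_neg)
    moreover have "f \<in> trace_W m p {}" using zero_in_sobolev_W(1)[OF \<open>m > 0\<close> p] by (auto simp: trace_W_def)
    ultimately show ?thesis by (simp add: W pts)
  next
    case ne: False
    obtain y where ext: "seq_extension l1 l2 x y" using ex_seq_extension[OF ne x] by blast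
    define v where "v i = (if i \<in> indices l1 l2 0 then f (x i) else 0)" for i
    interpret sobolev_spline m y v S K
      using ext SK \<open>m > 0\<close> by unfold_locales (auto simp: seq_extension_def)
    have energy: "energy p \<le> W_sum m p l1 l2 x f"
      using p by (intro energy_le_W_sum[OF ext x]) (auto simp: v_def)
    have upper: "W_tilde m p l1 l2 x f \<le> ennreal C * ennreal (trace_W_norm m p (points l1 l2 x) f)"
      if f: "f \<in> trace_W m p (points l1 l2 x)"
    proof -
      define \<N> where "\<N> = sobolev_W_norm m p ` {F \<in> sobolev_W m p. \<forall>z\<in>points l1 l2 x. F z = f z}"
      have \<N>: "\<N> \<noteq> {}" using f by (auto simp: trace_W_def \<N>_def)
      have le: "W_tilde m p l1 l2 x f \<le> ennreal (C * n)" if n: "n \<in> \<N>" for n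
      proof -
        obtain F where F: "F \<in> sobolev_W m p" "\<forall>z\<in>points l1 l2 x. F z = f z" "n = sobolev_W_norm m p F"
          using n by (auto simp: \<N>_def)
        have "W_tilde m p l1 l2 x f \<le> ennreal (Ca * n)"
          unfolding Ca_def F(3) by (rule W_tilde_le_sobolev_W_norm[OF F(1) p \<open>m > 0\<close> ext F(2)])
        also have "\<dots> \<le> ennreal (C * n)"
          using sobolev_W_norm_nonneg[of m p F] by (intro ennreal_leI mult_right_mono) (auto simp: C_def F(3))
        finally show ?thesis .
      qed
      obtain n0 where "n0 \<in> \<N>" using \<N> by blast
      then have "W_tilde m p l1 l2 x f < top" using le[of n0] by (auto intro: le_less_trans)
      then obtain w where w: "w \<ge> 0" "W_tilde m p l1 l2 x f = ennreal w" by (metis ennreal_cases less_irrefl)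
      \<comment> \<open>Divided by \<open>C\<close>, the bound holds for the norm of every extension
        and hence for the infimum.\<close>
      have "w / C \<le> n" if "n \<in> \<N>" for n
      proof -
        have "C * n \<ge> 0" using that sobolev_W_norm_nonneg \<open>C \<ge> 1\<close> by (auto simp: \<N>_def)
        then have "w \<le> C * n" using le[OF that] w by simp
        then show ?thesis using \<open>C \<ge> 1\<close> by (simp add: field_simps)
      qed
      then have "w / C \<le> Inf \<N>" using \<N> by (intro cInf_greatest)
      then have "w \<le> C * trace_W_norm m p (points l1 l2 x) f"
        using \<open>C \<ge> 1\<close> by (simp add: \<N>_def trace_W_norm_def field_simps)
      then show ?thesis using w \<open>C \<ge> 1\<close> by (metis ennreal_leI ennreal_mult'' ennreal_mult' le_zero_eq order_trans zero_le_one)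
    qed
    have lower: "\<exists>F\<in>sobolev_W m p. (\<forall>z\<in>points l1 l2 x. F z = f z) \<and> (\<not> right_accumulating l1 l2 x \<longrightarrow>
        ennreal (sobolev_W_norm m p F) \<le> ennreal C * W_tilde m p l1 l2 x f)"
      if W: "W_tilde m p l1 l2 x f < top"
    proof -
      have W_fin: "W_sum m p l1 l2 x f \<noteq> top" using W by (auto simp: W_tilde_def)
      then have "energy p < \<infinity>" using le_less_trans[OF energy, of top] by (simp add: less_top)
      then obtain F where F: "F \<in> sobolev_W m p" "\<And>j. F (y j) = v j"
        "\<not> bdd_above (range y) \<Longrightarrow>
          sobolev_W_norm m p F \<le> real (m + 1) * (C5 m K 1 * C4 (c / 2) * enn2real (energy p) powr (1 / p))"
        using ex_sobolev_interpolant[OF p] by blast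
      have "F (x i) = f (x i)" if "i \<in> indices l1 l2 0" for i
        using F(2)[of i] that ext by (simp add: v_def seq_extension_def)
      then have "\<forall>z\<in>points l1 l2 x. F z = f z" by (auto simp: points_def)
      moreover have "ennreal (sobolev_W_norm m p F) \<le> ennreal C * W_tilde m p l1 l2 x f" if nr: "\<not> right_accumulating l1 l2 x"
      proof -
        define w where "w = enn2real (W_sum m p l1 l2 x f) powr (1 / p)"
        have "enn2real (energy p) \<le> enn2real (W_sum m p l1 l2 x f)"
          using energy W_fin by (intro enn2real_mono) (auto simp: less_top)
        then have e_le: "enn2real (energy p) powr (1 / p) \<le> w"
          unfolding w_def using p by (intro powr_mono2) auto
        have "Cb \<ge> 0" using C5_ge_one[of 1] C4_nonneg[of "c / 2"] c_pos by (simp add: Cb_def)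
        have "sobolev_W_norm m p F \<le> Cb * enn2real (energy p) powr (1 / p)"
          using F(3)[OF seq_extension_unbounded[OF ext ne nr]] by (simp add: Cb_def mult.assoc)
        also have "\<dots> \<le> Cb * w" using e_le \<open>Cb \<ge> 0\<close> by (intro mult_left_mono)
        also have "\<dots> \<le> C * w" by (intro mult_right_mono) (auto simp: C_def w_def)
        finally have "ennreal (sobolev_W_norm m p F) \<le> ennreal (C * w)" by (rule ennreal_leI)
        then show ?thesis using W_fin \<open>C \<ge> 1\<close> by (simp add: W_tilde_def w_def ennreal_mult)
      qed
      ultimately show ?thesis using F(1) by blast
    qed
    have "f \<in> trace_W m p (points l1 l2 x) \<longleftrightarrow> W_tilde m p l1 l2 x f < top"
    proof
      assume "f \<in> trace_W m p (points l1 l2 x)"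
      then show "W_tilde m p l1 l2 x f < top" using upper by (auto simp: ennreal_mult_less_top intro: le_less_trans)
    qed (use lower in \<open>auto simp: trace_W_def\<close>)
    moreover have "ennreal (trace_W_norm m p (points l1 l2 x) f) \<le> ennreal C * W_tilde m p l1 l2 x f"
      if W: "W_tilde m p l1 l2 x f < top" and nr: "\<not> right_accumulating l1 l2 x"
    proof -
      obtain F where "F \<in> sobolev_W m p" "\<forall>z\<in>points l1 l2 x. F z = f z"
        "ennreal (sobolev_W_norm m p F) \<le> ennreal C * W_tilde m p l1 l2 x f"
        using lower[OF W] nr by blast
      then show ?thesis using trace_W_norm_le[of F m p "points l1 l2 x" f] by (meson ennreal_leI order_trans)
    qed
    ultimately show ?thesis using upper by blast
  qed
  show ?thesis using \<open>C \<ge> 1\<close> main by blast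
qed

end
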